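(* Let $d\ge2$, let $\mathcal M\subset\mathbb S^{d-1}$ satisfy assumptions (A1)–(A3) of the context, and let $\Omega=\{r\sigma:r>0,\ \sigma\in\mathcal M\}$. Suppose that $u\in C^\infty(Q_1^\Omega)$ satisfies $$u_t=\Delta u\ \text{ in } Q_1^\Omega,\qquad \lim_{(t,x)\to(t_0,x_0)}u(t,x)=0\ \text{ whenever } 0<t_0\le1,\ x_0\in(\partial\Omega)\cap B_1(0).$$ Then for any $\lambda\in(0,\lambda_0)$ and $R\in(0,1)$, $$|u(t,x)|\le N\Big(\sup_{Q_1^\Omega}|u|\Big)|x|^\lambda\qquad\forall\,(t,x)\in Q_R^\Omega,$$ where $N=N(\Omega,\lambda,R)>0$.
   Context: $\mathbb S^{d-1}=\{x\in\mathbb R^d:|x|=1\}$ with surface measure $A_{\mathbb S}$. For $R\in(0,1]$: $B_R^\Omega=\Omega\cap B_R(0)$, $Q_R^\Omega=(1-R^2,1]\times B_R^\Omega$. Limits are taken for $(t,x)\in Q_1^\Omega$. For $f:\mathcal M\to\mathbb R$ let $F_f(x)=f(x/|x|)$ on $\Omega$; $f\in C^\infty(\mathcal M)$ means $F_f\in C^\infty(\Omega)$; $\nabla_{\mathbb S}f=\nabla F_f|_{\mathcal M}$, $\Delta_{\mathbb S}f=\Delta F_f|_{\mathcal M}$. $\mathring W^1_2(\mathcal M)$ is the closure of $C_c^\infty(\mathcal M)$ in the norm $\|f\|_{L_2(\mathcal M)}+\|\nabla_{\mathbb S}f\|_{L_2(\mathcal M)}$. Put $\partial_{\mathbb S}\mathcal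 M=\overline{\mathcal M}\setminus\mathcal M$ and $$\Lambda_0=\inf_{0\not\equiv w\in C_c^\infty(\mathcal M)}\frac{\int_{\mathcal M}|\nabla_{\mathbb S}w|^2dA_{\mathbb S}}{\int_{\mathcal M}|w|^2dA_{\mathbb S}},\qquad \lambda_0=-\frac{d-2}2+\sqrt{\Lambda_0+\Big(\frac{d-2}2\Big)^2}.$$ $\Lambda_0>0$ is the first Dirichlet eigenvalue of $\Delta_{\mathbb S}$ on $\mathcal M$ (under (A1)), and $w_0$ denotes the unique function in $C^\infty(\mathcal M)\cap\mathring W^1_2(\mathcal M)$ with $w_0>0$, $\int_{\mathcal M}|w_0|^2dA_{\mathbb S}=1$, $\Delta_{\mathbb S}w_0+\Lambda_0w_0=0$. Assumptions on $\mathcal M$: (A1) $\mathcal M$ is a (nonempty) connected relatively open subset of $\mathbb S^{d-1}$ with $\overline{\mathcal M}\ne\mathbb S^{d-1}$. (A2) $\displaystyle\inf_{p\in\partial_{\mathbb S}\mathcal M,\ r\in(0,1]}\frac{A_{\mathbb S}(\{\sigma\in\mathbb S^{d-1}\setminus\mathcal M:|\sigma-p|<r\})}{r^{d-1}}>0$. (A3) There exist constants $A,N>0$ with $w_0(\sigma)\ge N^{-1}d(\sigma,\partial_{\mathbb S}\mathcal M)^A$ for $\sigma\in\mathcal M$. *)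

theory Defs
  imports "HOL-Analysis.Analysis"
begin

section \<open>Smooth functions and the Laplacian\<close>

text \<open>
  Derivatives are taken relative to \<^term>\<open>S\<close>. For open \<^term>\<open>S\<close> this is the usual class of
  \<^term>\<open>k\<close> times continuously differentiable functions. For parabolic cylinders, which contain
  their final time slice, the derivatives on that slice are one-sided in time and continuous up
  to the slice; relative derivatives are still unique there.
\<close>

primrec Ck_on :: "nat \<Rightarrow> 'a::real_normed_vector set \<Rightarrow> ('a \<Rightarrow> real) \<Rightarrow> bool" where
  "Ck_on 0 S f \<longleftrightarrow> continuous_on S f"
| "Ck_on (Suc k) S f \<longleftrightarrow>
     (\<exists>f'. (\<forall>x\<in>S. (f has_derivative f' x) (at x within S)) \<and> (\<forall>v. Ck_on k S (\<lambda>x. f' x v)))"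

definition smooth_on :: "'a::real_normed_vector set \<Rightarrow> ('a \<Rightarrow> real) \<Rightarrow> bool" where
  "smooth_on S f \<longleftrightarrow> (\<forall>k. Ck_on k S f)"

definition partial :: "'a::euclidean_space \<Rightarrow> ('a \<Rightarrow> real) \<Rightarrow> 'a \<Rightarrow> real" where
  "partial b f x = frechet_derivative f (at x) b"

definition grad :: "('a::euclidean_space \<Rightarrow> real) \<Rightarrow> 'a \<Rightarrow> 'a" where
  "grad f x = (\<Sum>b\<in>Basis. partial b f x *\<^sub>R b)"

definition laplacian :: "('a::euclidean_space \<Rightarrow> real) \<Rightarrow> 'a \<Rightarrow> real" where
  "laplacian f x = (\<Sum>b\<in>Basis. partial b (partial b f) x)"


section \<open>Surface measure of the unit sphere\<close>

text \<open>
  Surface measure in polar coordinates: the area of \<^term>\<open>E\<close> is the dimension times the Lebesgue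
  measure of the part of the cone over \<^term>\<open>E\<close> in the unit ball, see
  \<open>emeasure_sphere_area\<close> below. The factor is the one for which
  Lebesgue measure equals \<open>r ^ (d - 1) dr dA\<close>.
\<close>

definition sphere_area :: "'a::euclidean_space measure" where
  "sphere_area = scale_measure (of_nat DIM('a))
     (distr (restrict_space lborel (ball 0 1 - {0})) (restrict_space borel (sphere 0 1))
        (\<lambda>x. x /\<^sub>R norm x))"

definition cone_over :: "'a::real_normed_vector set \<Rightarrow> 'a set" where
  "cone_over M = {r *\<^sub>R \<sigma> | r \<sigma>. 0 < r \<and> \<sigma> \<in> M}"

lemma emeasure_sphere_area:
  fixes E :: "'a::euclidean_space set"
  assumes "E \<in> sets borel" "E \<subseteq> sphere 0 1"
  shows "emeasure sphere_area E = of_nat DIM('a) * emeasure lborel (cone_over E \<inter> ball 0 1)"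
proof -
  have sph: "(\<lambda>x::'a. x /\<^sub>R norm x) \<in> space (restrict_space lborel (ball 0 1 - {0})) \<rightarrow> sphere 0 1"
    by (auto simp: space_restrict_space)
  have meas: "(\<lambda>x::'a. x /\<^sub>R norm x) \<in>
      measurable (restrict_space lborel (ball 0 1 - {0})) (restrict_space borel (sphere 0 1))"
    by (rule measurable_restrict_space2[OF sph]) (auto intro!: measurable_restrict_space1)
  have E: "E \<in> sets (restrict_space borel (sphere (0::'a) 1))"
    using assms by (auto simp: sets_restrict_space)
  have eq: "(\<lambda>x::'a. x /\<^sub>R norm x) -` E \<inter> (ball 0 1 - {0}) = cone_over E \<inter> ball 0 1"
  proof (intro set_eqI iffI)
    fix x assume x: "x \<in> (\<lambda>x::'a. x /\<^sub>R norm x) -` E \<inter> (ball 0 1 - {0})"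
    then have "x = norm x *\<^sub>R (x /\<^sub>R norm x)" by simp
    with x show "x \<in> cone_over E \<inter> ball 0 1"
      unfolding cone_over_def by (auto intro!: exI[of _ "norm x"] exI[of _ "x /\<^sub>R norm x"])
  next
    fix x assume "x \<in> cone_over E \<inter> ball 0 1"
    then obtain r s where rs: "x = r *\<^sub>R s" "0 < r" "s \<in> E" "x \<in> ball 0 1"
      unfolding cone_over_def by auto
    with assms(2) have "norm s = 1" by auto
    with rs have "x /\<^sub>R norm x = s" "x \<noteq> 0" by auto
    with rs show "x \<in> (\<lambda>x. x /\<^sub>R norm x) -` E \<inter> (ball 0 1 - {0})" by auto
  qed
  have "emeasure (distr (restrict_space lborel (ball 0 1 - {0})) (restrict_space borel (sphere 0 1))
        (\<lambda>x::'a. x /\<^sub>R norm x)) E = emeasure lborel (cone_over E \<inter> ball 0 1)"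
    unfolding emeasure_distr[OF meas E]
    by (simp add: space_restrict_space eq)
       (subst emeasure_restrict_space, use eq in auto)
  then show ?thesis by (simp add: sphere_area_def)
qed


section \<open>Function spaces and the first Dirichlet eigenvalue\<close>

text \<open>
  Functions on \<^term>\<open>M\<close> are represented by functions on the ambient space; only their values on
  \<^term>\<open>M\<close> matter.
\<close>

definition radial_ext :: "('a::euclidean_space \<Rightarrow> real) \<Rightarrow> 'a \<Rightarrow> real" where
  "radial_ext f x = f (x /\<^sub>R norm x)"

definition sphere_smooth :: "'a::euclidean_space set \<Rightarrow> ('a \<Rightarrow> real) \<Rightarrow> bool" where
  "sphere_smooth M f \<longleftrightarrow> smooth_on (cone_over M) (radial_ext f)"

definition sphere_grad :: "('a::euclidean_space \<Rightarrow> real) \<Rightarrow> 'a \<Rightarrow> 'a" where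
  "sphere_grad f \<sigma> = grad (radial_ext f) \<sigma>"

definition sphere_laplacian :: "('a::euclidean_space \<Rightarrow> real) \<Rightarrow> 'a \<Rightarrow> real" where
  "sphere_laplacian f \<sigma> = laplacian (radial_ext f) \<sigma>"

definition sphere_Cc_inf :: "'a::euclidean_space set \<Rightarrow> ('a \<Rightarrow> real) set" where
  "sphere_Cc_inf M =
     {f. sphere_smooth M f \<and> (\<exists>K. compact K \<and> K \<subseteq> M \<and> (\<forall>\<sigma>\<in>M - K. f \<sigma> = 0))}"

definition square_integrable ::
    "'a::euclidean_space set \<Rightarrow> ('a \<Rightarrow> 'b::euclidean_space) \<Rightarrow> bool" where
  "square_integrable M f \<longleftrightarrow>
     set_borel_measurable sphere_area M f \<and>
     set_integrable sphere_area M (\<lambda>\<sigma>. (norm (f \<sigma>))\<^sup>2)"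

definition L2_norm :: "'a::euclidean_space set \<Rightarrow> ('a \<Rightarrow> 'b::euclidean_space) \<Rightarrow> real" where
  "L2_norm M f = sqrt (LINT \<sigma>:M|sphere_area. (norm (f \<sigma>))\<^sup>2)"

definition W12_norm :: "'a::euclidean_space set \<Rightarrow> ('a \<Rightarrow> real) \<Rightarrow> real" where
  "W12_norm M f = L2_norm M f + L2_norm M (sphere_grad f)"

text \<open>
  The smooth members of the closure of the test functions in \<^const>\<open>W12_norm\<close>. For smooth
  functions the weak gradient is the classical one, so the norm of the difference can be
  formed with \<^const>\<open>sphere_grad\<close>; square integrability makes that norm meaningful.
\<close>

definition smooth_W12_0 :: "'a::euclidean_space set \<Rightarrow> ('a \<Rightarrow> real) set" where
  "smooth_W12_0 M =
     {f. sphere_smooth M f \<and> square_integrable M f \<and> square_integrable M (sphere_grad f) \<and>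
         (\<exists>\<phi>. (\<forall>n. \<phi> n \<in> sphere_Cc_inf M) \<and>
              (\<lambda>n::nat. W12_norm M (\<lambda>\<sigma>. f \<sigma> - \<phi> n \<sigma>)) \<longlonglongrightarrow> 0)}"

definition Lambda0 :: "'a::euclidean_space set \<Rightarrow> real" where
  "Lambda0 M =
     (INF w \<in> {w \<in> sphere_Cc_inf M. \<exists>\<sigma>\<in>M. w \<sigma> \<noteq> 0}.
        (LINT \<sigma>:M|sphere_area. (norm (sphere_grad w \<sigma>))\<^sup>2) /
        (LINT \<sigma>:M|sphere_area. \<bar>w \<sigma>\<bar>\<^sup>2))"

definition lambda0 :: "'a::euclidean_space set \<Rightarrow> real" where
  "lambda0 M =
     - (real DIM('a) - 2) / 2 + sqrt (Lambda0 M + ((real DIM('a) - 2) / 2)\<^sup>2)"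

definition first_eigenfunction :: "'a::euclidean_space set \<Rightarrow> ('a \<Rightarrow> real) \<Rightarrow> bool" where
  "first_eigenfunction M w \<longleftrightarrow>
     w \<in> smooth_W12_0 M \<and>
     (\<forall>\<sigma>\<in>M. 0 < w \<sigma>) \<and>
     (LINT \<sigma>:M|sphere_area. \<bar>w \<sigma>\<bar>\<^sup>2) = 1 \<and>
     (\<forall>\<sigma>\<in>M. sphere_laplacian w \<sigma> + Lambda0 M * w \<sigma> = 0)"


section \<open>Assumptions on the spherical domain\<close>

definition sphere_boundary :: "'a::euclidean_space set \<Rightarrow> 'a set" where
  "sphere_boundary M = closure M - M"

definition assumption_A1 :: "'a::euclidean_space set \<Rightarrow> bool" where
  "assumption_A1 M \<longleftrightarrow>
     M \<noteq> {} \<and> connected M \<and> openin (top_of_set (sphere 0 1)) M \<and> closure M \<noteq> sphere 0 1"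

text \<open>
  Under the first assumption and in dimension at least two the boundary is nonempty, so the real
  infimum below is over a nonempty set of nonnegative numbers.
\<close>

definition assumption_A2 :: "'a::euclidean_space set \<Rightarrow> bool" where
  "assumption_A2 M \<longleftrightarrow>
     0 < (INF (p, r) \<in> sphere_boundary M \<times> {0<..1::real}.
            measure sphere_area {\<sigma> \<in> sphere 0 1 - M. norm (\<sigma> - p) < r} / r ^ (DIM('a) - 1))"

definition assumption_A3 :: "'a::euclidean_space set \<Rightarrow> ('a \<Rightarrow> real) \<Rightarrow> bool" where
  "assumption_A3 M w \<longleftrightarrow>
     (\<exists>A>0. \<exists>N>0. \<forall>\<sigma>\<in>M. inverse N * infdist \<sigma> (sphere_boundary M) powr A \<le> w \<sigma>)"


section \<open>Parabolic cylinders and the Dirichlet problem for the heat equation\<close>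

definition cylinder :: "'a::euclidean_space set \<Rightarrow> real \<Rightarrow> (real \<times> 'a) set" where
  "cylinder \<Omega> R = {1 - R\<^sup>2<..1} \<times> (\<Omega> \<inter> ball 0 R)"

text \<open>At the final time \<open>t = 1\<close> the time derivative is the left derivative.\<close>

definition heat_solution :: "'a::euclidean_space set \<Rightarrow> (real \<times> 'a \<Rightarrow> real) \<Rightarrow> bool" where
  "heat_solution \<Omega> u \<longleftrightarrow>
     (\<forall>(t, x) \<in> cylinder \<Omega> 1.
        ((\<lambda>s. u (s, x)) has_real_derivative laplacian (\<lambda>y. u (t, y)) x) (at t within {0<..1}))"

definition zero_lateral_values :: "'a::euclidean_space set \<Rightarrow> (real \<times> 'a \<Rightarrow> real) \<Rightarrow> bool" where
  "zero_lateral_values \<Omega> u \<longleftrightarrow>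
     (\<forall>t0 x0. 0 < t0 \<and> t0 \<le> 1 \<and> x0 \<in> frontier \<Omega> \<inter> ball 0 1 \<longrightarrow>
        (u \<longlongrightarrow> 0) (at (t0, x0) within cylinder \<Omega> 1))"

end

theory Submission
  imports Defs "HOL-Computational_Algebra.Polynomial" "HOL-Real_Asymp.Real_Asymp"
begin

text \<open>
  A smooth convex truncation \<open>v\<close> of \<open>u\<close> at a positive level, extended by zero, is a nonnegative
  subsolution of the heat equation in the whole unit ball that vanishes near the vertex, and its
  restrictions to spheres are test functions for \<open>\<Lambda>\<^sub>0\<close>. Splitting \<open>|\<nabla>v|\<^sup>2\<close> into a spherical part,
  bounded below by \<open>\<Lambda>\<^sub>0 v\<^sup>2 / |x|\<^sup>2\<close>, and a radial part, to which the square
  \<open>(v\<^sub>r - \<lambda> v / r)\<^sup>2 \<ge> 0\<close> applies, shows that \<open>\<integral> v\<^sup>2 p(t, |x|\<^sup>2) dx\<close> grows no faster than if \<open>v\<^sup>2\<close> were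
  a radial subsolution in dimension \<open>D = d + 2 \<lambda>\<close>, because \<open>\<lambda> (\<lambda> + d - 2) \<le> \<Lambda>\<^sub>0\<close>. Testing with the
  backward heat kernel of dimension \<open>D\<close> gives \<open>\<integral> v\<^sup>2 dx \<le> N \<rho>\<^sup>D sup |u|\<^sup>2\<close> over the ball of radius \<open>\<rho>\<close>
  at each time, and testing with the heat kernel of dimension \<open>d\<close> centred at a point at distance \<open>\<rho>\<close>
  from the vertex turns this into \<open>v\<^sup>2 \<le> N \<rho> powr (2 \<lambda>) sup |u|\<^sup>2\<close> there.
\<close>

section \<open>Smooth functions and smooth truncation\<close>

text \<open>No regularity of \<open>u\<close> up to the lateral boundary is available, so integral
  identities cannot be applied to \<open>u\<close> itself. Cutting at a positive level discards a
  neighbourhood of that boundary and of the vertex, and all bounds are uniform in the level, which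
  tends to zero only at the very end. The truncation has to be convex, to preserve subsolutions, and
  infinitely smooth, because only smooth functions compete in \<open>Lambda0\<close>. The exponent
  \<open>lambda0\<close> is the larger root of \<open>s * (s + d - 2) = Lambda0 M\<close>: for this
  \<open>s\<close>, the function r^s times the first eigenfunction is formally harmonic in the cone.
  A function of size r^\<lambda> has a squared mass of order \<rho>^D with
  \<open>D = d + 2 * \<lambda>\<close>, as if space had dimension \<open>D\<close>; a kernel of that
  dimension is bounded long before its pole and of order \<rho>^(-D) shortly before it, and
  comparing the two times yields the factor \<rho>^D. The poles come arbitrarily close to the final
  time, so the commutator of kernel and cutoff must stay bounded there. This forces a cutoff that is
  flat at its centre to an order of at least about \<open>D / 2\<close>, a requirement that fixes
  the parameter \<open>n\<close>.\<close>

lemma Ck_on_Suc_I: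
  assumes "\<And>x. x \<in> S \<Longrightarrow> (f has_derivative f' x) (at x within S)"
    and "\<And>v. Ck_on k S (\<lambda>x. f' x v)"
  shows "Ck_on (Suc k) S f"
  using assms by auto

lemma Ck_on_cong:
  assumes "\<And>x. x \<in> S \<Longrightarrow> f x = g x"
  shows "Ck_on k S f \<longleftrightarrow> Ck_on k S g"
proof (cases k)
  case 0
  then show ?thesis using assms by (simp cong: continuous_on_cong)
next
  case (Suc n)
  have "(f has_derivative d) (at x within S) \<longleftrightarrow> (g has_derivative d) (at x within S)"
    if "x \<in> S" for x d
    using has_derivative_transform[OF that, of g f] has_derivative_transform[OF that, of f g] assms
    by metis
  then show ?thesis using Suc by simp
qed

lemma Ck_on_imp_continuous_on: "Ck_on k S f \<Longrightarrow> continuous_on S f"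
proof (cases k)
  case (Suc n)
  assume "Ck_on k S f"
  then show ?thesis
    using Suc by (auto simp: continuous_on_eq_continuous_within intro: has_derivative_continuous)
qed simp

lemma Ck_on_Suc_D: "Ck_on (Suc k) S f \<Longrightarrow> Ck_on k S f"
proof (induction k arbitrary: f)
  case 0
  then show ?case using Ck_on_imp_continuous_on by fastforce
next
  case (Suc k)
  from Suc.prems obtain f' where f': "\<And>x. x \<in> S \<Longrightarrow> (f has_derivative f' x) (at x within S)"
    "\<And>v. Ck_on (Suc k) S (\<lambda>x. f' x v)"
    unfolding Ck_on.simps(2)[of "Suc k"] by blast
  then show ?case by (blast intro: Ck_on_Suc_I[where f' = f'] Suc.IH)
qed

lemma Ck_on_const: "Ck_on k S (\<lambda>_. c)"
  by (induction k arbitrary: c) (auto intro!: exI[of _ "\<lambda>_ _. 0"])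

lemma Ck_on_linear:
  assumes "bounded_linear f"
  shows "Ck_on k S f"
proof (cases k)
  case 0
  then show ?thesis using assms by (simp add: linear_continuous_on)
next
  case (Suc n)
  then show ?thesis
    using assms Ck_on_const bounded_linear_imp_has_derivative[OF assms]
    by (auto intro!: exI[of _ "\<lambda>_. f"])
qed

lemma Ck_on_add: "Ck_on k S f \<Longrightarrow> Ck_on k S g \<Longrightarrow> Ck_on k S (\<lambda>x. f x + g x)"
proof (induction k arbitrary: f g)
  case 0
  then show ?case by (auto intro: continuous_intros)
next
  case (Suc k)
  then obtain f' g' where
    "\<And>x. x \<in> S \<Longrightarrow> (f has_derivative f' x) (at x within S)" "\<And>v. Ck_on k S (\<lambda>x. f' x v)"
    "\<And>x. x \<in> S \<Longrightarrow> (g has_derivative g' x) (at x within S)" "\<And>v. Ck_on k S (\<lambda>x. g' x v)"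
    unfolding Ck_on.simps by metis
  note d = this
  show ?case
  proof (rule Ck_on_Suc_I)
    show "((\<lambda>x. f x + g x) has_derivative (\<lambda>v. f' x v + g' x v)) (at x within S)"
      if "x \<in> S" for x
      using that d by (intro has_derivative_add) auto
    show "Ck_on k S (\<lambda>x. f' x v + g' x v)" for v
      by (rule Suc.IH) (use d in auto)
  qed
qed

lemma Ck_on_sum: "(\<And>i. i \<in> A \<Longrightarrow> Ck_on k S (f i)) \<Longrightarrow> Ck_on k S (\<lambda>x. \<Sum>i\<in>A. f i x)"
  by (induction A rule: infinite_finite_induct) (auto intro: Ck_on_const Ck_on_add)

lemma Ck_on_mult: "Ck_on k S f \<Longrightarrow> Ck_on k S g \<Longrightarrow> Ck_on k S (\<lambda>x. f x * g x)"
proof (induction k arbitrary: f g)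
  case 0
  then show ?case by (auto intro: continuous_intros)
next
  case (Suc k)
  then obtain f' g' where d:
    "\<And>x. x \<in> S \<Longrightarrow> (f has_derivative f' x) (at x within S)" "\<And>v. Ck_on k S (\<lambda>x. f' x v)"
    "\<And>x. x \<in> S \<Longrightarrow> (g has_derivative g' x) (at x within S)" "\<And>v. Ck_on k S (\<lambda>x. g' x v)"
    unfolding Ck_on.simps by metis
  have fg: "Ck_on k S f" "Ck_on k S g" using Suc.prems Ck_on_Suc_D by blast+
  show ?case
  proof (rule Ck_on_Suc_I)
    show "((\<lambda>x. f x * g x) has_derivative (\<lambda>v. f x * g' x v + f' x v * g x)) (at x within S)"
      if "x \<in> S" for x
      using that d by (intro has_derivative_mult) auto
    show "Ck_on k S (\<lambda>x. f x * g' x v + f' x v * g x)" for v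
      by (rule Ck_on_add[OF Suc.IH Suc.IH]) (use d fg in auto)
  qed
qed

text \<open>The inner map is smooth of every order, given componentwise, so that its hypothesis
  stays fixed while the induction runs over \<open>k\<close> and \<open>f\<close>: the chain rule
  writes the new derivative as a sum of products of components of the derivative of \<open>P\<close>
  with \<open>f'\<close> composed with \<open>P\<close>. The sets may fail to be open, which admits
  cylinders containing their final time slice.\<close>

lemma Ck_on_compose:
  fixes P :: "'c::real_normed_vector \<Rightarrow> 'b::euclidean_space"
  assumes P: "\<And>b k. b \<in> Basis \<Longrightarrow> Ck_on k S (\<lambda>x. P x \<bullet> b)" and im: "P ` S \<subseteq> T"
  shows "Ck_on k T f \<Longrightarrow> Ck_on k S (\<lambda>x. f (P x))"
proof (induction k arbitrary: f)
  case 0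
  have "continuous_on S P"
    using P[of _ 0] by (subst continuous_on_componentwise) simp
  then show ?case using 0 im by (auto intro: continuous_on_compose2)
next
  case (Suc k)
  then obtain f' where f': "\<And>x. x \<in> T \<Longrightarrow> (f has_derivative f' x) (at x within T)"
    "\<And>v. Ck_on k T (\<lambda>x. f' x v)"
    by auto
  have "\<forall>b\<in>Basis. \<exists>P'. (\<forall>x\<in>S. ((\<lambda>x. P x \<bullet> b) has_derivative P' x) (at x within S)) \<and>
      (\<forall>v. Ck_on k S (\<lambda>x. P' x v))"
    using P[of _ "Suc k"] by auto
  then obtain P' where P':
    "\<And>b x. b \<in> Basis \<Longrightarrow> x \<in> S \<Longrightarrow> ((\<lambda>x. P x \<bullet> b) has_derivative P' b x) (at x within S)"
    "\<And>b v. b \<in> Basis \<Longrightarrow> Ck_on k S (\<lambda>x. P' b x v)"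
    by metis
  define DP where "DP x v = (\<Sum>b\<in>Basis. P' b x v *\<^sub>R b)" for x v
  have DP: "(P has_derivative DP x) (at x within S)" if "x \<in> S" for x
    using P'(1) that
    by (subst has_derivative_componentwise_within) (auto simp: DP_def inner_sum_left_Basis)
  have "Ck_on k S (\<lambda>x. \<Sum>b\<in>Basis. P' b x v * f' (P x) b)" for v
    by (intro Ck_on_sum Ck_on_mult P'(2) Suc.IH f'(2))
  \<comment> \<open>Off \<open>T\<close> nothing is known about \<open>f'\<close>, so linearity is
    at hand only for \<open>x\<close> in \<open>S\<close>; the formula is transferred by
    \<open>Ck_on_cong\<close>.\<close>
  moreover have "f' (P x) (DP x v) = (\<Sum>b\<in>Basis. P' b x v * f' (P x) b)" if "x \<in> S" for x v
  proof -
    interpret bounded_linear "f' (P x)"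
      using f'(1)[of "P x"] im that has_derivative_bounded_linear by blast
    show ?thesis by (simp add: DP_def sum scale)
  qed
  ultimately have "Ck_on k S (\<lambda>x. f' (P x) (DP x v))" for v
    by (subst Ck_on_cong) auto
  moreover have "((\<lambda>x. f (P x)) has_derivative (\<lambda>v. f' (P x) (DP x v))) (at x within S)"
    if "x \<in> S" for x
    using has_derivative_in_compose2[of T f f' P S x "DP x"] f'(1) im DP[OF that] that by blast
  ultimately show ?case
    using Ck_on_Suc_I[where f' = "\<lambda>x v. f' (P x) (DP x v)"] by blast
qed

text \<open>Differentiation lowers the exponent by one, hence the induction over all real exponents.
  The case \<open>- 1 / 2\<close> later makes the projection to the sphere smooth away from the
  origin.\<close>

lemma Ck_on_inner_self_powr:
  fixes S :: "'a::real_inner set"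
  assumes "0 \<notin> S"
  shows "Ck_on k S (\<lambda>x. (x \<bullet> x) powr s)"
proof (induction k arbitrary: s)
  case 0
  then show ?case using assms by (auto intro!: continuous_intros)
next
  case (Suc k)
  have "Ck_on k S (\<lambda>x. (2 * s) * (x \<bullet> v) * (x \<bullet> x) powr (s - 1))" for v
    by (intro Ck_on_mult Ck_on_const Suc.IH Ck_on_linear bounded_linear_inner_left)
  moreover have "((\<lambda>x. (x \<bullet> x) powr s) has_derivative
      (\<lambda>v. (2 * s) * (x \<bullet> v) * (x \<bullet> x) powr (s - 1))) (at x within S)" if "x \<in> S" for x
  proof -
    have "x \<bullet> x > 0" using that assms by auto
    then show ?thesis
      using that assms
      by (auto intro!: derivative_eq_intros simp: inner_commute powr_diff divide_simps)
  qed
  ultimately show ?case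
    using Ck_on_Suc_I[where f' = "\<lambda>x v. (2 * s) * (x \<bullet> v) * (x \<bullet> x) powr (s - 1)"] by blast
qed

lemma smooth_on_compose:
  fixes P :: "'c::real_normed_vector \<Rightarrow> 'b::euclidean_space"
  assumes "\<And>b k. b \<in> Basis \<Longrightarrow> Ck_on k S (\<lambda>x. P x \<bullet> b)" "P ` S \<subseteq> T" "smooth_on T f"
  shows "smooth_on S (\<lambda>x. f (P x))"
  using Ck_on_compose[OF assms(1,2)] assms(3) by (auto simp: smooth_on_def)

section \<open>Functions flat at zero and a convex truncation built from them\<close>

definition flat_exp :: "real \<Rightarrow> real poly \<Rightarrow> real \<Rightarrow> real" where
  "flat_exp \<delta> p s = (if s > 0 then poly p (inverse s) * exp (- \<delta> / s) else 0)"

lemma flat_exp_tendsto_0: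
  assumes "\<delta> > 0"
  shows "((\<lambda>s. poly p (inverse s) * exp (- \<delta> / s)) \<longlongrightarrow> 0) (at_right (0::real))"
proof -
  have m: "((\<lambda>x. x ^ k * exp (- \<delta> * x)) \<longlongrightarrow> 0) at_top" for k
    using assms by real_asymp
  have "((\<lambda>x. \<Sum>i\<le>degree p. coeff p i * (x ^ i * exp (- \<delta> * x))) \<longlongrightarrow>
      (\<Sum>i\<le>degree p. coeff p i * 0)) at_top"
    by (intro tendsto_sum tendsto_mult tendsto_const m)
  then have "((\<lambda>x. poly p x * exp (- \<delta> * x)) \<longlongrightarrow> 0) at_top"
    by (simp add: poly_altdef sum_distrib_right mult.assoc)
  then show ?thesis
    by (subst (asm) filterlim_at_top_to_right) (simp add: divide_inverse)
qed

text \<open>In the variable X = 1/s, differentiation turns p(X) exp(-\<delta> X) into X^2 (\<delta>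
  p - p')(X) exp(-\<delta> X). The family is thus closed under differentiation, and smoothness
  follows by induction with the polynomial generalised.\<close>

lemma flat_exp_deriv:
  assumes "\<delta> > 0"
  shows "(flat_exp \<delta> p has_real_derivative
    flat_exp \<delta> ([:0, 0, 1:] * (smult \<delta> p - pderiv p)) s) (at s)"
proof -
  consider "s > 0" | "s < 0" | "s = 0" by linarith
  then show ?thesis
  proof cases
    case 1
    have "((\<lambda>s. poly p (inverse s) * exp (- \<delta> / s)) has_real_derivative
      flat_exp \<delta> ([:0, 0, 1:] * (smult \<delta> p - pderiv p)) s) (at s)"
      using 1 by (auto intro!: derivative_eq_intros DERIV_chain2[of "poly p"] poly_DERIV
          simp: flat_exp_def divide_inverse power2_eq_square algebra_simps)
    then show ?thesis
      by (rule has_field_derivative_transform_within_open[where S = "{0<..}"])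
        (use 1 in \<open>auto simp: flat_exp_def\<close>)
  next
    case 2
    have "((\<lambda>s. 0) has_real_derivative flat_exp \<delta> ([:0, 0, 1:] * (smult \<delta> p - pderiv p)) s) (at s)"
      using 2 by (simp add: flat_exp_def)
    then show ?thesis
      by (rule has_field_derivative_transform_within_open[where S = "{..<0}"])
        (use 2 in \<open>auto simp: flat_exp_def\<close>)
  next
    case 3
    \<comment> \<open>The right difference quotient at the junction belongs to the same family, with
      polynomial \<open>[:0, 1:] * p\<close>, and so tends to zero.\<close>
    have "((\<lambda>h. flat_exp \<delta> p h / h) \<longlongrightarrow> 0) (at_right 0)"
    proof (rule Lim_transform_eventually[OF flat_exp_tendsto_0[OF assms, of "[:0, 1:] * p"]])
      show "\<forall>\<^sub>F s in at_right 0. poly ([:0, 1:] * p) (inverse s) * exp (- \<delta> / s) = flat_exp \<delta> p s / s"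
        by (auto simp: eventually_at_filter flat_exp_def field_simps)
    qed
    moreover have "((\<lambda>h. flat_exp \<delta> p h / h) \<longlongrightarrow> 0) (at_left 0)"
      by (rule Lim_transform_eventually[OF tendsto_const])
        (auto simp: eventually_at_filter flat_exp_def)
    ultimately have "((\<lambda>h. flat_exp \<delta> p h / h) \<longlongrightarrow> 0) (at 0)"
      by (simp add: filterlim_split_at)
    then show ?thesis using 3 by (simp add: DERIV_def flat_exp_def)
  qed
qed

lemma Ck_on_flat_exp:
  assumes "\<delta> > 0"
  shows "Ck_on k UNIV (flat_exp \<delta> p)"
proof (induction k arbitrary: p)
  case 0
  show ?case
    using DERIV_continuous[OF flat_exp_deriv[OF assms]]
    by (simp add: continuous_on_eq_continuous_within)
next
  case (Suc k)
  let ?q = "[:0, 0, 1:] * (smult \<delta> p - pderiv p)"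
  show ?case
  proof (rule Ck_on_Suc_I)
    show "(flat_exp \<delta> p has_derivative (\<lambda>v. flat_exp \<delta> ?q s * v)) (at s)" for s
      using flat_exp_deriv[OF assms, of p s] by (simp add: has_field_derivative_def)
    show "Ck_on k UNIV (\<lambda>s. flat_exp \<delta> ?q s * v)" for v
      by (rule Ck_on_mult[OF Suc Ck_on_const])
  qed
qed

text \<open>The truncation \<open>s exp (- \<delta> / s)\<close> is convex on the whole half-line, unlike \<open>exp (- \<delta> / s)\<close>.\<close>

definition trunc :: "real \<Rightarrow> real \<Rightarrow> real" where
  "trunc \<delta> s = s * flat_exp \<delta> 1 s"

definition trunc1 :: "real \<Rightarrow> real \<Rightarrow> real" where
  "trunc1 \<delta> s = flat_exp \<delta> [:1, \<delta>:] s"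

text \<open>The second derivative of \<open>trunc\<close>, equal to
  \<open>\<delta>\<^sup>2 / s ^ 3 * exp (- \<delta> / s)\<close> for positive \<open>s\<close>; the
  polynomial has no negative coefficient, which is the convexity of the truncation.\<close>

definition trunc2 :: "real \<Rightarrow> real \<Rightarrow> real" where
  "trunc2 \<delta> s = flat_exp \<delta> [:0, 0, 0, \<delta>\<^sup>2:] s"

context
  fixes \<delta> :: real
  assumes \<delta>: "\<delta> > 0"
begin

lemma smooth_on_trunc: "smooth_on UNIV (trunc \<delta>)"
  unfolding smooth_on_def trunc_def
  by (intro allI Ck_on_mult Ck_on_flat_exp[OF \<delta>] Ck_on_linear bounded_linear_ident)

lemma trunc_deriv: "(trunc \<delta> has_real_derivative trunc1 \<delta> s) (at s)"
proof -
  have "((\<lambda>s. s * flat_exp \<delta> 1 s) has_real_derivative trunc1 \<delta> s) (at s)"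
    by (rule derivative_eq_intros flat_exp_deriv[OF \<delta>] refl)+
      (auto simp: trunc1_def flat_exp_def field_simps power2_eq_square)
  then show ?thesis unfolding trunc_def[abs_def] .
qed

lemma trunc1_deriv: "(trunc1 \<delta> has_real_derivative trunc2 \<delta> s) (at s)"
proof -
  have "flat_exp \<delta> ([:0, 0, 1:] * (smult \<delta> [:1, \<delta>:] - pderiv [:1, \<delta>:])) s = trunc2 \<delta> s"
    by (simp add: trunc2_def pderiv_pCons power2_eq_square)
  then show ?thesis using flat_exp_deriv[OF \<delta>, of "[:1, \<delta>:]" s] by (simp add: trunc1_def[abs_def])
qed

lemma continuous_on_trunc:
  "continuous_on A (trunc \<delta>)" "continuous_on A (trunc1 \<delta>)" "continuous_on A (trunc2 \<delta>)"
  using DERIV_continuous[OF trunc_deriv] DERIV_continuous[OF trunc1_deriv]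
    DERIV_continuous[OF flat_exp_deriv[OF \<delta>, of "[:0, 0, 0, \<delta>\<^sup>2:]"]]
  by (auto simp: trunc2_def[abs_def] intro!: continuous_at_imp_continuous_on)

lemma trunc2_nonneg: "0 \<le> trunc2 \<delta> s"
  using \<delta> by (auto simp: trunc2_def flat_exp_def)

text \<open>The last bound is \<open>1 + y \<le> exp y\<close> at \<open>y = - \<delta> / s\<close>.
  It says that truncation costs at most \<delta>, so that it can be undone by letting \<delta> tend
  to zero.\<close>

lemma trunc_bounds: "0 \<le> trunc \<delta> s" "0 \<le> B \<Longrightarrow> s \<le> B \<Longrightarrow> trunc \<delta> s \<le> B" "s - \<delta> \<le> trunc \<delta> s"
proof -
  show "0 \<le> trunc \<delta> s" by (simp add: trunc_def flat_exp_def)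
  show "trunc \<delta> s \<le> B" if "0 \<le> B" "s \<le> B"
  proof (cases "s > 0")
    case True
    then have "trunc \<delta> s \<le> s * 1" using \<delta>
      unfolding trunc_def flat_exp_def by (intro mult_left_mono) auto
    with that show ?thesis by simp
  qed (use that in \<open>simp add: trunc_def flat_exp_def\<close>)
  show "s - \<delta> \<le> trunc \<delta> s"
  proof (cases "s > 0")
    case True
    then have "s * (1 + (- \<delta> / s)) \<le> s * exp (- \<delta> / s)"
      by (intro mult_left_mono exp_ge_add_one_self) auto
    with True show ?thesis by (simp add: trunc_def flat_exp_def algebra_simps)
  qed (use \<delta> in \<open>simp add: trunc_def flat_exp_def\<close>)
qed

end

section \<open>Integration by parts and polar coordinates\<close>

lemma integral_translate:
  fixes f :: "'a::euclidean_space \<Rightarrow> real"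
  assumes "f \<in> borel_measurable borel"
  shows "(LINT x|lborel. f (x + c)) = (LINT x|lborel. f x)"
proof -
  have "(LINT x|lborel. f x) = (LINT x|distr lborel borel ((+) c). f x)"
    by (simp add: lborel_distr_plus)
  also have "\<dots> = (LINT x|lborel. f (c + x))"
    by (rule integral_distr) (use assms in auto)
  finally show ?thesis by (simp add: add.commute)
qed

text \<open>Difference quotients of an integrable function integrate to zero by translation
  invariance. Since \<open>f\<close> is Lipschitz along \<open>b\<close>, dominated convergence
  carries this over to the derivative. Only the direction \<open>b\<close> enters, so a divergence
  theorem for fields follows component by component.\<close>

lemma integral_directional_derivative_eq_0:
  fixes f g :: "'a::euclidean_space \<Rightarrow> real"
  assumes K: "compact K" and supp: "\<And>x. x \<notin> K \<Longrightarrow> f x = 0"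
    and contf: "continuous_on K f" and contg: "continuous_on K g"
    and deriv: "\<And>x. x \<in> K \<Longrightarrow> ((\<lambda>s. f (x + s *\<^sub>R b)) has_real_derivative g x) (at 0)"
  shows "(LINT x:K|lborel. g x) = 0"
proof -
  \<comment> \<open>Off \<open>K\<close> the function vanishes on an open set, so \<open>g\<close>
    extended by zero is the derivative along \<open>b\<close> at every point.\<close>
  define g0 where "g0 x = indicator K x * g x" for x
  have d0: "((\<lambda>s. f (x + s *\<^sub>R b)) has_real_derivative g0 x) (at 0)" for x
  proof (cases "x \<in> K")
    case False
    define S where "S = (\<lambda>s::real. x + s *\<^sub>R b) -` (- K)"
    have "open S" unfolding S_def
      using K by (intro open_vimage continuous_intros) (simp add: compact_imp_closed open_Compl)
    moreover have "0 \<in> S" using False by (simp add: S_def)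
    ultimately have S: "open S" "0 \<in> S" "\<And>s. s \<in> S \<Longrightarrow> x + s *\<^sub>R b \<notin> K"
      by (auto simp: S_def)
    have "((\<lambda>s. 0) has_real_derivative g0 x) (at 0)" using False by (simp add: g0_def)
    then show ?thesis
      by (rule has_field_derivative_transform_within_open[OF _ S(1,2)]) (simp add: S(3) supp)
  qed (use deriv in \<open>simp add: g0_def\<close>)
  have d: "((\<lambda>s. f (x + s *\<^sub>R b)) has_real_derivative g0 (x + s *\<^sub>R b)) (at s)" for x s
    using d0[of "x + s *\<^sub>R b"] DERIV_shift[of "\<lambda>s. f (x + s *\<^sub>R b)" _ 0 s]
    by (simp add: algebra_simps)
  obtain B0 where B0: "\<And>x. x \<in> K \<Longrightarrow> norm (g x) \<le> B0"
    using compact_imp_bounded[OF compact_continuous_image[OF contg K]]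
    by (auto simp: bounded_iff)
  define B where "B = max B0 0"
  have B: "norm (g0 x) \<le> B" "B \<ge> 0" for x
    using B0 by (force simp: B_def g0_def indicator_def)+
  have lip: "norm (f (x + h *\<^sub>R b) - f x) \<le> B * norm h" for x h
    using field_differentiable_bound[of UNIV "\<lambda>s. f (x + s *\<^sub>R b)" "\<lambda>s. g0 (x + s *\<^sub>R b)" B h 0] d B
    by simp
  have intf: "integrable lborel f"
  proof -
    have "integrable lborel (\<lambda>x. indicator K x *\<^sub>R f x)"
      using borel_integrable_compact[OF K contf] .
    also have "(\<lambda>x. indicator K x *\<^sub>R f x) = f" using supp by (intro ext) (simp split: split_indicator)
    finally show ?thesis .
  qed
  then have mf [measurable]: "f \<in> borel_measurable borel" by auto
  have intg: "integrable lborel g0"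
    using borel_integrable_compact[OF K contg] by (simp add: g0_def[abs_def])
  obtain r where r: "K \<subseteq> cball 0 r"
    using compact_imp_bounded[OF K] by (force simp: bounded_iff)
  define h where "h n = inverse (real (Suc n))" for n
  define D where "D n x = (f (x + h n *\<^sub>R b) - f x) / h n" for n x
  have h: "h n > 0" "h n \<le> 1" for n by (auto simp: h_def field_simps)
  have "(\<lambda>n. LINT x|lborel. D n x) \<longlonglongrightarrow> (LINT x|lborel. g0 x)"
  proof (rule integral_dominated_convergence[where w = "\<lambda>x. indicator (cball 0 (r + norm b)) x *\<^sub>R B"])
    \<comment> \<open>The dominating function lives on a ball enlarged by \<open>norm b\<close>,
      because a shift by \<open>h n *\<^sub>R b\<close> with \<open>h n \<le> 1\<close> moves the
      support no further.\<close>
    show "integrable lborel (\<lambda>x. indicator (cball (0::'a) (r + norm b)) x *\<^sub>R B)"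
      by (intro borel_integrable_compact continuous_intros) auto
    show "AE x in lborel. (\<lambda>n. D n x) \<longlonglongrightarrow> g0 x"
    proof (rule AE_I2)
      fix x
      have "h \<longlonglongrightarrow> 0" unfolding h_def by (rule LIMSEQ_inverse_real_of_nat)
      then have "filterlim h (at 0) sequentially"
        by (rule filterlim_atI) (use h in \<open>auto simp: less_imp_neq[THEN not_sym]\<close>)
      then show "(\<lambda>n. D n x) \<longlonglongrightarrow> g0 x"
        using d0[of x] unfolding DERIV_def D_def by (auto dest: filterlim_compose)
    qed
    show "AE x in lborel. norm (D n x) \<le> indicator (cball 0 (r + norm b)) x *\<^sub>R B" for n
    proof (rule AE_I2)
      fix x
      show "norm (D n x) \<le> indicator (cball 0 (r + norm b)) x *\<^sub>R B"
      proof (cases "x \<in> cball 0 (r + norm b)")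
        case True
        then show ?thesis using lip[of x "h n"] h[of n]
          by (simp add: D_def divide_simps)
      next
        case False
        then have nx: "norm x > r + norm b" by simp
        have "norm x \<le> norm (x + h n *\<^sub>R b) + norm (h n *\<^sub>R b)"
          by (metis add_diff_cancel norm_triangle_ineq4)
        moreover have "norm (h n *\<^sub>R b) \<le> norm b"
          using h[of n] by (simp add: mult_left_le_one_le)
        ultimately have "x + h n *\<^sub>R b \<notin> K" using nx r by force
        moreover have "x \<notin> K" using nx r norm_ge_zero[of b] by (smt (verit) mem_cball_0 subsetD)
        ultimately show ?thesis using supp False by (simp add: D_def)
      qed
    qed
    show "D n \<in> borel_measurable lborel" for n unfolding D_def by measurable
    show "g0 \<in> borel_measurable lborel" using intg by auto
  qed
  moreover have "(LINT x|lborel. D n x) = 0" for n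
  proof -
    have i: "integrable lborel (\<lambda>x. f (x + h n *\<^sub>R b))"
    proof -
      have "integrable (distr lborel borel ((+) (h n *\<^sub>R b))) f" using intf by (simp add: lborel_distr_plus)
      then show ?thesis by (subst (asm) integrable_distr_eq) (auto simp: add.commute)
    qed
    show ?thesis unfolding D_def
      using i intf integral_translate[OF mf, of "h n *\<^sub>R b"] by simp
  qed
  ultimately have "(\<lambda>n::nat. 0) \<longlonglongrightarrow> (LINT x|lborel. g0 x)" by simp
  then have "(LINT x|lborel. g0 x) = 0"
    using LIMSEQ_unique tendsto_const by blast
  then show ?thesis by (simp add: set_lebesgue_integral_def g0_def)
qed

section \<open>Surface measure and integration in polar coordinates\<close>

lemma nn_integral_sphere_area:
  fixes f :: "'a::euclidean_space \<Rightarrow> ennreal"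
  assumes f: "f \<in> borel_measurable borel"
  shows "(\<integral>\<^sup>+x. f x \<partial>sphere_area) =
    of_nat DIM('a) * (\<integral>\<^sup>+x. f (x /\<^sub>R norm x) * indicator (ball 0 1 - {0}) x \<partial>lborel)"
proof -
  have sph: "(\<lambda>x::'a. x /\<^sub>R norm x) \<in> space (restrict_space lborel (ball 0 1 - {0})) \<rightarrow> sphere 0 1"
    by (auto simp: space_restrict_space)
  have m1: "(\<lambda>x::'a. x /\<^sub>R norm x) \<in>
      measurable (restrict_space lborel (ball 0 1 - {0})) (restrict_space borel (sphere 0 1))"
    by (rule measurable_restrict_space2[OF sph]) (auto intro!: measurable_restrict_space1)
  have m2: "f \<in> borel_measurable (restrict_space borel (sphere 0 1))"
    using f by (rule measurable_restrict_space1)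
  show ?thesis unfolding sphere_area_def
    by (subst nn_integral_scale_measure) (use m1 m2 in \<open>simp_all add: nn_integral_distr nn_integral_restrict_space\<close>)
qed

lemma nn_integral_scaleR:
  fixes f :: "'a::euclidean_space \<Rightarrow> ennreal"
  assumes f: "f \<in> borel_measurable borel" and c: "c > 0"
  shows "(\<integral>\<^sup>+x. f x \<partial>lborel) = ennreal (c ^ DIM('a)) * (\<integral>\<^sup>+x. f (c *\<^sub>R x) \<partial>lborel)"
proof -
  have c0: "c \<noteq> 0" using c by simp
  show ?thesis
    by (subst lborel_affine[OF c0, of 0])
     (use f c in \<open>simp add: nn_integral_density nn_integral_distr nn_integral_cmult\<close>)
qed

lemma nn_integral_power_tail:
  assumes "r > 0" "n > 0"
  shows "(\<integral>\<^sup>+\<theta>. ennreal (inverse (\<theta> ^ Suc n)) * indicator {r<..} \<theta> \<partial>lborel) = ennreal (inverse (real n * r ^ n))"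
proof -
  define F where "F \<theta> = - inverse (real n * \<theta> ^ n)" for \<theta> :: real
  have "(\<integral>\<^sup>+\<theta>. ennreal (inverse (\<theta> ^ Suc n)) * indicator {r<..} \<theta> \<partial>lborel) =
      (\<integral>\<^sup>+\<theta>. ennreal (inverse (\<theta> ^ Suc n)) * indicator {r..} \<theta> \<partial>lborel)"
    by (rule nn_integral_cong_AE)
      (use AE_lborel_singleton[of r] in \<open>auto elim!: eventually_mono split: split_indicator\<close>)
  also have "\<dots> = ennreal (0 - F r)"
  proof (rule nn_integral_FTC_atLeast)
    show "(F has_real_derivative inverse (\<theta> ^ Suc n)) (at \<theta>)" if "r \<le> \<theta>" for \<theta>
    proof -
      have "\<theta> > 0" using that assms by simp
      moreover have "\<theta> * (\<theta> ^ (n - Suc 0)) = \<theta> ^ n" using assms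
        by (metis Suc_pred power_Suc)
      ultimately show ?thesis unfolding F_def using assms
        by (auto intro!: derivative_eq_intros simp: field_simps power2_eq_square)
    qed
    show "(F \<longlongrightarrow> 0) at_top"
    proof -
      have "((\<lambda>\<theta>::real. - (inverse (real n) * inverse \<theta> ^ n)) \<longlongrightarrow> - (inverse (real n) * 0 ^ n)) at_top"
        by (intro tendsto_intros tendsto_inverse_0_at_top filterlim_ident)
      then show ?thesis using assms by (simp add: F_def[abs_def] power_inverse zero_power)
    qed
  qed (use assms in auto)
  finally show ?thesis by (simp add: F_def)
qed

text \<open>Tonelli and scaling suffice. As \<open>sphere_area\<close> is \<open>d\<close> times an
  image of Lebesgue measure on the unit ball, the right-hand side is a double integral over
  \<open>r\<close> and a point \<open>y\<close> of the ball. The substitutions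
  \<open>r = norm y * \<theta>\<close> and then \<open>x = \<theta> *\<^sub>R y\<close> leave
  \<open>G x\<close> multiplied by the integral of \<open>norm x ^ d / \<theta> ^ (d + 1)\<close>
  over \<open>\<theta> > norm x\<close>, which is \<open>1 / d\<close>.\<close>

lemma nn_integral_polar:
  fixes G :: "'a::euclidean_space \<Rightarrow> ennreal"
  assumes G [measurable]: "G \<in> borel_measurable borel"
  shows "(\<integral>\<^sup>+x. G x \<partial>lborel) =
    (\<integral>\<^sup>+r. ennreal (r ^ (DIM('a) - 1)) * indicator {0<..} r * (\<integral>\<^sup>+\<sigma>. G (r *\<^sub>R \<sigma>) \<partial>sphere_area) \<partial>lborel)"
    (is "_ = ?R")
proof -
  define d where "d = DIM('a)"
  define n where "n = d - 1"
  have d: "d = Suc n" "d > 0" by (auto simp: n_def d_def)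
  define B where "B = ball (0::'a) 1 - {0}"
  have [measurable]: "B \<in> sets borel" by (auto simp: B_def)
  have "?R = (\<integral>\<^sup>+r. ennreal (r ^ n) * indicator {0<..} r *
      (of_nat d * (\<integral>\<^sup>+y. G (r *\<^sub>R (y /\<^sub>R norm y)) * indicator B y \<partial>lborel)) \<partial>lborel)"
    unfolding n_def d_def B_def
    by (intro nn_integral_cong arg_cong2[of _ _ _ _ "(*)"] refl nn_integral_sphere_area) measurable
  also have "\<dots> = (\<integral>\<^sup>+r. of_nat d * (\<integral>\<^sup>+y. ennreal (r ^ n) * indicator {0<..} r *
      (G (r *\<^sub>R (y /\<^sub>R norm y)) * indicator B y) \<partial>lborel) \<partial>lborel)"
    by (intro nn_integral_cong) (simp add: nn_integral_cmult[symmetric] ac_simps)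
  also have "\<dots> = of_nat d * (\<integral>\<^sup>+r. \<integral>\<^sup>+y. ennreal (r ^ n) * indicator {0<..} r *
      (G (r *\<^sub>R (y /\<^sub>R norm y)) * indicator B y) \<partial>lborel \<partial>lborel)"
    by (intro nn_integral_cmult) measurable
  also have "(\<integral>\<^sup>+r. \<integral>\<^sup>+y. ennreal (r ^ n) * indicator {0<..} r *
      (G (r *\<^sub>R (y /\<^sub>R norm y)) * indicator B y) \<partial>lborel \<partial>lborel) =
    (\<integral>\<^sup>+y. \<integral>\<^sup>+r. ennreal (r ^ n) * indicator {0<..} r *
      (G (r *\<^sub>R (y /\<^sub>R norm y)) * indicator B y) \<partial>lborel \<partial>lborel)"
    by (intro lborel_pair.Fubini') measurable
  \<comment> \<open>Substitution \<open>r = norm y * \<theta>\<close> at fixed \<open>y\<close>,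
    which replaces the normalised direction by \<open>y\<close> itself.\<close>
  also have "\<dots> = (\<integral>\<^sup>+y. \<integral>\<^sup>+\<theta>. ennreal (\<theta> ^ n) * indicator {0<..} \<theta> *
      (ennreal (norm y ^ d) * G (\<theta> *\<^sub>R y) * indicator B y) \<partial>lborel \<partial>lborel)"
  proof (rule nn_integral_cong)
    fix y :: 'a
    show "(\<integral>\<^sup>+r. ennreal (r ^ n) * indicator {0<..} r *
        (G (r *\<^sub>R (y /\<^sub>R norm y)) * indicator B y) \<partial>lborel) =
      (\<integral>\<^sup>+\<theta>. ennreal (\<theta> ^ n) * indicator {0<..} \<theta> *
        (ennreal (norm y ^ d) * G (\<theta> *\<^sub>R y) * indicator B y) \<partial>lborel)"
    proof (cases "y \<in> B")
      case True
      then have y: "norm y > 0" by (simp add: B_def)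
      have "(\<integral>\<^sup>+r. ennreal (r ^ n) * indicator {0<..} r *
          (G (r *\<^sub>R (y /\<^sub>R norm y)) * indicator B y) \<partial>lborel) =
        ennreal (norm y) * (\<integral>\<^sup>+\<theta>. ennreal ((norm y * \<theta>) ^ n) * indicator {0<..} (norm y * \<theta>) *
          (G ((norm y * \<theta>) *\<^sub>R (y /\<^sub>R norm y)) * indicator B y) \<partial>lborel)"
        using y by (subst nn_integral_real_affine[where c = "norm y" and t = 0]) simp_all
      also have "\<dots> = (\<integral>\<^sup>+\<theta>. ennreal (norm y) * (ennreal ((norm y * \<theta>) ^ n) *
          indicator {0<..} (norm y * \<theta>) *
          (G ((norm y * \<theta>) *\<^sub>R (y /\<^sub>R norm y)) * indicator B y)) \<partial>lborel)"
        by (intro nn_integral_cmult[symmetric]) measurable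
      also have "\<dots> = (\<integral>\<^sup>+\<theta>. ennreal (\<theta> ^ n) * indicator {0<..} \<theta> *
          (ennreal (norm y ^ d) * G (\<theta> *\<^sub>R y) * indicator B y) \<partial>lborel)"
      proof (rule nn_integral_cong)
        fix \<theta> :: real
        show "ennreal (norm y) * (ennreal ((norm y * \<theta>) ^ n) * indicator {0<..} (norm y * \<theta>) *
            (G ((norm y * \<theta>) *\<^sub>R (y /\<^sub>R norm y)) * indicator B y)) =
          ennreal (\<theta> ^ n) * indicator {0<..} \<theta> *
            (ennreal (norm y ^ d) * G (\<theta> *\<^sub>R y) * indicator B y)"
        proof (cases "\<theta> > 0")
          case True
          have "ennreal (norm y) * ennreal ((norm y * \<theta>) ^ n) = ennreal (\<theta> ^ n) * ennreal (norm y ^ d)"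
            using True d by (simp add: ennreal_mult[symmetric] power_mult_distrib ac_simps)
          moreover have "(norm y * \<theta>) *\<^sub>R (y /\<^sub>R norm y) = \<theta> *\<^sub>R y" using y by simp
          moreover have "indicator {0<..} (norm y * \<theta>) = (1::ennreal)" "indicator {0<..} \<theta> = (1::ennreal)"
            using True y by auto
          ultimately show ?thesis by (simp only: mult.assoc[symmetric] mult_1_right)
        qed (use y in \<open>simp add: zero_less_mult_iff\<close>)
      qed
      finally show ?thesis .
    qed simp
  qed
  also have "\<dots> = (\<integral>\<^sup>+\<theta>. \<integral>\<^sup>+y. ennreal (\<theta> ^ n) * indicator {0<..} \<theta> *
      (ennreal (norm y ^ d) * G (\<theta> *\<^sub>R y) * indicator B y) \<partial>lborel \<partial>lborel)"
    by (intro lborel_pair.Fubini') measurable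
  \<comment> \<open>Substitution \<open>x = \<theta> *\<^sub>R y\<close> at fixed \<theta>: the unit
    ball becomes the ball of radius \<theta>. The Jacobian and \<open>norm y ^ d\<close> each
    contribute the power \<open>- d\<close> of \<theta>, so its exponent becomes
    \<open>n - 2 * d = - (d + 1)\<close>.\<close>
  also have "\<dots> = (\<integral>\<^sup>+\<theta>. \<integral>\<^sup>+x. ennreal (inverse (\<theta> ^ Suc d)) *
      (ennreal (norm x ^ d) * G x * indicator {z. 0 < norm (fst z) \<and> norm (fst z) < snd z} (x, \<theta>))
      \<partial>lborel \<partial>lborel)"
  proof (rule nn_integral_cong)
    fix \<theta> :: real
    show "(\<integral>\<^sup>+y. ennreal (\<theta> ^ n) * indicator {0<..} \<theta> *
        (ennreal (norm y ^ d) * G (\<theta> *\<^sub>R y) * indicator B y) \<partial>lborel) =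
      (\<integral>\<^sup>+x. ennreal (inverse (\<theta> ^ Suc d)) *
      (ennreal (norm x ^ d) * G x * indicator {z. 0 < norm (fst z) \<and> norm (fst z) < snd z} (x, \<theta>))
      \<partial>lborel)"
    proof (cases "\<theta> > 0")
      case True
      have "(\<lambda>x. indicator {z. 0 < norm (fst z) \<and> norm (fst z) < snd z} (x, \<theta>) :: ennreal) =
          indicator (ball (0::'a) \<theta> - {0})"
        by (auto split: split_indicator)
      then have [measurable]: "(\<lambda>x::'a. indicator {z. 0 < norm (fst z) \<and> norm (fst z) < snd z} (x, \<theta>)
          :: ennreal) \<in> borel_measurable borel"
        by (simp only:) (intro borel_measurable_indicator sets.Diff borel_open borel_singleton open_ball sets.empty_sets)
      have "(\<integral>\<^sup>+x. ennreal (inverse (\<theta> ^ Suc d)) * (ennreal (norm x ^ d) * G x *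
          indicator {z. 0 < norm (fst z) \<and> norm (fst z) < snd z} (x, \<theta>)) \<partial>lborel) =
        ennreal (\<theta> ^ d) * (\<integral>\<^sup>+y. ennreal (inverse (\<theta> ^ Suc d)) * (ennreal (norm (\<theta> *\<^sub>R y) ^ d) *
          G (\<theta> *\<^sub>R y) * indicator {z. 0 < norm (fst z) \<and> norm (fst z) < snd z} (\<theta> *\<^sub>R y, \<theta>)) \<partial>lborel)"
        unfolding d_def by (rule nn_integral_scaleR[OF _ True]) measurable
      also have "\<dots> = (\<integral>\<^sup>+y. ennreal (\<theta> ^ d) * (ennreal (inverse (\<theta> ^ Suc d)) *
          (ennreal (norm (\<theta> *\<^sub>R y) ^ d) *
          G (\<theta> *\<^sub>R y) * indicator {z. 0 < norm (fst z) \<and> norm (fst z) < snd z} (\<theta> *\<^sub>R y, \<theta>))) \<partial>lborel)"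
        by (intro nn_integral_cmult[symmetric]) measurable
      also have "\<dots> = (\<integral>\<^sup>+y. ennreal (\<theta> ^ n) * indicator {0<..} \<theta> *
        (ennreal (norm y ^ d) * G (\<theta> *\<^sub>R y) * indicator B y) \<partial>lborel)"
      proof (rule nn_integral_cong)
        fix y :: 'a
        have "ennreal (\<theta> ^ d) * (ennreal (inverse (\<theta> ^ Suc d)) * ennreal (norm (\<theta> *\<^sub>R y) ^ d)) =
          ennreal (\<theta> ^ n) * ennreal (norm y ^ d)"
          using True d by (simp add: ennreal_mult[symmetric] power_mult_distrib field_simps)
        moreover have "indicator {z. 0 < norm (fst z) \<and> norm (fst z) < snd z} (\<theta> *\<^sub>R y, \<theta>) =
          (indicator B y :: ennreal)"
          using True by (auto simp: B_def split: split_indicator)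
        ultimately show "ennreal (\<theta> ^ d) * (ennreal (inverse (\<theta> ^ Suc d)) *
          (ennreal (norm (\<theta> *\<^sub>R y) ^ d) *
          G (\<theta> *\<^sub>R y) * indicator {z. 0 < norm (fst z) \<and> norm (fst z) < snd z} (\<theta> *\<^sub>R y, \<theta>))) =
          ennreal (\<theta> ^ n) * indicator {0<..} \<theta> *
          (ennreal (norm y ^ d) * G (\<theta> *\<^sub>R y) * indicator B y)"
          using True by (simp add: mult.assoc[symmetric])
      qed
      finally show ?thesis by simp
    next
      case False
      have "indicator {z. 0 < norm (fst z) \<and> norm (fst z) < snd z} (x, \<theta>) = (0::ennreal)" for x :: 'a
        using False norm_ge_zero[of x] by (auto split: split_indicator simp del: norm_ge_zero)
      with False show ?thesis by simp
    qed
  qed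
  also have "\<dots> = (\<integral>\<^sup>+x. \<integral>\<^sup>+\<theta>. ennreal (inverse (\<theta> ^ Suc d)) *
      (ennreal (norm x ^ d) * G x * indicator {z. 0 < norm (fst z) \<and> norm (fst z) < snd z} (x, \<theta>))
      \<partial>lborel \<partial>lborel)"
    by (intro lborel_pair.Fubini') measurable
  also have "\<dots> = (\<integral>\<^sup>+x. ennreal (inverse (real d)) * G x \<partial>lborel)"
  proof (rule nn_integral_cong_AE)
    show "AE x in lborel. (\<integral>\<^sup>+\<theta>. ennreal (inverse (\<theta> ^ Suc d)) *
      (ennreal (norm x ^ d) * G x * indicator {z. 0 < norm (fst z) \<and> norm (fst z) < snd z} (x, \<theta>))
      \<partial>lborel) = ennreal (inverse (real d)) * G x"
      using AE_lborel_singleton[of "0::'a"]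
    proof eventually_elim
      case (elim x)
      then have x: "norm x > 0" by simp
      have "(\<integral>\<^sup>+\<theta>. ennreal (inverse (\<theta> ^ Suc d)) * (ennreal (norm x ^ d) * G x *
          indicator {z. 0 < norm (fst z) \<and> norm (fst z) < snd z} (x, \<theta>)) \<partial>lborel) =
        (\<integral>\<^sup>+\<theta>. (ennreal (norm x ^ d) * G x) * (ennreal (inverse (\<theta> ^ Suc d)) *
          indicator {norm x<..} \<theta>) \<partial>lborel)"
        using x by (intro nn_integral_cong) (auto simp: ac_simps split: split_indicator)
      also have "\<dots> = (ennreal (norm x ^ d) * G x) * ennreal (inverse (real d * norm x ^ d))"
        using x d(2) by (subst nn_integral_cmult) (simp_all only: nn_integral_power_tail, measurable)
      also have "\<dots> = (ennreal (norm x ^ d) * ennreal (inverse (real d * norm x ^ d))) * G x"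
        by (simp only: ac_simps)
      also have "ennreal (norm x ^ d) * ennreal (inverse (real d * norm x ^ d)) = ennreal (inverse (real d))"
        using x d(2) by (subst ennreal_mult[symmetric]) (auto simp: field_simps)
      finally show ?case .
    qed
  qed
  also have "\<dots> = ennreal (inverse (real d)) * (\<integral>\<^sup>+x. G x \<partial>lborel)"
    by (intro nn_integral_cmult) measurable
  also have "of_nat d * (ennreal (inverse (real d)) * (\<integral>\<^sup>+x. G x \<partial>lborel)) = (\<integral>\<^sup>+x. G x \<partial>lborel)"
  proof -
    have "of_nat d * ennreal (inverse (real d)) = 1"
      using d(2) by (simp add: ennreal_of_nat_eq_real_of_nat ennreal_mult[symmetric])
    then show ?thesis by (simp add: mult.assoc[symmetric])
  qed
  finally show ?thesis by simp
qed

section \<open>Subsolutions in a cone and the spherical Rayleigh quotient\<close>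

lemma set_integrable_compact:
  fixes f :: "'a::euclidean_space \<Rightarrow> real"
  shows "compact K \<Longrightarrow> continuous_on K f \<Longrightarrow> set_integrable lborel K f"
  unfolding set_integrable_def by (rule borel_integrable_compact)

lemma finite_measure_sphere_area: "finite_measure (sphere_area :: 'a::euclidean_space measure)"
proof
  have sp: "space (sphere_area :: 'a measure) = sphere 0 1"
    by (simp add: sphere_area_def space_scale_measure space_restrict_space)
  have "emeasure lborel (cone_over (sphere 0 1) \<inter> ball (0::'a) 1) \<le> emeasure lborel (ball (0::'a) 1)"
    by (intro emeasure_mono) auto
  also have "\<dots> < \<infinity>" by (rule emeasure_bounded_finite) simp
  finally show "emeasure (sphere_area :: 'a measure) (space sphere_area) \<noteq> \<infinity>"
    unfolding sp by (subst emeasure_sphere_area) (auto simp: ennreal_mult_eq_top_iff)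
qed

lemma integrable_sphere_area:
  fixes f :: "'a::euclidean_space \<Rightarrow> real"
  assumes "continuous_on (sphere 0 1) f"
  shows "integrable sphere_area f"
proof -
  have sp: "space (sphere_area :: 'a measure) = sphere 0 1"
    by (simp add: sphere_area_def space_scale_measure space_restrict_space)
  have se: "sets (sphere_area :: 'a measure) = sets (restrict_space borel (sphere 0 1))"
    by (simp add: sphere_area_def)
  have "f \<in> borel_measurable (restrict_space borel (sphere 0 1))"
    using assms by (rule borel_measurable_continuous_on_restrict)
  then have m: "f \<in> borel_measurable sphere_area"
    by (simp add: measurable_cong_sets[OF se refl])
  obtain B where "\<forall>y\<in>f ` sphere 0 1. norm y \<le> B"
    using compact_imp_bounded[OF compact_continuous_image[OF assms compact_sphere]]
    unfolding bounded_iff by blast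
  then have B: "\<And>x. x \<in> sphere 0 1 \<Longrightarrow> norm (f x) \<le> B" by blast
  show ?thesis
    using finite_measure.integrable_const_bound[OF finite_measure_sphere_area AE_I2 m] B sp by metis
qed

text \<open>The radial extension is constant along rays, so its gradient keeps only the tangential
  part of the gradient of \<open>F\<close>; the chain rule supplies the factor
  \<open>r\<close>.\<close>

lemma sphere_grad_eq:
  fixes f F :: "'a::euclidean_space \<Rightarrow> real"
  assumes F: "(F has_derivative (\<lambda>h. D \<bullet> h)) (at (r *\<^sub>R \<sigma>))" and \<sigma>: "norm \<sigma> = 1"
  shows "sphere_grad (\<lambda>\<sigma>. F (r *\<^sub>R \<sigma>)) \<sigma> = r *\<^sub>R (D - (D \<bullet> \<sigma>) *\<^sub>R \<sigma>)"
proof -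
  have n0: "\<sigma> \<noteq> 0" using \<sigma> by auto
  have N: "(norm has_derivative (\<lambda>x. x \<bullet> \<sigma>)) (at \<sigma>)"
    using has_derivative_norm[OF n0] \<sigma> by (simp add: sgn_div_norm)
  have P: "((\<lambda>x. r *\<^sub>R (x /\<^sub>R norm x)) has_derivative (\<lambda>h. r *\<^sub>R (h - (\<sigma> \<bullet> h) *\<^sub>R \<sigma>))) (at \<sigma>)"
    using \<sigma> n0 N by (auto intro!: derivative_eq_intros simp: fun_eq_iff sgn_div_norm inner_commute algebra_simps)
  have "((\<lambda>x. F (r *\<^sub>R (x /\<^sub>R norm x))) has_derivative (\<lambda>h. D \<bullet> (r *\<^sub>R (h - (\<sigma> \<bullet> h) *\<^sub>R \<sigma>)))) (at \<sigma>)"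
    by (rule has_derivative_compose[OF P]) (use F \<sigma> in simp)
  then have "frechet_derivative (radial_ext (\<lambda>\<sigma>. F (r *\<^sub>R \<sigma>))) (at \<sigma>) =
      (\<lambda>h. D \<bullet> (r *\<^sub>R (h - (\<sigma> \<bullet> h) *\<^sub>R \<sigma>)))"
    unfolding radial_ext_def[abs_def] by (rule frechet_derivative_at[symmetric])
  then have "sphere_grad (\<lambda>\<sigma>. F (r *\<^sub>R \<sigma>)) \<sigma> = (\<Sum>b\<in>Basis. ((r *\<^sub>R (D - (D \<bullet> \<sigma>) *\<^sub>R \<sigma>)) \<bullet> b) *\<^sub>R b)"
    unfolding sphere_grad_def grad_def partial_def
    by (intro sum.cong refl arg_cong2[of _ _ _ _ scaleR]) (simp add: inner_diff_left inner_diff_right ac_simps)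
  then show ?thesis by (simp only: euclidean_representation)
qed

lemma continuous_on_time_slice:
  assumes "continuous_on (I \<times> X) F" "t \<in> I"
  shows "continuous_on X (\<lambda>x. F (t, x))"
  by (rule continuous_on_compose2[OF assms(1)]) (use assms(2) in \<open>auto intro!: continuous_intros\<close>)

text \<open>The function lives on the whole ball rather than on the cone, so that integration by
  parts over a ball meets no lateral boundary. Of the second derivatives only the pure ones appear,
  since fields are integrated one component at a time. The last three assumptions serve the division
  by \<open>x \<bullet> x\<close> and the Rayleigh quotient.\<close>

locale cone_subsolution =
  fixes M :: "'a::euclidean_space set" and v :: "real \<times> 'a \<Rightarrow> real" and Dv :: "real \<times> 'a \<Rightarrow> 'a"
    and D2 :: "'a \<Rightarrow> real \<times> 'a \<Rightarrow> real" and vt :: "real \<times> 'a \<Rightarrow> real" and S :: real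
  assumes M: "M \<subseteq> sphere 0 1"
    and cont_v: "continuous_on ({0<..1} \<times> ball 0 1) v"
    and cont_Dv: "continuous_on ({0<..1} \<times> ball 0 1) Dv"
    and cont_D2: "b \<in> Basis \<Longrightarrow> continuous_on ({0<..1} \<times> ball 0 1) (D2 b)"
    and cont_vt: "continuous_on ({0<..1} \<times> ball 0 1) vt"
    and deriv_v: "t \<in> {0<..1} \<Longrightarrow> x \<in> ball 0 1 \<Longrightarrow>
      ((\<lambda>y. v (t, y)) has_derivative (\<lambda>h. Dv (t, x) \<bullet> h)) (at x)"
    and deriv_Dv: "t \<in> {0<..1} \<Longrightarrow> x \<in> ball 0 1 \<Longrightarrow> b \<in> Basis \<Longrightarrow>
      ((\<lambda>s. Dv (t, x + s *\<^sub>R b) \<bullet> b) has_real_derivative D2 b (t, x)) (at 0)"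
    and deriv_t: "t \<in> {0<..1} \<Longrightarrow> x \<in> ball 0 1 \<Longrightarrow>
      ((\<lambda>s. v (s, x)) has_real_derivative vt (t, x)) (at t within {0<..1})"
    and subsolution: "t \<in> {0<..1} \<Longrightarrow> x \<in> ball 0 1 \<Longrightarrow> vt (t, x) \<le> (\<Sum>b\<in>Basis. D2 b (t, x))"
    and v_nonneg: "t \<in> {0<..1} \<Longrightarrow> x \<in> ball 0 1 \<Longrightarrow> 0 \<le> v (t, x)"
    and v_le: "t \<in> {0<..1} \<Longrightarrow> x \<in> ball 0 1 \<Longrightarrow> v (t, x) \<le> S"
    and v_vertex: "t \<in> {0<..1} \<Longrightarrow> \<exists>e>0. \<forall>x\<in>ball 0 e. v (t, x) = 0"
    and v_outside: "t \<in> {0<..1} \<Longrightarrow> x \<in> ball 0 1 \<Longrightarrow> x \<notin> cone_over M \<Longrightarrow> v (t, x) = 0 \<and> Dv (t, x) = 0"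
    and v_slice: "t \<in> {0<..1} \<Longrightarrow> 0 < r \<Longrightarrow> r < 1 \<Longrightarrow> (\<lambda>\<sigma>. v (t, r *\<^sub>R \<sigma>)) \<in> sphere_Cc_inf M"
begin

section \<open>The Rayleigh quotient on spheres and a weighted Hardy inequality\<close>

lemma slice_rayleigh:
  assumes t: "t \<in> {0<..1}" and r: "0 < r" "r < 1" and L: "0 \<le> Lambda0 M"
  shows "(\<integral>\<^sup>+\<sigma>. ennreal (Lambda0 M * (v (t, r *\<^sub>R \<sigma>))\<^sup>2) \<partial>sphere_area) \<le>
    (\<integral>\<^sup>+\<sigma>. ennreal (r\<^sup>2 * ((norm (Dv (t, r *\<^sub>R \<sigma>)))\<^sup>2 - (Dv (t, r *\<^sub>R \<sigma>) \<bullet> \<sigma>)\<^sup>2)) \<partial>sphere_area)"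
proof -
  define f where "f \<sigma> = v (t, r *\<^sub>R \<sigma>)" for \<sigma>
  define g where "g \<sigma> = r\<^sup>2 * ((norm (Dv (t, r *\<^sub>R \<sigma>)))\<^sup>2 - (Dv (t, r *\<^sub>R \<sigma>) \<bullet> \<sigma>)\<^sup>2)" for \<sigma>
  have sp: "space (sphere_area :: 'a measure) = sphere 0 1"
    by (simp add: sphere_area_def space_scale_measure space_restrict_space)
  have ball: "r *\<^sub>R \<sigma> \<in> ball 0 1" if "\<sigma> \<in> sphere 0 1" for \<sigma> :: 'a
    using that r by simp
  have cf: "continuous_on (sphere 0 1) f"
    unfolding f_def by (rule continuous_on_compose2[OF continuous_on_time_slice[OF cont_v t]])
      (use ball in \<open>auto intro!: continuous_intros\<close>)
  have "continuous_on (sphere 0 1) (\<lambda>\<sigma>. Dv (t, r *\<^sub>R \<sigma>))"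
    by (rule continuous_on_compose2[OF continuous_on_time_slice[OF cont_Dv t]])
      (use ball in \<open>auto intro!: continuous_intros\<close>)
  then have cg: "continuous_on (sphere 0 1) g"
    unfolding g_def by (intro continuous_intros)
  have If: "integrable sphere_area (\<lambda>\<sigma>. (f \<sigma>)\<^sup>2)" and Ig: "integrable sphere_area g"
    using cf cg by (auto intro!: integrable_sphere_area continuous_intros)
  have g_nonneg: "0 \<le> g \<sigma>" if "\<sigma> \<in> sphere 0 1" for \<sigma>
  proof -
    have "(Dv (t, r *\<^sub>R \<sigma>) \<bullet> \<sigma>)\<^sup>2 \<le> (norm (Dv (t, r *\<^sub>R \<sigma>)))\<^sup>2"
      using Cauchy_Schwarz_ineq2[of "Dv (t, r *\<^sub>R \<sigma>)" \<sigma>] that by (simp add: power2_le_iff_abs_le)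
    then show ?thesis by (simp add: g_def)
  qed
  \<comment> \<open>\<open>Lambda0\<close> integrates over \<open>M\<close> only, the polar formula
    over the whole sphere; the two agree because \<open>v\<close> and its gradient vanish off the
    cone.\<close>
  have out: "f \<sigma> = 0 \<and> g \<sigma> = 0" if "\<sigma> \<in> sphere 0 1 - M" for \<sigma>
  proof -
    have "r *\<^sub>R \<sigma> \<notin> cone_over M"
    proof
      assume "r *\<^sub>R \<sigma> \<in> cone_over M"
      then obtain r' \<sigma>' where *: "r *\<^sub>R \<sigma> = r' *\<^sub>R \<sigma>'" "r' > 0" "\<sigma>' \<in> M" by (auto simp: cone_over_def)
      then have "r * norm \<sigma> = r' * norm \<sigma>'" using arg_cong[OF *(1), of norm] *(2) r(1)
        unfolding norm_scaleR by (metis abs_of_pos)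
      moreover have "norm \<sigma>' = 1" using *(3) M by auto
      ultimately have "r = r'" using that by simp
      with * that r show False by auto
    qed
    then show ?thesis using v_outside[OF t ball, of \<sigma>] that by (simp add: f_def g_def)
  qed
  have grad: "(norm (sphere_grad f \<sigma>))\<^sup>2 = g \<sigma>" if "\<sigma> \<in> M" for \<sigma>
  proof -
    have s: "\<sigma> \<in> sphere 0 1" using that M by auto
    then have n: "norm \<sigma> = 1" by simp
    then have ss: "\<sigma> \<bullet> \<sigma> = 1" by (simp add: dot_square_norm)
    have e: "sphere_grad f \<sigma> = r *\<^sub>R (Dv (t, r *\<^sub>R \<sigma>) - (Dv (t, r *\<^sub>R \<sigma>) \<bullet> \<sigma>) *\<^sub>R \<sigma>)"
      unfolding f_def[abs_def] by (rule sphere_grad_eq[OF deriv_v[OF t ball[OF s]] n])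
    define D where "D = Dv (t, r *\<^sub>R \<sigma>)"
    have "(norm (sphere_grad f \<sigma>))\<^sup>2 = r\<^sup>2 * ((D - (D \<bullet> \<sigma>) *\<^sub>R \<sigma>) \<bullet> (D - (D \<bullet> \<sigma>) *\<^sub>R \<sigma>))"
      by (simp only: e D_def norm_scaleR power_mult_distrib power2_abs power2_norm_eq_inner)
    also have "(D - (D \<bullet> \<sigma>) *\<^sub>R \<sigma>) \<bullet> (D - (D \<bullet> \<sigma>) *\<^sub>R \<sigma>) = (norm D)\<^sup>2 - (D \<bullet> \<sigma>)\<^sup>2"
      unfolding power2_norm_eq_inner
      by (simp add: inner_diff_left inner_diff_right ss inner_commute power2_eq_square)
    finally show ?thesis by (simp add: g_def D_def)
  qed
  have eqf: "(LINT \<sigma>:M|sphere_area. \<bar>f \<sigma>\<bar>\<^sup>2) = (LINT \<sigma>|sphere_area. (f \<sigma>)\<^sup>2)"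
    unfolding set_lebesgue_integral_def
    by (rule Bochner_Integration.integral_cong) (use out sp in \<open>auto split: split_indicator\<close>)
  have eqg: "(LINT \<sigma>:M|sphere_area. (norm (sphere_grad f \<sigma>))\<^sup>2) = (LINT \<sigma>|sphere_area. g \<sigma>)"
    unfolding set_lebesgue_integral_def
    by (rule Bochner_Integration.integral_cong) (use out sp grad in \<open>auto split: split_indicator\<close>)
  have nonneg: "0 \<le> (LINT \<sigma>|sphere_area. (f \<sigma>)\<^sup>2)" "0 \<le> (LINT \<sigma>|sphere_area. g \<sigma>)"
    using g_nonneg sp by (auto intro!: integral_nonneg_AE AE_I2)
  have main: "Lambda0 M * (LINT \<sigma>|sphere_area. (f \<sigma>)\<^sup>2) \<le> (LINT \<sigma>|sphere_area. g \<sigma>)"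
  \<comment> \<open>The infimum ranges over test functions that are not identically zero on
    \<open>M\<close>, so a vanishing slice is treated separately.\<close>
  proof (cases "\<exists>\<sigma>\<in>M. f \<sigma> \<noteq> 0")
    case True
    have "Lambda0 M \<le> (LINT \<sigma>:M|sphere_area. (norm (sphere_grad f \<sigma>))\<^sup>2) / (LINT \<sigma>:M|sphere_area. \<bar>f \<sigma>\<bar>\<^sup>2)"
      unfolding Lambda0_def
    proof (rule cINF_lower)
      show "f \<in> {w \<in> sphere_Cc_inf M. \<exists>\<sigma>\<in>M. w \<sigma> \<noteq> 0}"
        using v_slice[OF t r] True by (simp add: f_def[abs_def])
      show "bdd_below ((\<lambda>w. (LINT \<sigma>:M|sphere_area. (norm (sphere_grad w \<sigma>))\<^sup>2) /
          (LINT \<sigma>:M|sphere_area. \<bar>w \<sigma>\<bar>\<^sup>2)) ` {w \<in> sphere_Cc_inf M. \<exists>\<sigma>\<in>M. w \<sigma> \<noteq> 0})"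
        by (rule bdd_belowI[of _ 0]) (auto intro!: divide_nonneg_nonneg simp: set_lebesgue_integral_def)
    qed
    \<comment> \<open>Were the denominator zero, the quotient would be 0 by convention and carry no
      information, but then the left-hand side is zero as well.\<close>
    then show ?thesis using nonneg unfolding eqf eqg
      by (cases "(LINT \<sigma>|sphere_area. (f \<sigma>)\<^sup>2) = 0") (auto simp: field_simps)
  next
    case False
    then have "(LINT \<sigma>|sphere_area. (f \<sigma>)\<^sup>2) = (LINT \<sigma>|(sphere_area :: 'a measure). 0)"
      by (intro Bochner_Integration.integral_cong) (use out sp in auto)
    then show ?thesis using nonneg by simp
  qed
  have "(\<integral>\<^sup>+\<sigma>. ennreal (Lambda0 M * (f \<sigma>)\<^sup>2) \<partial>sphere_area) =
      ennreal (LINT \<sigma>|sphere_area. Lambda0 M * (f \<sigma>)\<^sup>2)"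
    by (rule nn_integral_eq_integral) (use If L in auto)
  also have "\<dots> \<le> ennreal (LINT \<sigma>|sphere_area. g \<sigma>)"
    using main by (intro ennreal_leI) simp
  also have "\<dots> = (\<integral>\<^sup>+\<sigma>. ennreal (g \<sigma>) \<partial>sphere_area)"
    by (rule nn_integral_eq_integral[symmetric]) (use Ig g_nonneg sp in \<open>auto intro!: AE_I2\<close>)
  finally show ?thesis by (simp add: f_def g_def)
qed

text \<open>Division by \<open>x \<bullet> x\<close> is harmless: \<open>v\<close> is identically
  zero near the vertex, and the integrand with it, so continuity has to be checked only away from
  the origin.\<close>

lemma continuous_on_vanishing_vertex:
  assumes t: "t \<in> {0<..1}" and F: "continuous_on (ball 0 1 - {0}) F"
    and z: "\<And>x. v (t, x) = 0 \<Longrightarrow> F x = (0::real)"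
  shows "continuous_on (ball 0 1) F"
proof -
  obtain e where e: "e > 0" "\<And>x. x \<in> ball 0 e \<Longrightarrow> v (t, x) = 0" using v_vertex[OF t] by auto
  have "continuous_on (ball 0 e) (\<lambda>_::'a. 0::real)" by simp
  then have "continuous_on (ball 0 e) F" by (rule continuous_on_eq) (use e z in auto)
  then have "continuous_on ((ball 0 1 - {0}) \<union> ball 0 e) F"
    using F by (intro continuous_on_open_Un) auto
  then show ?thesis by (rule continuous_on_subset) (use e in auto)
qed

lemma Dv_vertex:
  assumes t: "t \<in> {0<..1}" and e: "e > 0" "\<And>x. x \<in> ball 0 e \<Longrightarrow> v (t, x) = 0"
    and x: "x \<in> ball 0 (min e 1)"
  shows "Dv (t, x) = 0"
proof -
  have "((\<lambda>_. 0) has_derivative (\<lambda>h. Dv (t, x) \<bullet> h)) (at x)"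
    by (rule has_derivative_transform_within_open[OF deriv_v[OF t] _ _ e(2), of x "ball 0 e"])
      (use x in auto)
  then have "(\<lambda>h. Dv (t, x) \<bullet> h) = (\<lambda>h. 0)" by (rule has_derivative_unique) simp
  then have "Dv (t, x) \<bullet> Dv (t, x) = 0" by metis
  then show ?thesis by simp
qed

lemma continuous_on_radial_part:
  assumes t: "t \<in> {0<..1}"
  shows "continuous_on (ball 0 1) (\<lambda>x. (Dv (t, x) \<bullet> x)\<^sup>2 / (x \<bullet> x))" (is "continuous_on _ ?G")
proof -
  obtain e where e: "e > 0" "\<And>x. x \<in> ball 0 e \<Longrightarrow> v (t, x) = 0" using v_vertex[OF t] by auto
  have "continuous_on (ball 0 (min e 1)) (\<lambda>_::'a. 0::real)" by simp
  then have 1: "continuous_on (ball 0 (min e 1)) ?G"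
    by (rule continuous_on_eq) (use Dv_vertex[OF t e] in simp)
  have 2: "continuous_on (ball 0 1 - {0}) ?G"
    by (auto intro!: continuous_intros continuous_on_subset[OF continuous_on_time_slice[OF cont_Dv t]])
  have "continuous_on ((ball 0 1 - {0}) \<union> ball 0 (min e 1)) ?G"
    using 1 2 by (intro continuous_on_open_Un) auto
  then show ?thesis by (rule continuous_on_subset) (use e in auto)
qed

text \<open>The slice inequality, multiplied by \<open>p (r\<^sup>2) / r\<^sup>2\<close> and
  integrated over \<open>r\<close>. The bracket on the right is the squared length of the part of
  the gradient orthogonal to \<open>x\<close>.\<close>

lemma angular_gradient_ge:
  assumes t: "t \<in> {0<..1}" and \<rho>: "\<rho> < 1" and L: "0 \<le> Lambda0 M"
    and p: "continuous_on UNIV p" "\<And>y. 0 \<le> p y"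
  shows "(LINT x:cball 0 \<rho>|lborel. Lambda0 M * (v (t, x))\<^sup>2 * p (x \<bullet> x) / (x \<bullet> x)) \<le>
    (LINT x:cball 0 \<rho>|lborel. ((norm (Dv (t, x)))\<^sup>2 - (Dv (t, x) \<bullet> x)\<^sup>2 / (x \<bullet> x)) * p (x \<bullet> x))"
    (is "(LINT x:?K|lborel. ?F x) \<le> (LINT x:?K|lborel. ?G x)")
proof -
  have K: "?K \<subseteq> ball 0 1" "compact ?K" using \<rho> by auto
  note cv = continuous_on_time_slice[OF cont_v t] and cD = continuous_on_time_slice[OF cont_Dv t]
  note cp = continuous_on_compose2[OF p(1), of _ "\<lambda>x::'a. x \<bullet> x"]
  have cF: "continuous_on (ball 0 1) ?F"
    by (rule continuous_on_vanishing_vertex[OF t])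
      (auto intro!: continuous_intros continuous_on_subset[OF cv] cp)
  have cG: "continuous_on (ball 0 1) ?G"
    by (intro continuous_intros cp cD continuous_on_radial_part[OF t] subset_UNIV)
  have iF: "set_integrable lborel ?K ?F" and iG: "set_integrable lborel ?K ?G"
    using K cF cG continuous_on_subset by (auto intro!: set_integrable_compact)
  have F0: "0 \<le> ?F x" for x using L p by simp
  have G0: "0 \<le> ?G x" for x
  proof -
    have "(Dv (t, x) \<bullet> x)\<^sup>2 \<le> (norm (Dv (t, x)))\<^sup>2 * (x \<bullet> x)"
      using Cauchy_Schwarz_ineq[of "Dv (t, x)" x] by (simp add: power2_norm_eq_inner)
    then have "(Dv (t, x) \<bullet> x)\<^sup>2 / (x \<bullet> x) \<le> (norm (Dv (t, x)))\<^sup>2"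
      by (cases "x = 0") (auto simp: divide_simps)
    then show ?thesis using p by simp
  qed
  define F where "F x = ennreal (indicator ?K x *\<^sub>R ?F x)" for x
  define G where "G x = ennreal (indicator ?K x *\<^sub>R ?G x)" for x
  have m: "F \<in> borel_measurable borel" "G \<in> borel_measurable borel"
    using iF iG unfolding F_def[abs_def] G_def[abs_def] set_integrable_def by auto
  have eqF: "(\<integral>\<^sup>+x. F x \<partial>lborel) = ennreal (LINT x:?K|lborel. ?F x)"
    unfolding F_def set_lebesgue_integral_def
    by (rule nn_integral_eq_integral) (use iF F0 in \<open>auto simp: set_integrable_def intro!: AE_I2 split: split_indicator\<close>)
  have eqG: "(\<integral>\<^sup>+x. G x \<partial>lborel) = ennreal (LINT x:?K|lborel. ?G x)"
    unfolding G_def set_lebesgue_integral_def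
    by (rule nn_integral_eq_integral) (use iG G0 in \<open>auto simp: set_integrable_def intro!: AE_I2 split: split_indicator\<close>)
  have "(\<integral>\<^sup>+x. F x \<partial>lborel) \<le> (\<integral>\<^sup>+x. G x \<partial>lborel)"
    unfolding nn_integral_polar[OF m(1)] nn_integral_polar[OF m(2)]
  proof (intro nn_integral_mono)
    fix r :: real
    show "ennreal (r ^ (DIM('a) - 1)) * indicator {0<..} r * (\<integral>\<^sup>+\<sigma>. F (r *\<^sub>R \<sigma>) \<partial>sphere_area) \<le>
      ennreal (r ^ (DIM('a) - 1)) * indicator {0<..} r * (\<integral>\<^sup>+\<sigma>. G (r *\<^sub>R \<sigma>) \<partial>sphere_area)"
    proof (cases "0 < r \<and> r \<le> \<rho>")
      case True
      then have r: "0 < r" "r \<le> \<rho>" "r < 1" using \<rho> by auto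
      have sp: "space (sphere_area :: 'a measure) = sphere 0 1"
        by (simp add: sphere_area_def space_scale_measure space_restrict_space)
      have "(\<integral>\<^sup>+\<sigma>. F (r *\<^sub>R \<sigma>) \<partial>sphere_area) =
          (\<integral>\<^sup>+\<sigma>. ennreal (p (r\<^sup>2) / r\<^sup>2) * ennreal (Lambda0 M * (v (t, r *\<^sub>R \<sigma>))\<^sup>2) \<partial>sphere_area)"
      proof (rule nn_integral_cong)
        fix \<sigma> :: 'a assume "\<sigma> \<in> space sphere_area"
        then have s: "norm \<sigma> = 1" "\<sigma> \<bullet> \<sigma> = 1" by (auto simp: sp dot_square_norm)
        show "F (r *\<^sub>R \<sigma>) = ennreal (p (r\<^sup>2) / r\<^sup>2) * ennreal (Lambda0 M * (v (t, r *\<^sub>R \<sigma>))\<^sup>2)"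
          using r s p L by (subst ennreal_mult[symmetric]) (auto simp: F_def power2_eq_square mult.commute)
      qed
      also have "\<dots> = ennreal (p (r\<^sup>2) / r\<^sup>2) *
          (\<integral>\<^sup>+\<sigma>. ennreal (Lambda0 M * (v (t, r *\<^sub>R \<sigma>))\<^sup>2) \<partial>sphere_area)"
      proof (rule nn_integral_cmult)
        have "continuous_on (sphere 0 1) (\<lambda>\<sigma>. v (t, r *\<^sub>R \<sigma>))"
          by (rule continuous_on_compose2[OF cv]) (use r in \<open>auto intro!: continuous_intros\<close>)
        then have "integrable sphere_area (\<lambda>\<sigma>. Lambda0 M * (v (t, r *\<^sub>R \<sigma>))\<^sup>2)"
          by (auto intro!: integrable_sphere_area continuous_intros)
        then show "(\<lambda>\<sigma>. ennreal (Lambda0 M * (v (t, r *\<^sub>R \<sigma>))\<^sup>2)) \<in> borel_measurable sphere_area"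
          by auto
      qed
      also have "\<dots> \<le> ennreal (p (r\<^sup>2) / r\<^sup>2) * (\<integral>\<^sup>+\<sigma>. ennreal (r\<^sup>2 * ((norm (Dv (t, r *\<^sub>R \<sigma>)))\<^sup>2
          - (Dv (t, r *\<^sub>R \<sigma>) \<bullet> \<sigma>)\<^sup>2)) \<partial>sphere_area)"
        by (intro mult_left_mono slice_rayleigh[OF t r(1,3) L]) simp
      also have "\<dots> = (\<integral>\<^sup>+\<sigma>. ennreal (p (r\<^sup>2) / r\<^sup>2) * ennreal (r\<^sup>2 * ((norm (Dv (t, r *\<^sub>R \<sigma>)))\<^sup>2
          - (Dv (t, r *\<^sub>R \<sigma>) \<bullet> \<sigma>)\<^sup>2)) \<partial>sphere_area)"
      proof (rule nn_integral_cmult[symmetric])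
        have "continuous_on (sphere 0 1) (\<lambda>\<sigma>. Dv (t, r *\<^sub>R \<sigma>))"
          by (rule continuous_on_compose2[OF cD]) (use r in \<open>auto intro!: continuous_intros\<close>)
        then have "integrable sphere_area (\<lambda>\<sigma>. r\<^sup>2 * ((norm (Dv (t, r *\<^sub>R \<sigma>)))\<^sup>2 - (Dv (t, r *\<^sub>R \<sigma>) \<bullet> \<sigma>)\<^sup>2))"
          by (intro integrable_sphere_area continuous_intros)
        then show "(\<lambda>\<sigma>. ennreal (r\<^sup>2 * ((norm (Dv (t, r *\<^sub>R \<sigma>)))\<^sup>2 - (Dv (t, r *\<^sub>R \<sigma>) \<bullet> \<sigma>)\<^sup>2)))
            \<in> borel_measurable sphere_area"
          by auto
      qed
      also have "\<dots> = (\<integral>\<^sup>+\<sigma>. G (r *\<^sub>R \<sigma>) \<partial>sphere_area)"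
      proof (rule nn_integral_cong)
        fix \<sigma> :: 'a assume "\<sigma> \<in> space sphere_area"
        then have s: "norm \<sigma> = 1" "\<sigma> \<bullet> \<sigma> = 1" by (auto simp: sp dot_square_norm)
        have "(Dv (t, r *\<^sub>R \<sigma>) \<bullet> \<sigma>)\<^sup>2 \<le> (norm (Dv (t, r *\<^sub>R \<sigma>)))\<^sup>2"
          using Cauchy_Schwarz_ineq2[of "Dv (t, r *\<^sub>R \<sigma>)" \<sigma>] s by (simp add: power2_le_iff_abs_le)
        then show "ennreal (p (r\<^sup>2) / r\<^sup>2) * ennreal (r\<^sup>2 * ((norm (Dv (t, r *\<^sub>R \<sigma>)))\<^sup>2
          - (Dv (t, r *\<^sub>R \<sigma>) \<bullet> \<sigma>)\<^sup>2)) = G (r *\<^sub>R \<sigma>)"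
          using r s p by (subst ennreal_mult[symmetric])
            (auto simp: G_def power2_eq_square power_mult_distrib mult.commute)
      qed
      finally show ?thesis by (rule mult_left_mono) simp
    next
      case False
      show ?thesis
      proof (cases "0 < r")
        case True
        with False have r: "\<rho> < r" by simp
        have sp: "space (sphere_area :: 'a measure) = sphere 0 1"
          by (simp add: sphere_area_def space_scale_measure space_restrict_space)
        have "(\<integral>\<^sup>+\<sigma>. F (r *\<^sub>R \<sigma>) \<partial>sphere_area) = (\<integral>\<^sup>+\<sigma>. 0 \<partial>(sphere_area :: 'a measure))"
          by (rule nn_integral_cong) (use r True sp in \<open>auto simp: F_def\<close>)
        then show ?thesis by simp
      qed simp
    qed
  qed
  moreover have "0 \<le> (LINT x:?K|lborel. ?G x)"
    unfolding set_lebesgue_integral_def by (rule Bochner_Integration.integral_nonneg) (use G0 in simp)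
  ultimately show ?thesis unfolding eqF eqG by (simp add: ennreal_le_iff)
qed

lemma directional_deriv_v:
  assumes "t \<in> {0<..1}" "x \<in> ball 0 1"
  shows "((\<lambda>s. v (t, x + s *\<^sub>R b)) has_real_derivative Dv (t, x) \<bullet> b) (at 0)"
proof -
  have "((\<lambda>s. x + s *\<^sub>R b) has_derivative (\<lambda>s. s *\<^sub>R b)) (at 0)"
    by (auto intro!: derivative_eq_intros)
  then have "((\<lambda>s. v (t, x + s *\<^sub>R b)) has_derivative (\<lambda>s. Dv (t, x) \<bullet> (s *\<^sub>R b))) (at 0)"
    by (rule has_derivative_compose) (use deriv_v[OF assms] in simp)
  then show ?thesis by (simp add: has_field_derivative_def mult_commute_abs)
qed

lemma sum_inner_Basis_power2: "(\<Sum>b\<in>Basis. (x \<bullet> b)\<^sup>2) = x \<bullet> (x :: 'a)"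
  by (simp add: euclidean_inner[of x x] power2_eq_square)

text \<open>Green's identity: the divergence of p grad(v^2) - v^2 grad(p), with \<open>p\<close>
  evaluated at \<open>Y x\<close>, integrates to zero. The Laplacian of \<open>p (Y x)\<close> is
  \<open>4 * Y x * p2 (Y x) + 2 * d * p1 (Y x)\<close>. The field has no boundary contribution
  because \<open>p\<close> and \<open>p1\<close> both vanish beyond
  \<open>\<rho>\<^sup>2\<close>.\<close>

lemma laplacian_by_parts:
  fixes c :: 'a
  assumes t: "t \<in> {0<..1}" and K: "cball c \<rho> \<subseteq> ball 0 1" and \<rho>: "0 \<le> \<rho>"
    and p: "\<And>y. (p has_real_derivative p1 y) (at y)" "\<And>y. (p1 has_real_derivative p2 y) (at y)"
    and cp2: "continuous_on UNIV p2"
    and supp: "\<And>y. \<rho>\<^sup>2 \<le> y \<Longrightarrow> p y = 0 \<and> p1 y = 0"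
  defines "Y \<equiv> \<lambda>x. (x - c) \<bullet> (x - c)"
  shows "(LINT x:cball c \<rho>|lborel. 2 * v (t, x) * p (Y x) * (\<Sum>b\<in>Basis. D2 b (t, x))) =
    (LINT x:cball c \<rho>|lborel. (v (t, x))\<^sup>2 * (4 * Y x * p2 (Y x) + 2 * real DIM('a) * p1 (Y x)) -
      2 * (norm (Dv (t, x)))\<^sup>2 * p (Y x))"
proof -
  let ?K = "cball c \<rho>"
  have cK: "compact ?K" by simp
  have p_cont: "continuous_on UNIV p" "continuous_on UNIV p1"
    using p by (auto intro!: continuous_at_imp_continuous_on DERIV_isCont)
  have cY: "continuous_on X Y" for X unfolding Y_def by (intro continuous_intros)
  note cpY = continuous_on_compose2[OF p_cont(1) cY subset_UNIV]
    continuous_on_compose2[OF p_cont(2) cY subset_UNIV]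
    continuous_on_compose2[OF cp2 cY subset_UNIV]
  note cv = continuous_on_subset[OF continuous_on_time_slice[OF cont_v t] K]
  note cD = continuous_on_subset[OF continuous_on_time_slice[OF cont_Dv t] K]
  note cD2 = continuous_on_subset[OF continuous_on_time_slice[OF cont_D2 t] K]
  define g where "g b x = 2 * (Dv (t, x) \<bullet> b)\<^sup>2 * p (Y x) + 2 * v (t, x) * p (Y x) * D2 b (t, x)
    - (v (t, x))\<^sup>2 * (4 * ((x - c) \<bullet> b)\<^sup>2 * p2 (Y x) + 2 * p1 (Y x))" for b x
  have cg: "continuous_on ?K (g b)" if "b \<in> Basis" for b
    unfolding g_def by (intro continuous_intros cpY cv cD cD2 that)
  have zero: "(LINT x:?K|lborel. g b x) = 0" if b: "b \<in> Basis" for b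
  proof (rule integral_directional_derivative_eq_0[OF cK _ _ cg[OF b]])
    let ?f = "\<lambda>x. 2 * v (t, x) * p (Y x) * (Dv (t, x) \<bullet> b) - (v (t, x))\<^sup>2 * (2 * p1 (Y x) * ((x - c) \<bullet> b))"
    show "?f x = 0" if "x \<notin> ?K" for x
    proof -
      have "\<rho> < norm (x - c)" using that by (simp add: dist_norm norm_minus_commute)
      then have "\<rho>\<^sup>2 \<le> Y x"
        using \<rho> power_mono[of \<rho> "norm (x - c)" 2] by (simp add: Y_def power2_norm_eq_inner)
      then show ?thesis using supp[of "Y x"] by simp
    qed
    show "continuous_on ?K ?f"
      by (intro continuous_intros cpY cv cD)
    fix x assume x: "x \<in> ?K"
    then have xb: "x \<in> ball 0 1" using K by auto
    have bb: "b \<bullet> b = 1" using b by simp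
    note dv = directional_deriv_v[OF t xb, of b]
    have dY: "((\<lambda>s. Y (x + s *\<^sub>R b)) has_real_derivative 2 * ((x - c) \<bullet> b)) (at 0)"
      unfolding Y_def
      by (auto intro!: derivative_eq_intros simp: has_field_derivative_def fun_eq_iff inner_commute algebra_simps)
    have dp: "((\<lambda>s. p (Y (x + s *\<^sub>R b))) has_real_derivative p1 (Y x) * (2 * ((x - c) \<bullet> b))) (at 0)"
      using DERIV_chain2[OF _ dY, of p "p1 (Y x)"] p(1)[of "Y x"] by simp
    have dp1: "((\<lambda>s. p1 (Y (x + s *\<^sub>R b))) has_real_derivative p2 (Y x) * (2 * ((x - c) \<bullet> b))) (at 0)"
      using DERIV_chain2[OF _ dY, of p1 "p2 (Y x)"] p(2)[of "Y x"] by simp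
    have dl: "((\<lambda>s. (x + s *\<^sub>R b - c) \<bullet> b) has_real_derivative 1) (at 0)"
      using bb by (auto intro!: derivative_eq_intros simp: has_field_derivative_def)
    show "((\<lambda>s. 2 * v (t, x + s *\<^sub>R b) * p (Y (x + s *\<^sub>R b)) * (Dv (t, x + s *\<^sub>R b) \<bullet> b) -
        (v (t, x + s *\<^sub>R b))\<^sup>2 * (2 * p1 (Y (x + s *\<^sub>R b)) * ((x + s *\<^sub>R b - c) \<bullet> b)))
        has_real_derivative g b x) (at 0)"
      by (rule DERIV_cong[OF DERIV_diff[OF
          DERIV_mult[OF DERIV_mult[OF DERIV_cmult[OF dv, of 2] dp] deriv_Dv[OF t xb b]]
          DERIV_mult[OF DERIV_power[OF dv, where n = 2] DERIV_mult[OF DERIV_cmult[OF dp1, of 2] dl]]]])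
        (simp add: g_def power2_eq_square algebra_simps)
  qed
  have "(LINT x:?K|lborel. (\<Sum>b\<in>Basis. g b x)) = (\<Sum>b\<in>Basis. (LINT x:?K|lborel. g b x))"
    unfolding set_lebesgue_integral_def scaleR_sum_right
    by (rule Bochner_Integration.integral_sum)
      (use set_integrable_compact[OF cK cg] in \<open>auto simp: set_integrable_def\<close>)
  then have 0: "(LINT x:?K|lborel. (\<Sum>b\<in>Basis. g b x)) = 0" using zero by simp
  have sum_g: "(\<Sum>b\<in>Basis. g b x) = 2 * v (t, x) * p (Y x) * (\<Sum>b\<in>Basis. D2 b (t, x)) -
      ((v (t, x))\<^sup>2 * (4 * Y x * p2 (Y x) + 2 * real DIM('a) * p1 (Y x)) -
      2 * (norm (Dv (t, x)))\<^sup>2 * p (Y x))" for x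
    unfolding g_def sum.distrib sum_subtractf sum_distrib_left[symmetric] sum_distrib_right[symmetric]
      sum_inner_Basis_power2 power2_norm_eq_inner
    by (simp add: Y_def algebra_simps)
  have iA: "set_integrable lborel ?K (\<lambda>x. 2 * v (t, x) * p (Y x) * (\<Sum>b\<in>Basis. D2 b (t, x)))"
    by (intro set_integrable_compact[OF cK] continuous_intros cpY cv cD2)
  have iB: "set_integrable lborel ?K (\<lambda>x. (v (t, x))\<^sup>2 * (4 * Y x * p2 (Y x) + 2 * real DIM('a) * p1 (Y x)) -
      2 * (norm (Dv (t, x)))\<^sup>2 * p (Y x))"
    by (intro set_integrable_compact[OF cK] continuous_intros cpY cv cD cY)
  show ?thesis
    using 0 set_integral_diff(2)[OF iA iB] unfolding sum_g by linarith
qed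

text \<open>The divergence theorem for the field v^2 p x / |x|^2; the coefficient
  \<open>d - 2\<close> comes from the divergence of x / |x|^2.\<close>

lemma hardy_by_parts:
  assumes t: "t \<in> {0<..1}" and \<rho>: "0 \<le> \<rho>" "\<rho> < 1"
    and p: "\<And>y. (p has_real_derivative p1 y) (at y)" and cp1: "continuous_on UNIV p1"
    and supp: "\<And>y. \<rho>\<^sup>2 \<le> y \<Longrightarrow> p y = 0"
  shows "(LINT x:cball 0 \<rho>|lborel. 2 * v (t, x) * p (x \<bullet> x) * (Dv (t, x) \<bullet> x) / (x \<bullet> x)
     + (v (t, x))\<^sup>2 * (2 * p1 (x \<bullet> x) + (real DIM('a) - 2) * p (x \<bullet> x) / (x \<bullet> x))) = 0"
proof -
  let ?K = "cball (0::'a) \<rho>"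
  have cK: "compact ?K" and K: "?K \<subseteq> ball 0 1" using \<rho> by auto
  have p_cont: "continuous_on UNIV p"
    using p by (auto intro!: continuous_at_imp_continuous_on DERIV_isCont)
  have cY: "continuous_on X (\<lambda>x::'a. x \<bullet> x)" for X by (intro continuous_intros)
  note cpY = continuous_on_compose2[OF p_cont cY subset_UNIV]
    continuous_on_compose2[OF cp1 cY subset_UNIV]
  note cv = continuous_on_time_slice[OF cont_v t]
  note cD = continuous_on_time_slice[OF cont_Dv t]
  define g where "g b x = 2 * v (t, x) * p (x \<bullet> x) * (Dv (t, x) \<bullet> b) * (x \<bullet> b) / (x \<bullet> x)
     + (v (t, x))\<^sup>2 * (2 * p1 (x \<bullet> x) * (x \<bullet> b)\<^sup>2 / (x \<bullet> x) + p (x \<bullet> x) / (x \<bullet> x)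
         - 2 * p (x \<bullet> x) * (x \<bullet> b)\<^sup>2 / (x \<bullet> x)\<^sup>2)" for b x
  have cg: "continuous_on ?K (g b)" for b
    by (rule continuous_on_subset[OF continuous_on_vanishing_vertex[OF t] K])
      (auto simp: g_def intro!: continuous_intros cpY continuous_on_subset[OF cv] continuous_on_subset[OF cD])
  have zero: "(LINT x:?K|lborel. g b x) = 0" if b: "b \<in> Basis" for b
  proof (rule integral_directional_derivative_eq_0[OF cK _ _ cg])
    let ?f = "\<lambda>x. (v (t, x))\<^sup>2 * p (x \<bullet> x) * (x \<bullet> b) / (x \<bullet> x)"
    show "?f x = 0" if "x \<notin> ?K" for x
      using that \<rho> power_mono[of \<rho> "norm x" 2] supp[of "x \<bullet> x"]
      by (simp add: power2_norm_eq_inner)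
    show "continuous_on ?K ?f"
      by (rule continuous_on_subset[OF continuous_on_vanishing_vertex[OF t] K])
        (auto intro!: continuous_intros cpY continuous_on_subset[OF cv])
    fix x assume x: "x \<in> ?K"
    then have xb: "x \<in> ball 0 1" using K by auto
    have bb: "b \<bullet> b = 1" using b by simp
    show "((\<lambda>s. (v (t, x + s *\<^sub>R b))\<^sup>2 * p ((x + s *\<^sub>R b) \<bullet> (x + s *\<^sub>R b)) * ((x + s *\<^sub>R b) \<bullet> b) /
        ((x + s *\<^sub>R b) \<bullet> (x + s *\<^sub>R b))) has_real_derivative g b x) (at 0)"
    proof (cases "x = 0")
      case True
      \<comment> \<open>At the origin the formula for \<open>g\<close> divides by zero and has the
        value 0, which is the correct derivative because the field vanishes nearby.\<close>
      obtain e where e: "e > 0" "\<And>x. x \<in> ball 0 e \<Longrightarrow> v (t, x) = 0" using v_vertex[OF t] by auto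
      have "((\<lambda>s. 0) has_real_derivative g b x) (at 0)" using True by (simp add: g_def)
      then show ?thesis
        by (rule has_field_derivative_transform_within_open[where S = "ball 0 e"])
          (use e b True in auto)
    next
      case False
      have dY: "((\<lambda>s. (x + s *\<^sub>R b) \<bullet> (x + s *\<^sub>R b)) has_real_derivative 2 * (x \<bullet> b)) (at 0)"
        by (auto intro!: derivative_eq_intros simp: has_field_derivative_def fun_eq_iff inner_commute algebra_simps)
      have dp: "((\<lambda>s. p ((x + s *\<^sub>R b) \<bullet> (x + s *\<^sub>R b))) has_real_derivative p1 (x \<bullet> x) * (2 * (x \<bullet> b))) (at 0)"
        using DERIV_chain2[OF _ dY, of p "p1 (x \<bullet> x)"] p[of "x \<bullet> x"] by simp
      have dl: "((\<lambda>s. (x + s *\<^sub>R b) \<bullet> b) has_real_derivative 1) (at 0)"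
        using bb by (auto intro!: derivative_eq_intros simp: has_field_derivative_def)
      show ?thesis
        by (rule DERIV_cong[OF DERIV_divide[OF
            DERIV_mult[OF DERIV_mult[OF DERIV_power[OF directional_deriv_v[OF t xb], where n = 2] dp] dl] dY]])
          (use False in \<open>simp_all add: g_def power2_eq_square field_simps\<close>)
    qed
  qed
  have "(LINT x:?K|lborel. (\<Sum>b\<in>Basis. g b x)) = (\<Sum>b\<in>Basis. (LINT x:?K|lborel. g b x))"
    unfolding set_lebesgue_integral_def scaleR_sum_right
    by (rule Bochner_Integration.integral_sum)
      (use set_integrable_compact[OF cK cg] in \<open>auto simp: set_integrable_def\<close>)
  then have 0: "(LINT x:?K|lborel. (\<Sum>b\<in>Basis. g b x)) = 0" using zero by simp
  have "(\<Sum>b\<in>Basis. g b x) = 2 * v (t, x) * p (x \<bullet> x) * (Dv (t, x) \<bullet> x) / (x \<bullet> x)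
     + (v (t, x))\<^sup>2 * (2 * p1 (x \<bullet> x) + (real DIM('a) - 2) * p (x \<bullet> x) / (x \<bullet> x))" for x
  proof (cases "v (t, x) = 0")
    case False
    then have x: "x \<bullet> x \<noteq> 0" using v_vertex[OF t] by (metis centre_in_ball inner_eq_zero_iff)
    have "(\<Sum>b\<in>Basis. g b x) = 2 * v (t, x) * p (x \<bullet> x) * (\<Sum>b\<in>Basis. (Dv (t, x) \<bullet> b) * (x \<bullet> b)) / (x \<bullet> x)
     + (v (t, x))\<^sup>2 * (2 * p1 (x \<bullet> x) * (\<Sum>b\<in>Basis. (x \<bullet> b)\<^sup>2) / (x \<bullet> x) + real DIM('a) * p (x \<bullet> x) / (x \<bullet> x)
         - 2 * p (x \<bullet> x) * (\<Sum>b\<in>Basis. (x \<bullet> b)\<^sup>2) / (x \<bullet> x)\<^sup>2)"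
      by (simp add: g_def sum.distrib sum_subtractf sum_distrib_left sum_distrib_right sum_divide_distrib
          mult.assoc right_diff_distrib distrib_left)
    then show ?thesis
      using x unfolding sum_inner_Basis_power2 euclidean_inner[of "Dv (t, x)" x, symmetric]
      by (simp add: field_simps power2_eq_square)
  qed (simp add: g_def)
  then show ?thesis using 0 by simp
qed

text \<open>This is the gain over the plain energy identity: trading the gradient term for
  \<open>4 * \<alpha> * v\<^sup>2 * p1\<close> raises the coefficient of \<open>p1\<close> in the
  Laplacian of the weight from \<open>2 * d\<close> to \<open>2 * (d + 2 * \<alpha>)\<close>, that
  of a space of dimension \<open>d + 2 * \<alpha>\<close>.\<close>

lemma hardy:
  assumes t: "t \<in> {0<..1}" and \<rho>: "0 \<le> \<rho>" "\<rho> < 1"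
    and L: "0 \<le> Lambda0 M" "\<alpha> * (\<alpha> + real DIM('a) - 2) \<le> Lambda0 M"
    and p: "\<And>y. (p has_real_derivative p1 y) (at y)" "\<And>y. 0 \<le> p y" and cp1: "continuous_on UNIV p1"
    and supp: "\<And>y. \<rho>\<^sup>2 \<le> y \<Longrightarrow> p y = 0"
  shows "(LINT x:cball 0 \<rho>|lborel. - 2 * (norm (Dv (t, x)))\<^sup>2 * p (x \<bullet> x)) \<le>
    (LINT x:cball 0 \<rho>|lborel. 4 * \<alpha> * (v (t, x))\<^sup>2 * p1 (x \<bullet> x))"
proof -
  let ?K = "cball (0::'a) \<rho>"
  have cK: "compact ?K" and K: "?K \<subseteq> ball 0 1" using \<rho> by auto
  have p_cont: "continuous_on UNIV p"
    using p by (auto intro!: continuous_at_imp_continuous_on DERIV_isCont)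
  have cY: "continuous_on X (\<lambda>x::'a. x \<bullet> x)" for X by (intro continuous_intros)
  note cpY = continuous_on_compose2[OF p_cont cY subset_UNIV]
    continuous_on_compose2[OF cp1 cY subset_UNIV]
  note cv = continuous_on_time_slice[OF cont_v t]
  note cD = continuous_on_time_slice[OF cont_Dv t]
  define w where "w x = (v (t, x))\<^sup>2 * p (x \<bullet> x) / (x \<bullet> x)" for x
  define h where "h x = 2 * v (t, x) * p (x \<bullet> x) * (Dv (t, x) \<bullet> x) / (x \<bullet> x)" for x
  define z where "z x = (v (t, x))\<^sup>2 * p1 (x \<bullet> x)" for x
  define n where "n x = (norm (Dv (t, x)))\<^sup>2 * p (x \<bullet> x)" for x
  define q where "q x = (Dv (t, x) \<bullet> x)\<^sup>2 / (x \<bullet> x) * p (x \<bullet> x)" for x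
  note int_ball = set_integrable_compact[OF cK continuous_on_subset[OF _ K]]
  have iw: "set_integrable lborel ?K w"
    by (intro int_ball continuous_on_vanishing_vertex[OF t])
      (auto simp: w_def intro!: continuous_intros cpY continuous_on_subset[OF cv])
  have ih: "set_integrable lborel ?K h"
    by (intro int_ball continuous_on_vanishing_vertex[OF t])
      (auto simp: h_def intro!: continuous_intros cpY continuous_on_subset[OF cv] continuous_on_subset[OF cD])
  have iz: "set_integrable lborel ?K z" and i_n: "set_integrable lborel ?K n"
    and iq: "set_integrable lborel ?K q"
    unfolding z_def n_def q_def
    by (intro int_ball continuous_intros cpY cv cD continuous_on_radial_part[OF t])+
  define W H Z N Q where "W = (LINT x:?K|lborel. w x)" and "H = (LINT x:?K|lborel. h x)"
    and "Z = (LINT x:?K|lborel. z x)" and "N = (LINT x:?K|lborel. n x)" and "Q = (LINT x:?K|lborel. q x)"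
  have "Lambda0 M * W \<le> N - Q"
  proof -
    have "(LINT x:?K|lborel. Lambda0 M * w x) \<le> (LINT x:?K|lborel. n x - q x)"
      using angular_gradient_ge[OF t \<rho>(2) L(1) p_cont p(2)]
      by (simp add: w_def n_def q_def algebra_simps)
    then show ?thesis using set_integral_diff(2)[OF i_n iq] by (simp add: W_def N_def Q_def)
  qed
  moreover have "H + (2 * Z + (real DIM('a) - 2) * W) = 0"
  proof -
    have i1: "set_integrable lborel ?K (\<lambda>x. 2 * z x)" "set_integrable lborel ?K (\<lambda>x. (real DIM('a) - 2) * w x)"
      using iz iw by auto
    have i2: "set_integrable lborel ?K (\<lambda>x. 2 * z x + (real DIM('a) - 2) * w x)"
      using set_integral_add(1)[OF i1] .
    have "(LINT x:?K|lborel. h x + (2 * z x + (real DIM('a) - 2) * w x)) = 0"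
      using hardy_by_parts[OF t \<rho> p(1) cp1 supp] by (simp add: h_def z_def w_def algebra_simps)
    then show ?thesis
      using set_integral_add(2)[OF ih i2] set_integral_add(2)[OF i1] by (simp add: H_def Z_def W_def)
  qed
  \<comment> \<open>From the square of \<open>Dv (t, x) \<bullet> x - \<alpha> * v (t, x)\<close>,
    which by Euler's relation vanishes for functions homogeneous of degree \<alpha>.\<close>
  moreover have "\<alpha> * H \<le> Q + \<alpha>\<^sup>2 * W"
  proof -
    have i1: "set_integrable lborel ?K (\<lambda>x. \<alpha> * h x)" "set_integrable lborel ?K (\<lambda>x. \<alpha>\<^sup>2 * w x)"
      using ih iw by auto
    have "(LINT x:?K|lborel. \<alpha> * h x) \<le> (LINT x:?K|lborel. q x + \<alpha>\<^sup>2 * w x)"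
    proof (rule set_integral_mono[OF i1(1) set_integral_add(1)[OF iq i1(2)]])
      fix x
      have "0 \<le> (Dv (t, x) \<bullet> x - \<alpha> * v (t, x))\<^sup>2 / (x \<bullet> x) * p (x \<bullet> x)" using p(2) by simp
      then show "\<alpha> * h x \<le> q x + \<alpha>\<^sup>2 * w x"
        by (simp add: h_def q_def w_def power2_diff add_divide_distrib diff_divide_distrib
            power_mult_distrib algebra_simps)
    qed
    then show ?thesis using set_integral_add(2)[OF iq i1(2)] by (simp add: H_def Q_def W_def)
  qed
  moreover have "0 \<le> W"
    unfolding W_def set_lebesgue_integral_def
    by (rule Bochner_Integration.integral_nonneg) (simp add: w_def p(2))
  then have "(\<alpha> * (\<alpha> + real DIM('a) - 2)) * W \<le> Lambda0 M * W"
    using L(2) by (intro mult_right_mono)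
  moreover have "\<alpha> * H = - (2 * \<alpha> * Z) - (\<alpha> * (real DIM('a) - 2)) * W"
  proof -
    have H: "H = - (2 * Z + (real DIM('a) - 2) * W)" using calculation(2) by linarith
    show ?thesis unfolding H by (simp add: algebra_simps)
  qed
  \<comment> \<open>Eliminating \<open>H\<close> and \<open>Q\<close> shows that \<open>N\<close> is
    at least \<open>(Lambda0 M - \<alpha> * (\<alpha> + d - 2)) * W - 2 * \<alpha> * Z\<close>,
    where the first term is nonnegative.\<close>
  ultimately have "- 2 * N \<le> 4 * \<alpha> * Z"
    by (simp add: algebra_simps power2_eq_square)
  moreover have "(LINT x:?K|lborel. - 2 * n x) = - 2 * N" "(LINT x:?K|lborel. 4 * \<alpha> * z x) = 4 * \<alpha> * Z"
    unfolding N_def Z_def by (rule set_integral_mult_right)+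
  ultimately show ?thesis by (simp only: n_def z_def mult.assoc)
qed

section \<open>Energy inequality for radial weights depending on time\<close>

lemma set_integral_const_lborel:
  assumes "a \<le> b"
  shows "(LINT t:{a..b::real}|lborel. c) = (b - a) * (c::real)"
  using assms by (simp add: set_lebesgue_integral_def)

text \<open>Formally, the weighted mass has time derivative at most the integral of
  \<open>v\<^sup>2 * (pt + 4 * y * p2 + 2 * D * p1)\<close>. The hypothesis \<open>dim\<close>
  isolates the treatment of the gradient term: for \<open>D = d\<close> it holds trivially at any
  centre, for \<open>D = d + 2 * \<alpha>\<close> it is \<open>hardy\<close> at the vertex, and one
  proof serves both. The error \<open>E\<close> is paired with the bound \<open>m\<close> on the
  unweighted mass.\<close>

lemma energy_estimate:
  fixes c :: 'a
  assumes ab: "0 < a" "a \<le> b" "b \<le> 1" and K: "cball c \<rho> \<subseteq> ball 0 1" "0 \<le> \<rho>"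
    and p1: "\<And>t y. t \<in> {a..b} \<Longrightarrow> (p t has_real_derivative p1 t y) (at y)"
    and p2: "\<And>t y. t \<in> {a..b} \<Longrightarrow> (p1 t has_real_derivative p2 t y) (at y)"
    and pt: "\<And>t y. t \<in> {a..b} \<Longrightarrow> ((\<lambda>s. p s y) has_real_derivative pt t y) (at t within {a..b})"
    and cp: "continuous_on ({a..b} \<times> UNIV) (\<lambda>z. p (fst z) (snd z))"
    and cpt: "continuous_on ({a..b} \<times> UNIV) (\<lambda>z. pt (fst z) (snd z))"
    and cp2: "\<And>t. t \<in> {a..b} \<Longrightarrow> continuous_on UNIV (p2 t)"
    and supp: "\<And>t y. t \<in> {a..b} \<Longrightarrow> \<rho>\<^sup>2 \<le> y \<Longrightarrow> p t y = 0 \<and> p1 t y = 0"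
    and pos: "\<And>t y. t \<in> {a..b} \<Longrightarrow> 0 \<le> p t y"
    and dim: "\<And>t. t \<in> {a..b} \<Longrightarrow>
      (LINT x:cball c \<rho>|lborel. - 2 * (norm (Dv (t, x)))\<^sup>2 * p t ((x - c) \<bullet> (x - c))) \<le>
      (LINT x:cball c \<rho>|lborel. 2 * (D - real DIM('a)) * (v (t, x))\<^sup>2 * p1 t ((x - c) \<bullet> (x - c)))"
    and super: "\<And>t y. t \<in> {a..b} \<Longrightarrow> 0 \<le> y \<Longrightarrow> pt t y + 4 * y * p2 t y + 2 * D * p1 t y \<le> E"
    and mass: "\<And>t. t \<in> {a..b} \<Longrightarrow> (LINT x:cball c \<rho>|lborel. (v (t, x))\<^sup>2) \<le> m" and E: "0 \<le> E"
  shows "(LINT x:cball c \<rho>|lborel. (v (b, x))\<^sup>2 * p b ((x - c) \<bullet> (x - c))) \<le>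
    (LINT x:cball c \<rho>|lborel. (v (a, x))\<^sup>2 * p a ((x - c) \<bullet> (x - c))) + (b - a) * (E * m)"
proof -
  let ?K = "cball c \<rho>"
  define Y where "Y x = (x - c) \<bullet> (x - c)" for x
  have cK: "compact ?K" by simp
  have cY: "continuous_on X Y" for X unfolding Y_def by (intro continuous_intros)
  have sub: "{a..b} \<times> ?K \<subseteq> {0<..1} \<times> ball 0 1" using ab K by auto
  define k where "k t x = 2 * v (t, x) * vt (t, x) * p t (Y x) + (v (t, x))\<^sup>2 * pt t (Y x)" for t x
  have cY2: "continuous_on ({a..b} \<times> ?K) (\<lambda>z. (fst z, Y (snd z)))"
    unfolding Y_def by (intro continuous_intros)
  have im: "(\<lambda>z. (fst z, Y (snd z))) ` ({a..b} \<times> ?K) \<subseteq> {a..b} \<times> UNIV" by auto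
  have ck: "continuous_on ({a..b} \<times> ?K) (\<lambda>z. k (fst z) (snd z))"
    using continuous_on_compose2[OF cp cY2 im] continuous_on_compose2[OF cpt cY2 im]
    by (auto simp: k_def intro!: continuous_intros continuous_on_subset[OF cont_v sub]
        continuous_on_subset[OF cont_vt sub])
  \<comment> \<open>Fubini together with the fundamental theorem of calculus in \<open>t\<close> at
    fixed \<open>x\<close> takes the place of differentiation under the integral sign.\<close>
  define Z where "Z t x = indicator ({a..b} \<times> ?K) (t, x) *\<^sub>R k t x" for t x
  have "integrable lborel (\<lambda>z. indicator ({a..b} \<times> ?K) z *\<^sub>R k (fst z) (snd z))"
    by (rule borel_integrable_compact[OF compact_Times[OF compact_Icc cK] ck])
  moreover have "(\<lambda>(t, x). Z t x) = (\<lambda>z. indicator ({a..b} \<times> ?K) z *\<^sub>R k (fst z) (snd z))"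
    by (auto simp: Z_def fun_eq_iff)
  ultimately have iZ: "integrable (lborel \<Otimes>\<^sub>M lborel) (\<lambda>(t, x). Z t x)"
    by (simp only: lborel_prod)
  have Fub: "(LINT x|lborel. LINT t|lborel. Z t x) = (LINT t|lborel. LINT x|lborel. Z t x)"
    by (rule lborel_pair.Fubini_integral[OF iZ])
  have split: "Z t x = indicator {a..b} t *\<^sub>R (indicator ?K x *\<^sub>R k t x)" for t x
    by (simp add: Z_def indicator_times)
  have tI: "t \<in> {0<..1}" if "t \<in> {a..b}" for t using that ab by auto
  have inner_t: "(LINT t|lborel. Z t x) =
      indicator ?K x *\<^sub>R ((v (b, x))\<^sup>2 * p b (Y x) - (v (a, x))\<^sup>2 * p a (Y x))" for x
  proof (cases "x \<in> ?K")
    case True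
    then have x: "x \<in> ball 0 1" using K by auto
    have "(LINT t|lborel. indicator {a..b} t *\<^sub>R k t x) =
        (v (b, x))\<^sup>2 * p b (Y x) - (v (a, x))\<^sup>2 * p a (Y x)"
    proof (rule integral_FTC_atLeastAtMost[OF ab(2)])
      show "continuous_on {a..b} (\<lambda>t. k t x)"
        by (rule continuous_on_compose2[OF ck, of _ "\<lambda>t. (t, x)", simplified])
          (use True in \<open>auto intro!: continuous_intros\<close>)
      fix t assume t: "a \<le> t" "t \<le> b"
      have 1: "((\<lambda>s. v (s, x)) has_real_derivative vt (t, x)) (at t within {a..b})"
        by (rule DERIV_subset[OF deriv_t[OF tI x]]) (use t ab in auto)
      have "((\<lambda>t. (v (t, x))\<^sup>2 * p t (Y x)) has_real_derivative k t x) (at t within {a..b})"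
        by (rule DERIV_cong[OF DERIV_mult[OF DERIV_power[OF 1, where n = 2] pt]])
          (use t in \<open>auto simp: k_def algebra_simps\<close>)
      then show "((\<lambda>t. (v (t, x))\<^sup>2 * p t (Y x)) has_vector_derivative k t x) (at t within {a..b})"
        by (simp add: has_real_derivative_iff_has_vector_derivative)
    qed
    then show ?thesis using True by (simp add: split)
  qed (simp add: split)
  have slice: "(LINT x:?K|lborel. k t x) \<le> E * m" if t: "t \<in> {a..b}" for t
  proof -
    note tt = tI[OF t]
    note cv = continuous_on_subset[OF continuous_on_time_slice[OF cont_v tt] K(1)]
    note cD = continuous_on_subset[OF continuous_on_time_slice[OF cont_Dv tt] K(1)]
    note cD2 = continuous_on_subset[OF continuous_on_time_slice[OF cont_D2 tt] K(1)]
    have c1: "continuous_on UNIV (p t)" "continuous_on UNIV (p1 t)"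
      using p1[OF t] p2[OF t] by (auto intro!: continuous_at_imp_continuous_on DERIV_isCont)
    have c2: "continuous_on UNIV (pt t)"
      by (rule continuous_on_compose2[OF cpt, of _ "\<lambda>y. (t, y)", simplified])
        (use t in \<open>auto intro!: continuous_intros\<close>)
    note cpY = continuous_on_compose2[OF c1(1) cY subset_UNIV] continuous_on_compose2[OF c1(2) cY subset_UNIV]
      continuous_on_compose2[OF c2 cY subset_UNIV] continuous_on_compose2[OF cp2[OF t] cY subset_UNIV]
    define L where "L x = 2 * v (t, x) * p t (Y x) * (\<Sum>b\<in>Basis. D2 b (t, x))" for x
    define T where "T x = (v (t, x))\<^sup>2 * pt t (Y x)" for x
    define A where "A x = (v (t, x))\<^sup>2 * (4 * Y x * p2 t (Y x) + 2 * real DIM('a) * p1 t (Y x))" for x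
    define n where "n x = - 2 * (norm (Dv (t, x)))\<^sup>2 * p t (Y x)" for x
    define B where "B x = 2 * (D - real DIM('a)) * (v (t, x))\<^sup>2 * p1 t (Y x)" for x
    have iL: "set_integrable lborel ?K L"
      unfolding L_def by (intro set_integrable_compact[OF cK] continuous_intros cpY cv cD2)
    have i: "set_integrable lborel ?K T" "set_integrable lborel ?K A"
      "set_integrable lborel ?K n" "set_integrable lborel ?K B" "set_integrable lborel ?K (\<lambda>x. (v (t, x))\<^sup>2)"
      "set_integrable lborel ?K (k t)"
      unfolding T_def A_def n_def B_def k_def
      by (intro set_integrable_compact[OF cK] continuous_intros cpY cv cD cY
          continuous_on_subset[OF continuous_on_time_slice[OF cont_vt tt] K(1)])+
    have "(LINT x:?K|lborel. k t x) \<le> (LINT x:?K|lborel. L x + T x)"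
    proof (rule set_integral_mono[OF i(6) set_integral_add(1)[OF iL i(1)]])
      fix x assume "x \<in> ?K"
      then have x: "x \<in> ball 0 1" using K by auto
      \<comment> \<open>The subsolution inequality enters here; the factor in front of it is
        nonnegative.\<close>
      have "2 * v (t, x) * p t (Y x) * vt (t, x) \<le> L x"
        unfolding L_def using subsolution[OF tt x] v_nonneg[OF tt x] pos[OF t]
        by (intro mult_left_mono) auto
      then show "k t x \<le> L x + T x" by (simp add: k_def T_def mult.commute mult.left_commute)
    qed
    also have "\<dots> = (LINT x:?K|lborel. A x + n x) + (LINT x:?K|lborel. T x)"
    proof -
      have "(LINT x:?K|lborel. L x) = (LINT x:?K|lborel. A x + n x)"
        using laplacian_by_parts[OF tt K p1[OF t] p2[OF t] cp2[OF t] supp[OF t]]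
        by (simp add: L_def A_def n_def Y_def)
      then show ?thesis by (simp only: set_integral_add(2)[OF iL i(1)])
    qed
    also have "\<dots> = (LINT x:?K|lborel. A x) + (LINT x:?K|lborel. n x) + (LINT x:?K|lborel. T x)"
      by (simp add: set_integral_add(2)[OF i(2,3)])
    also have "\<dots> \<le> (LINT x:?K|lborel. A x) + (LINT x:?K|lborel. B x) + (LINT x:?K|lborel. T x)"
      using dim[OF t] by (simp add: n_def B_def Y_def)
    also have "\<dots> = (LINT x:?K|lborel. A x + B x + T x)"
      by (simp add: set_integral_add(2)[OF i(2,4)] set_integral_add(2)[OF set_integral_add(1)[OF i(2,4)] i(1)])
    also have "\<dots> \<le> (LINT x:?K|lborel. E * (v (t, x))\<^sup>2)"
    proof (rule set_integral_mono)
      show "set_integrable lborel ?K (\<lambda>x. A x + B x + T x)"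
        by (intro set_integral_add(1) i)
      show "set_integrable lborel ?K (\<lambda>x. E * (v (t, x))\<^sup>2)" using i(5) by simp
      fix x
      have "(v (t, x))\<^sup>2 * (pt t (Y x) + 4 * Y x * p2 t (Y x) + 2 * D * p1 t (Y x)) \<le> (v (t, x))\<^sup>2 * E"
        by (intro mult_left_mono super[OF t]) (auto simp: Y_def)
      then show "A x + B x + T x \<le> E * (v (t, x))\<^sup>2"
        by (simp add: A_def B_def T_def algebra_simps)
    qed
    also have "\<dots> = E * (LINT x:?K|lborel. (v (t, x))\<^sup>2)" by simp
    also have "\<dots> \<le> E * m" using mass[OF t] E by (rule mult_left_mono)
    finally show ?thesis .
  qed
  have iv: "set_integrable lborel ?K (\<lambda>x. (v (t, x))\<^sup>2 * p t (Y x))" if t: "t \<in> {a..b}" for t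
  proof -
    have c1: "continuous_on UNIV (p t)"
      using p1[OF t] by (auto intro!: continuous_at_imp_continuous_on DERIV_isCont)
    show ?thesis
      by (intro set_integrable_compact[OF cK] continuous_intros continuous_on_compose2[OF c1 cY subset_UNIV]
        continuous_on_subset[OF continuous_on_time_slice[OF cont_v tI[OF t]] K(1)])
  qed
  have "(LINT x:?K|lborel. (v (b, x))\<^sup>2 * p b (Y x)) - (LINT x:?K|lborel. (v (a, x))\<^sup>2 * p a (Y x)) =
      (LINT x|lborel. LINT t|lborel. Z t x)"
    using set_integral_diff(2)[OF iv iv, of b a] ab
    by (simp add: inner_t set_lebesgue_integral_def)
  also have "\<dots> = (LINT t|lborel. LINT x|lborel. Z t x)" by (rule Fub)
  also have "\<dots> \<le> (LINT t:{a..b}|lborel. E * m)"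
    unfolding set_lebesgue_integral_def
  proof (rule integral_mono)
    show "integrable lborel (\<lambda>t. LINT x|lborel. Z t x)"
      using lborel_pair.integrable_fst'[OF iZ] by simp
    show "integrable lborel (\<lambda>t. indicator {a..b} t *\<^sub>R (E * m))"
      by (intro borel_integrable_compact continuous_intros) auto
    show "(LINT x|lborel. Z t x) \<le> indicator {a..b} t *\<^sub>R (E * m)" for t
      using slice[of t] by (cases "t \<in> {a..b}") (auto simp: split set_lebesgue_integral_def)
  qed
  also have "\<dots> = (b - a) * (E * m)" by (rule set_integral_const_lborel[OF ab(2)])
  finally show ?thesis unfolding Y_def by linarith
qed

end

section \<open>Heat kernels of fractional dimension with a cutoff\<close>

text \<open>The exponent is at least two, so at the kink the difference quotient
  \<open>max 0 h ^ k\<close> tends to zero. Applied twice, this makes the cube of the cutoff twice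
  continuously differentiable.\<close>

lemma DERIV_max_0_power:
  assumes "k > 0"
  shows "((\<lambda>s::real. max 0 s ^ Suc k) has_real_derivative real (Suc k) * max 0 s ^ k) (at s)"
proof -
  consider "s > 0" | "s < 0" | "s = 0" by linarith
  then show ?thesis
  proof cases
    case 1
    have "((\<lambda>s. s ^ Suc k) has_real_derivative real (Suc k) * max 0 s ^ k) (at s)"
      using DERIV_pow[of "Suc k" s] 1 by simp
    then show ?thesis
      by (rule has_field_derivative_transform_within_open[where S = "{0<..}"]) (use 1 in auto)
  next
    case 2
    have "((\<lambda>s. 0) has_real_derivative real (Suc k) * max 0 s ^ k) (at s)"
      using 2 assms by (simp add: zero_power)
    then show ?thesis
      by (rule has_field_derivative_transform_within_open[where S = "{..<0}"]) (use 2 in auto)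
  next
    case 3
    have "(\<lambda>h::real. max 0 h ^ Suc k / h) = (\<lambda>h. max 0 h ^ k)"
      using assms by (auto simp: fun_eq_iff max_def)
    moreover have "((\<lambda>h::real. max 0 h ^ k) \<longlongrightarrow> max 0 0 ^ k) (at 0)"
      by (intro tendsto_intros)
    ultimately show ?thesis using 3 assms by (simp add: DERIV_def zero_power)
  qed
qed

text \<open>
  Heat kernel of the possibly fractional dimension \<open>D\<close>, as a function of the squared distance \<open>y\<close>,
  with a cutoff that is flat to high order at \<open>y = 0\<close>. The flatness compensates the singularity
  of the kernel in the commutator of cutoff and heat operator.
\<close>

definition heat_ker :: "real \<Rightarrow> real \<Rightarrow> real \<Rightarrow> real" where
  "heat_ker D T y = T powr (- D / 2) * exp (- y / (4 * T))"

definition cut :: "nat \<Rightarrow> real \<Rightarrow> real \<Rightarrow> real" where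
  "cut n \<rho> y = max 0 (\<rho> ^ (2 * n) - y ^ n)"

text \<open>The third power is the smallest integer power of the cutoff whose second derivative in
  \<open>y\<close> is still continuous at the edge.\<close>

definition cut_ker :: "real \<Rightarrow> nat \<Rightarrow> real \<Rightarrow> real \<Rightarrow> real \<Rightarrow> real" where
  "cut_ker D n \<rho> T y = heat_ker D T y * cut n \<rho> y ^ 3"

definition cut_ker_y :: "real \<Rightarrow> nat \<Rightarrow> real \<Rightarrow> real \<Rightarrow> real \<Rightarrow> real" where
  "cut_ker_y D n \<rho> T y = heat_ker D T y *
    (- 1 / (4 * T) * cut n \<rho> y ^ 3 - 3 * real n * cut n \<rho> y ^ 2 * y ^ (n - 1))"

definition cut_ker_yy :: "real \<Rightarrow> nat \<Rightarrow> real \<Rightarrow> real \<Rightarrow> real \<Rightarrow> real" where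
  "cut_ker_yy D n \<rho> T y = heat_ker D T y *
    (1 / (16 * T\<^sup>2) * cut n \<rho> y ^ 3 + 3 * real n / (2 * T) * cut n \<rho> y ^ 2 * y ^ (n - 1)
     + 6 * (real n)\<^sup>2 * cut n \<rho> y * (y ^ (n - 1))\<^sup>2 - 3 * real n * real (n - 1) * cut n \<rho> y ^ 2 * y ^ (n - 2))"

definition cut_ker_T :: "real \<Rightarrow> nat \<Rightarrow> real \<Rightarrow> real \<Rightarrow> real \<Rightarrow> real" where
  "cut_ker_T D n \<rho> T y = heat_ker D T y * (y / (4 * T\<^sup>2) - D / (2 * T)) * cut n \<rho> y ^ 3"

lemma heat_ker_nonneg: "0 \<le> heat_ker D T y"
  by (simp add: heat_ker_def)

lemma cut_nonneg: "0 \<le> cut n \<rho> y"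
  by (simp add: cut_def)

lemma cut_le: "0 \<le> y \<Longrightarrow> cut n \<rho> y \<le> \<rho> ^ (2 * n)"
  by (simp add: cut_def)

lemma cut_ker_nonneg: "0 \<le> cut_ker D n \<rho> T y"
  by (simp add: cut_ker_def heat_ker_nonneg cut_nonneg)

lemma cut_eq_0: "\<rho>\<^sup>2 \<le> y \<Longrightarrow> cut n \<rho> y = 0"
  using power_mono[of "\<rho>\<^sup>2" y n] by (simp add: cut_def power_mult)

lemma heat_ker_deriv_y:
  "T > 0 \<Longrightarrow> (heat_ker D T has_real_derivative heat_ker D T y * (- 1 / (4 * T))) (at y)"
  unfolding heat_ker_def[abs_def] by (auto intro!: derivative_eq_intros)

lemma heat_ker_deriv_T:
  assumes "T > 0"
  shows "((\<lambda>T. heat_ker D T y) has_real_derivative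
    heat_ker D T y * (y / (4 * T\<^sup>2) - D / (2 * T))) (at T)"
proof -
  have p: "((\<lambda>T. T powr (- D / 2)) has_real_derivative (- D / 2) * T powr (- D / 2 - 1)) (at T)"
    by (rule has_real_derivative_powr[OF assms])
  have e: "((\<lambda>T. exp (- y / (4 * T))) has_real_derivative exp (- y / (4 * T)) * (y / (4 * T\<^sup>2))) (at T)"
    using assms by (auto intro!: derivative_eq_intros simp: field_simps power2_eq_square)
  have pm: "T powr (- D / 2 - 1) = T powr (- D / 2) / T"
    using assms by (subst powr_diff) simp
  show ?thesis unfolding heat_ker_def
    by (rule DERIV_cong[OF DERIV_mult[OF p e]])
      (simp only: pm, simp add: algebra_simps)
qed

lemma cut_power_deriv:
  assumes "k > 0"
  shows "((\<lambda>y. cut n \<rho> y ^ Suc k) has_real_derivative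
    real (Suc k) * cut n \<rho> y ^ k * - (real n * y ^ (n - 1))) (at y)"
proof -
  have "((\<lambda>y. \<rho> ^ (2 * n) - y ^ n) has_real_derivative - (real n * y ^ (n - 1))) (at y)"
    by (auto intro!: derivative_eq_intros)
  from DERIV_chain2[OF DERIV_max_0_power[OF assms] this] show ?thesis
    by (simp only: cut_def)
qed

lemma cut_ker_deriv_y:
  assumes "T > 0"
  shows "(cut_ker D n \<rho> T has_real_derivative cut_ker_y D n \<rho> T y) (at y)"
proof -
  have c: "((\<lambda>y. cut n \<rho> y ^ 3) has_real_derivative 3 * cut n \<rho> y ^ 2 * - (real n * y ^ (n - 1))) (at y)"
    using cut_power_deriv[of 2 n \<rho> y] by (simp add: eval_nat_numeral)
  show ?thesis unfolding cut_ker_def[abs_def]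
    by (rule DERIV_cong[OF DERIV_mult[OF heat_ker_deriv_y[OF assms] c]])
      (simp add: cut_ker_y_def algebra_simps)
qed

lemma cut_ker_deriv_yy:
  assumes "T > 0"
  shows "(cut_ker_y D n \<rho> T has_real_derivative cut_ker_yy D n \<rho> T y) (at y)"
proof -
  have c3: "((\<lambda>y. cut n \<rho> y ^ 3) has_real_derivative 3 * cut n \<rho> y ^ 2 * - (real n * y ^ (n - 1))) (at y)"
    using cut_power_deriv[of 2 n \<rho> y] by (simp add: eval_nat_numeral)
  have c2: "((\<lambda>y. cut n \<rho> y ^ 2) has_real_derivative 2 * cut n \<rho> y * - (real n * y ^ (n - 1))) (at y)"
    using cut_power_deriv[of 1 n \<rho> y] by (simp add: eval_nat_numeral)
  have pw: "((\<lambda>y::real. y ^ (n - 1)) has_real_derivative real (n - 1) * y ^ (n - 2)) (at y)"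
    using DERIV_pow[of "n - 1" y] by (simp add: numeral_2_eq_2)
  show ?thesis unfolding cut_ker_y_def[abs_def]
    by (rule DERIV_cong[OF DERIV_mult[OF heat_ker_deriv_y[OF assms]
          DERIV_diff[OF DERIV_cmult[OF c3] DERIV_mult[OF DERIV_cmult[OF c2] pw]]]])
      (use assms in \<open>simp add: cut_ker_yy_def field_simps power2_eq_square\<close>)
qed

lemma cut_ker_deriv_T:
  assumes "T > 0"
  shows "((\<lambda>T. cut_ker D n \<rho> T y) has_real_derivative cut_ker_T D n \<rho> T y) (at T)"
  unfolding cut_ker_def[abs_def] cut_ker_T_def by (rule DERIV_cmult_right[OF heat_ker_deriv_T[OF assms]])

text \<open>The inequality \<open>s / (4 * k) \<le> exp (s / (4 * k))\<close>, raised to the power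
  \<open>k\<close>.\<close>

lemma power_times_exp_le:
  assumes "0 \<le> s" "k > 0"
  shows "s ^ k * exp (- s / 4) \<le> (4 * real k) ^ k"
proof -
  have "s / (4 * real k) \<le> exp (s / (4 * real k))"
    using exp_ge_add_one_self[of "s / (4 * real k)"] by linarith
  then have "(s / (4 * real k)) ^ k \<le> exp (s / (4 * real k)) ^ k"
    using assms by (intro power_mono) auto
  also have "\<dots> = exp (s / 4)" using assms by (simp add: exp_of_nat_mult[symmetric])
  finally have "s ^ k \<le> (4 * real k) ^ k * exp (s / 4)"
    using assms by (simp add: power_divide field_simps)
  then have "s ^ k * exp (- (s / 4)) \<le> (4 * real k) ^ k * exp (s / 4) * exp (- (s / 4))"
    by (intro mult_right_mono) auto
  then show ?thesis by (simp add: mult.assoc exp_add[symmetric])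
qed

lemma heat_ker_power_le:
  assumes "0 \<le> y" "0 < T" "k > 0"
  shows "heat_ker D T y * y ^ k \<le> (4 * real k) ^ k * T powr (real k - D / 2)"
proof -
  have "heat_ker D T y * y ^ k = T powr (real k - D / 2) * ((y / T) ^ k * exp (- (y / T) / 4))"
  proof -
    have 1: "T powr (real k - D / 2) = T ^ k * T powr (- D / 2)"
      using assms by (simp add: powr_realpow[symmetric] powr_add[symmetric])
    have 2: "- y / (4 * T) = - (y / T) / 4" by simp
    have 3: "y ^ k = T ^ k * (y / T) ^ k" using assms by (simp add: power_divide)
    show ?thesis unfolding heat_ker_def 1 2 by (subst 3) (simp only: ac_simps)
  qed
  also have "\<dots> \<le> T powr (real k - D / 2) * (4 * real k) ^ k"
    by (intro mult_left_mono power_times_exp_le) (use assms in auto)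
  finally show ?thesis by (simp add: mult.commute)
qed

text \<open>One summand for each of the two positive commutator terms in
  \<open>cut_ker_super\<close>; the powers of 4 come from the restriction
  \<open>T \<le> 4 * \<rho>\<^sup>2\<close>.\<close>

definition ker_const :: "real \<Rightarrow> nat \<Rightarrow> real" where
  "ker_const D n = 6 * real n * ((4 * real n) ^ n * 4 powr (real n - 1 - D / 2)) +
    24 * (real n)\<^sup>2 * ((4 * real (2 * n - 1)) ^ (2 * n - 1) * 4 powr (real (2 * n - 1) - D / 2))"

lemma ker_const_nonneg: "0 \<le> ker_const D n"
  by (simp add: ker_const_def)

lemma powr_four_square:
  fixes \<rho> :: real
  assumes "0 < \<rho>"
  shows "(4 * \<rho>\<^sup>2) powr s = 4 powr s * \<rho> powr (2 * s)"
proof -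
  have "\<rho>\<^sup>2 = \<rho> powr 2" using assms by simp
  then show ?thesis by (simp only: powr_mult powr_powr)
qed

text \<open>The kernel alone solves the heat equation in dimension \<open>D\<close>, so only terms
  with derivatives of the cutoff survive, and two of these four are nonpositive. The others carry
  \<open>y ^ n / T\<close> and \<open>y ^ (2 * n - 1)\<close>, which the Gaussian converts into
  powers of \<open>T\<close> with exponents \<open>n - 1 - D / 2\<close> and
  \<open>2 * n - 1 - D / 2\<close>. Both exponents are nonnegative by the hypotheses on
  \<open>n\<close>, so the bound survives \<open>T\<close> tending to 0; the power of \<rho> is the
  one given by parabolic scaling.\<close>

lemma cut_ker_super:
  assumes n: "2 \<le> n" "D / 2 + 1 \<le> real n" and D: "0 \<le> D"
    and \<rho>: "0 < \<rho>" and T: "0 < T" "T \<le> 4 * \<rho>\<^sup>2" and y: "0 \<le> y"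
  shows "- cut_ker_T D n \<rho> T y + 4 * y * cut_ker_yy D n \<rho> T y + 2 * D * cut_ker_y D n \<rho> T y
    \<le> ker_const D n * \<rho> powr (6 * real n - 2 - D)"
proof -
  define H where "H = heat_ker D T y"
  define q where "q = cut n \<rho> y"
  have H: "0 \<le> H" by (simp add: H_def heat_ker_nonneg)
  have q: "0 \<le> q" "q \<le> \<rho> ^ (2 * n)" using cut_le[OF y] by (auto simp: q_def cut_nonneg)
  obtain m where m: "n = Suc (Suc m)" using n(1) by (metis Suc_le_D numeral_2_eq_2 Suc_le_mono)
  have "- cut_ker_T D n \<rho> T y + 4 * y * cut_ker_yy D n \<rho> T y + 2 * D * cut_ker_y D n \<rho> T y =
      6 * real n * (q\<^sup>2 * (H * y ^ n / T)) + 24 * (real n)\<^sup>2 * (q * (H * y ^ (2 * n - 1)))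
      - 12 * real n * real (n - 1) * H * q\<^sup>2 * y ^ (n - 1) - 6 * D * real n * H * q\<^sup>2 * y ^ (n - 1)"
  proof -
    have e: "y ^ (2 * n - 1) = y * y ^ Suc m * y ^ Suc m" "y ^ n = y * y ^ Suc m"
      "y ^ (n - 1) = y ^ Suc m" "y ^ Suc m = y * y ^ m"
      by (simp_all add: m mult_2 power_add[symmetric] mult.assoc[symmetric] flip: power_Suc power_add)
    have nm: "n - 2 = m" by (simp add: m)
    show ?thesis
      using T(1) unfolding cut_ker_T_def cut_ker_yy_def cut_ker_y_def H_def[symmetric] q_def[symmetric] e(1-3) nm
      by (simp add: e(4) field_simps power2_eq_square power3_eq_cube)
  qed
  also have "\<dots> \<le> 6 * real n * (q\<^sup>2 * (H * y ^ n / T)) + 24 * (real n)\<^sup>2 * (q * (H * y ^ (2 * n - 1)))"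
  proof -
    have "0 \<le> 12 * real n * real (n - 1) * H * q\<^sup>2 * y ^ (n - 1)" "0 \<le> 6 * D * real n * H * q\<^sup>2 * y ^ (n - 1)"
      using H q y D by simp_all
    then show ?thesis by linarith
  qed
  also have "\<dots> \<le> 6 * real n * (((4 * real n) ^ n * 4 powr (real n - 1 - D / 2)) * \<rho> powr (6 * real n - 2 - D))
    + 24 * (real n)\<^sup>2 * (((4 * real (2 * n - 1)) ^ (2 * n - 1) * 4 powr (real (2 * n - 1) - D / 2)) *
       \<rho> powr (6 * real n - 2 - D))"
  proof (intro add_mono mult_left_mono)
    have "H * y ^ n / T \<le> (4 * real n) ^ n * T powr (real n - D / 2) / T"
      unfolding H_def using heat_ker_power_le[OF y T(1), of n D] n T by (intro divide_right_mono) auto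
    also have "T powr (real n - D / 2) = T powr 1 * T powr (real n - 1 - D / 2)"
      by (simp only: powr_add[symmetric]) simp
    also have "(4 * real n) ^ n * (T powr 1 * T powr (real n - 1 - D / 2)) / T =
        (4 * real n) ^ n * T powr (real n - 1 - D / 2)"
      using T by simp
    also have "\<dots> \<le> (4 * real n) ^ n * (4 * \<rho>\<^sup>2) powr (real n - 1 - D / 2)"
      using n T by (intro mult_left_mono powr_mono2) auto
    also have "(4 * \<rho>\<^sup>2) powr (real n - 1 - D / 2) = 4 powr (real n - 1 - D / 2) * \<rho> powr (2 * real n - 2 - D)"
      using powr_four_square[OF \<rho>, of "real n - 1 - D / 2"] by (simp add: algebra_simps)
    finally have 1: "H * y ^ n / T \<le> (4 * real n) ^ n * (4 powr (real n - 1 - D / 2) * \<rho> powr (2 * real n - 2 - D))" .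
    have 2: "q\<^sup>2 \<le> \<rho> powr (4 * real n)"
    proof -
      have "q\<^sup>2 \<le> (\<rho> ^ (2 * n))\<^sup>2" using q by (intro power_mono) auto
      also have "\<dots> = \<rho> ^ (4 * n)" by (simp add: power_mult[symmetric])
      also have "\<dots> = \<rho> powr (4 * real n)" using \<rho> by (simp add: powr_realpow[symmetric])
      finally show ?thesis .
    qed
    have "q\<^sup>2 * (H * y ^ n / T) \<le>
        \<rho> powr (4 * real n) * ((4 * real n) ^ n * (4 powr (real n - 1 - D / 2) * \<rho> powr (2 * real n - 2 - D)))"
      by (intro mult_mono 1 2) (use H y T in auto)
    also have "\<dots> = ((4 * real n) ^ n * 4 powr (real n - 1 - D / 2)) * (\<rho> powr (4 * real n) * \<rho> powr (2 * real n - 2 - D))"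
      by (simp only: ac_simps)
    also have "\<rho> powr (4 * real n) * \<rho> powr (2 * real n - 2 - D) = \<rho> powr (6 * real n - 2 - D)"
      by (simp add: powr_add[symmetric] algebra_simps)
    finally show "q\<^sup>2 * (H * y ^ n / T) \<le>
      ((4 * real n) ^ n * 4 powr (real n - 1 - D / 2)) * \<rho> powr (6 * real n - 2 - D)" .
  next
    have n1: "0 < 2 * n - 1" "real (2 * n - 1) = 2 * real n - 1" using n by auto
    have "H * y ^ (2 * n - 1) \<le> (4 * real (2 * n - 1)) ^ (2 * n - 1) * T powr (real (2 * n - 1) - D / 2)"
      unfolding H_def by (rule heat_ker_power_le[OF y T(1) n1(1)])
    also have "\<dots> \<le> (4 * real (2 * n - 1)) ^ (2 * n - 1) * (4 * \<rho>\<^sup>2) powr (real (2 * n - 1) - D / 2)"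
      using n n1 T by (intro mult_left_mono powr_mono2) auto
    also have "(4 * \<rho>\<^sup>2) powr (real (2 * n - 1) - D / 2) =
        4 powr (real (2 * n - 1) - D / 2) * \<rho> powr (4 * real n - 2 - D)"
      using powr_four_square[OF \<rho>, of "real (2 * n - 1) - D / 2"] n1 by (simp add: algebra_simps)
    finally have 1: "H * y ^ (2 * n - 1) \<le>
      (4 * real (2 * n - 1)) ^ (2 * n - 1) * (4 powr (real (2 * n - 1) - D / 2) * \<rho> powr (4 * real n - 2 - D))" .
    have 2: "q \<le> \<rho> powr (2 * real n)"
      using q(2) \<rho> by (simp add: powr_realpow[symmetric])
    have "q * (H * y ^ (2 * n - 1)) \<le> \<rho> powr (2 * real n) *
      ((4 * real (2 * n - 1)) ^ (2 * n - 1) * (4 powr (real (2 * n - 1) - D / 2) * \<rho> powr (4 * real n - 2 - D)))"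
      by (intro mult_mono 1 2) (use H y in auto)
    also have "\<dots> = ((4 * real (2 * n - 1)) ^ (2 * n - 1) * 4 powr (real (2 * n - 1) - D / 2)) *
      (\<rho> powr (2 * real n) * \<rho> powr (4 * real n - 2 - D))"
      by (simp only: ac_simps)
    also have "\<rho> powr (2 * real n) * \<rho> powr (4 * real n - 2 - D) = \<rho> powr (6 * real n - 2 - D)"
      by (simp add: powr_add[symmetric] algebra_simps)
    finally show "q * (H * y ^ (2 * n - 1)) \<le> ((4 * real (2 * n - 1)) ^ (2 * n - 1) *
      4 powr (real (2 * n - 1) - D / 2)) * \<rho> powr (6 * real n - 2 - D)" .
  qed auto
  finally show ?thesis by (simp add: ker_const_def algebra_simps)
qed

section \<open>Mean-square and pointwise decay\<close>

lemma set_integral_mono_subset: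
  fixes f g :: "'b \<Rightarrow> real"
  assumes "set_integrable N A f" "set_integrable N B g" "A \<subseteq> B"
    and "\<And>x. x \<in> A \<Longrightarrow> f x \<le> g x" "\<And>x. x \<in> B \<Longrightarrow> 0 \<le> g x"
  shows "(LINT x:A|N. f x) \<le> (LINT x:B|N. g x)"
  unfolding set_lebesgue_integral_def
  by (rule integral_mono) (use assms in \<open>auto simp: set_integrable_def split: split_indicator\<close>)

lemma set_integral_const_compact:
  fixes K :: "'b::euclidean_space set"
  assumes "compact K"
  shows "(LINT x:K|lborel. c) = measure lborel K * (c::real)"
  using assms by (simp add: set_lebesgue_integral_def compact_imp_closed emeasure_compact_finite less_top[symmetric])

text \<open>Here \<open>V\<close> stands for the volume of the ball of radius \<open>1 / 2\<close>
  and \<open>s\<close> for a lower bound of the time elapsed since the start. The first summand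
  bounds the initial kernel, the second the commutator; the last factor, times
  \<open>\<rho> powr D\<close>, is the reciprocal of the kernel's lower bound near the
  vertex.\<close>

definition mass_const :: "real \<Rightarrow> real \<Rightarrow> nat \<Rightarrow> real \<Rightarrow> real" where
  "mass_const V D n s =
    V * (s powr (- D / 2) + ker_const D n * (1 / 2) powr (6 * real n - 2 - D)) * (exp 1 * (2 * 4 ^ n) ^ 3)"

lemma mass_const_nonneg: "0 \<le> V \<Longrightarrow> 0 \<le> mass_const V D n s"
  by (simp add: mass_const_def ker_const_nonneg)

context cone_subsolution
begin

lemma v_square_le: "t \<in> {0<..1} \<Longrightarrow> x \<in> ball 0 1 \<Longrightarrow> (v (t, x))\<^sup>2 \<le> S\<^sup>2"
  using v_nonneg v_le by (simp add: power_mono)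

lemma set_integrable_v_square_mult:
  assumes "t \<in> {0<..1}" "compact K" "K \<subseteq> ball 0 1" "continuous_on K f"
  shows "set_integrable lborel K (\<lambda>x. (v (t, x))\<^sup>2 * f x)"
  using assms
  by (intro set_integrable_compact continuous_intros continuous_on_subset[OF continuous_on_time_slice[OF cont_v]]) auto

text \<open>The pole lies at the time \<open>T0\<close> after \<open>b\<close>, so the weight is
  regular on \<open>{a..b}\<close>, and the error term does not deteriorate as \<open>T0\<close>
  approaches \<open>b\<close>. Running the kernel backwards, as a function of \<open>T0 - t\<close>,
  is the origin of the minus sign before \<open>cut_ker_T\<close>.\<close>

lemma kernel_estimate:
  fixes c :: 'a
  assumes ab: "0 < a" "a \<le> b" "b \<le> 1" and K: "cball c r \<subseteq> ball 0 1" and r: "0 < r"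
    and n: "2 \<le> n" "D / 2 + 1 \<le> real n" and D: "0 \<le> D" and T0: "b < T0" "T0 - a \<le> 4 * r\<^sup>2"
    and dim: "\<And>t. t \<in> {a..b} \<Longrightarrow>
      (LINT x:cball c r|lborel. - 2 * (norm (Dv (t, x)))\<^sup>2 * cut_ker D n r (T0 - t) ((x - c) \<bullet> (x - c))) \<le>
      (LINT x:cball c r|lborel. 2 * (D - real DIM('a)) * (v (t, x))\<^sup>2 * cut_ker_y D n r (T0 - t) ((x - c) \<bullet> (x - c)))"
    and mass: "\<And>t. t \<in> {a..b} \<Longrightarrow> (LINT x:cball c r|lborel. (v (t, x))\<^sup>2) \<le> m"
  shows "(LINT x:cball c r|lborel. (v (b, x))\<^sup>2 * cut_ker D n r (T0 - b) ((x - c) \<bullet> (x - c))) \<le>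
    (LINT x:cball c r|lborel. (v (a, x))\<^sup>2 * cut_ker D n r (T0 - a) ((x - c) \<bullet> (x - c)))
    + (b - a) * ((ker_const D n * r powr (6 * real n - 2 - D)) * m)"
proof (rule energy_estimate[where ?p = "\<lambda>t. cut_ker D n r (T0 - t)" and ?p1.0 = "\<lambda>t. cut_ker_y D n r (T0 - t)"
    and ?p2.0 = "\<lambda>t. cut_ker_yy D n r (T0 - t)" and ?pt = "\<lambda>t y. - cut_ker_T D n r (T0 - t) y" and ?D = D, OF ab K])
  fix t y assume t: "t \<in> {a..b}"
  then have T: "0 < T0 - t" "T0 - t \<le> 4 * r\<^sup>2" using T0 by auto
  show "(cut_ker D n r (T0 - t) has_real_derivative cut_ker_y D n r (T0 - t) y) (at y)"
    by (rule cut_ker_deriv_y[OF T(1)])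
  show "(cut_ker_y D n r (T0 - t) has_real_derivative cut_ker_yy D n r (T0 - t) y) (at y)"
    by (rule cut_ker_deriv_yy[OF T(1)])
  have "((\<lambda>s. T0 - s) has_real_derivative - 1) (at t within {a..b})"
    by (auto intro!: derivative_eq_intros)
  from DERIV_chain2[OF cut_ker_deriv_T[OF T(1)] this]
  show "((\<lambda>s. cut_ker D n r (T0 - s) y) has_real_derivative - cut_ker_T D n r (T0 - t) y) (at t within {a..b})"
    by simp
  show "continuous_on UNIV (cut_ker_yy D n r (T0 - t))"
    unfolding cut_ker_yy_def[abs_def] heat_ker_def cut_def
    by (intro continuous_intros) (use T in auto)
  show "cut_ker D n r (T0 - t) y = 0 \<and> cut_ker_y D n r (T0 - t) y = 0" if "r\<^sup>2 \<le> y"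
    using cut_eq_0[OF that] by (simp add: cut_ker_def cut_ker_y_def)
  show "0 \<le> cut_ker D n r (T0 - t) y" by (rule cut_ker_nonneg)
  show "- cut_ker_T D n r (T0 - t) y + 4 * y * cut_ker_yy D n r (T0 - t) y + 2 * D * cut_ker_y D n r (T0 - t) y
      \<le> ker_const D n * r powr (6 * real n - 2 - D)" if "0 \<le> y"
    by (rule cut_ker_super[OF n D r T that])
next
  show "continuous_on ({a..b} \<times> UNIV) (\<lambda>z. cut_ker D n r (T0 - fst z) (snd z))"
    unfolding cut_ker_def heat_ker_def cut_def
    by (intro continuous_intros) (use T0 in auto)
  show "continuous_on ({a..b} \<times> UNIV) (\<lambda>z. - cut_ker_T D n r (T0 - fst z) (snd z))"
    unfolding cut_ker_T_def heat_ker_def cut_def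
    by (intro continuous_intros) (use T0 in auto)
qed (use r dim mass ker_const_nonneg in auto)

lemma continuous_on_cut_ker:
  fixes c :: 'a
  assumes "0 < T"
  shows "continuous_on X (\<lambda>x. cut_ker D n r T ((x - c) \<bullet> (x - c)))"
  unfolding cut_ker_def heat_ker_def cut_def by (intro continuous_intros) (use assms in auto)

text \<open>The kernel centred at the vertex with pole at \<open>t + \<rho>\<^sup>2\<close> and
  cutoff radius \<open>1 / 2\<close> is compared at two times: at time \<open>a\<close> it is
  bounded independently of \<rho>, at time \<open>t\<close> it is at least a multiple of
  \<open>\<rho> powr (- D)\<close> on the ball of radius \<open>2 * \<rho>\<close>.\<close>

lemma mass_bound:
  assumes L: "0 \<le> Lambda0 M" "\<alpha> * (\<alpha> + real DIM('a) - 2) \<le> Lambda0 M" "0 \<le> \<alpha>"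
    and D: "D = real DIM('a) + 2 * \<alpha>" and n: "2 \<le> n" "D / 2 + 1 \<le> real n"
    and a: "0 < a" "a < a'" and t: "a' \<le> t" "t \<le> 1" and \<rho>: "0 < \<rho>" "\<rho>\<^sup>2 \<le> a" "\<rho> \<le> 1 / 8"
  shows "(LINT x:cball 0 (2 * \<rho>)|lborel. (v (t, x))\<^sup>2) \<le>
    mass_const (measure lborel (cball (0::'a) (1 / 2))) D n (a' - a) * S\<^sup>2 * \<rho> powr D"
proof -
  let ?K = "cball (0::'a) (1 / 2)"
  let ?Y = "\<lambda>x::'a. (x - 0) \<bullet> (x - 0)"
  define V where "V = measure lborel ?K"
  define T0 where "T0 = t + \<rho>\<^sup>2"
  have K: "?K \<subseteq> ball 0 1" and cK: "compact ?K" by auto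
  have D0: "0 \<le> D" using D L by simp
  have tI: "s \<in> {0<..1}" if "s \<in> {a..t}" for s using that a t by auto
  have est: "(LINT x:?K|lborel. (v (t, x))\<^sup>2 * cut_ker D n (1 / 2) (T0 - t) (?Y x)) \<le>
    (LINT x:?K|lborel. (v (a, x))\<^sup>2 * cut_ker D n (1 / 2) (T0 - a) (?Y x))
    + (t - a) * ((ker_const D n * (1 / 2) powr (6 * real n - 2 - D)) * (S\<^sup>2 * V))"
  proof (rule kernel_estimate[OF _ _ _ K _ n D0])
    \<comment> \<open>Since \<open>\<rho>\<^sup>2 \<le> a\<close>, the difference
      \<open>T0 - a\<close> is at most \<open>t\<close>, hence at most 1, which is four times the
      squared cutoff radius.\<close>
    show "T0 - a \<le> 4 * (1 / 2)\<^sup>2" using t \<rho> a by (simp add: T0_def power2_eq_square)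
    fix s assume s: "s \<in> {a..t}"
    have "0 < \<rho>\<^sup>2" using \<rho> by simp
    then have T: "0 < T0 - s" using s unfolding T0_def atLeastAtMost_iff by linarith
    have 2: "2 * (D - real DIM('a)) = 4 * \<alpha>" using D by simp
    show "(LINT x:?K|lborel. - 2 * (norm (Dv (s, x)))\<^sup>2 * cut_ker D n (1 / 2) (T0 - s) (?Y x)) \<le>
      (LINT x:?K|lborel. 2 * (D - real DIM('a)) * (v (s, x))\<^sup>2 * cut_ker_y D n (1 / 2) (T0 - s) (?Y x))"
      unfolding 2 diff_zero
    proof (rule hardy[OF tI[OF s] _ _ L(1,2) cut_ker_deriv_y[OF T] cut_ker_nonneg])
      show "continuous_on UNIV (cut_ker_y D n (1 / 2) (T0 - s))"
        using cut_ker_deriv_yy[OF T] by (auto intro!: continuous_at_imp_continuous_on DERIV_isCont)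
      show "cut_ker D n (1 / 2) (T0 - s) y = 0" if "(1 / 2)\<^sup>2 \<le> y" for y
        using cut_eq_0[OF that] by (simp add: cut_ker_def)
    qed auto
    have "(LINT x:?K|lborel. (v (s, x))\<^sup>2) \<le> (LINT x:?K|lborel. S\<^sup>2)"
      using set_integrable_v_square_mult[OF tI[OF s] cK K, of "\<lambda>_. 1"] v_square_le[OF tI[OF s]] K
      by (intro set_integral_mono) (auto intro!: set_integrable_compact)
    then show "(LINT x:?K|lborel. (v (s, x))\<^sup>2) \<le> S\<^sup>2 * V"
      by (simp add: set_integral_const_compact V_def mult.commute)
  qed (use a t \<rho> in \<open>auto simp: T0_def\<close>)
  have Ta: "a' - a \<le> T0 - a" "0 < T0 - a" using t a zero_le_power2[of \<rho>] unfolding T0_def by linarith+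
  have "(LINT x:?K|lborel. (v (a, x))\<^sup>2 * cut_ker D n (1 / 2) (T0 - a) (?Y x)) \<le>
      (LINT x:?K|lborel. S\<^sup>2 * (a' - a) powr (- D / 2))"
  proof (rule set_integral_mono)
    show "set_integrable lborel ?K (\<lambda>x. (v (a, x))\<^sup>2 * cut_ker D n (1 / 2) (T0 - a) (?Y x))"
      by (rule set_integrable_v_square_mult[OF tI cK K continuous_on_cut_ker[OF Ta(2)]]) (use a t in auto)
    show "set_integrable lborel ?K (\<lambda>x. S\<^sup>2 * (a' - a) powr (- D / 2))"
      by (intro set_integrable_compact continuous_intros cK)
    fix x assume x: "x \<in> ?K"
    have "cut_ker D n (1 / 2) (T0 - a) (?Y x) \<le> (a' - a) powr (- D / 2) * 1 * 1 ^ 3"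
      unfolding cut_ker_def heat_ker_def
    proof (intro mult_mono power_mono)
      show "(T0 - a) powr (- D / 2) \<le> (a' - a) powr (- D / 2)"
        using Ta a D0 by (intro powr_mono2') auto
      show "exp (- ?Y x / (4 * (T0 - a))) \<le> 1" using Ta by simp
      have "cut n (1 / 2) (?Y x) \<le> (1 / 2) ^ (2 * n)" by (rule cut_le) simp
      also have "\<dots> \<le> 1" by (intro power_le_one) auto
      finally show "cut n (1 / 2) (?Y x) \<le> 1" .
    qed (auto simp: cut_nonneg)
    then show "(v (a, x))\<^sup>2 * cut_ker D n (1 / 2) (T0 - a) (?Y x) \<le> S\<^sup>2 * (a' - a) powr (- D / 2)"
      using v_square_le[OF tI, of a x] x K a t
      by (intro mult_mono) (auto simp: cut_ker_nonneg)
  qed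
  also have "\<dots> = V * (S\<^sup>2 * (a' - a) powr (- D / 2))"
    unfolding V_def by (rule set_integral_const_compact[OF cK])
  finally have start: "(LINT x:?K|lborel. (v (a, x))\<^sup>2 * cut_ker D n (1 / 2) (T0 - a) (?Y x)) \<le>
      V * (S\<^sup>2 * (a' - a) powr (- D / 2))" .
  \<comment> \<open>Lower bound of the kernel at time \<open>t\<close> on the small ball. There
    \<open>y \<le> 4 * \<rho>\<^sup>2\<close>, so the Gaussian is at least \<open>exp (- 1)\<close>;
    and \<open>\<rho> \<le> 1 / 8\<close> gives \<open>y \<le> 1 / 16\<close>, so the cutoff is at
    least half its central value \<open>(1 / 4) ^ n\<close>.\<close>
  define k where "k = \<rho> powr (- D) * exp (- 1) * ((1 / 4) ^ n / 2) ^ 3"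
  have k: "0 < k" using \<rho> by (simp add: k_def)
  have "(LINT x:cball 0 (2 * \<rho>)|lborel. (v (t, x))\<^sup>2 * k) \<le>
      (LINT x:?K|lborel. (v (t, x))\<^sup>2 * cut_ker D n (1 / 2) (T0 - t) (?Y x))"
  proof (rule set_integral_mono_subset)
    show sub: "cball (0::'a) (2 * \<rho>) \<subseteq> ?K" using \<rho> by auto
    have tt: "t \<in> {0<..1}" using tI[of t] a t by auto
    show "set_integrable lborel (cball 0 (2 * \<rho>)) (\<lambda>x. (v (t, x))\<^sup>2 * k)"
      by (rule set_integrable_v_square_mult[OF tt compact_cball _ continuous_on_const]) (use sub K in blast)
    show "set_integrable lborel ?K (\<lambda>x. (v (t, x))\<^sup>2 * cut_ker D n (1 / 2) (T0 - t) (?Y x))"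
      by (rule set_integrable_v_square_mult[OF tt cK K continuous_on_cut_ker]) (use \<rho> in \<open>simp add: T0_def\<close>)
    show "0 \<le> (v (t, x))\<^sup>2 * cut_ker D n (1 / 2) (T0 - t) (?Y x)" for x
      by (simp add: cut_ker_nonneg)
    fix x :: 'a assume x: "x \<in> cball 0 (2 * \<rho>)"
    have "(norm x)\<^sup>2 \<le> (2 * \<rho>)\<^sup>2" using x by (intro power_mono) auto
    then have y: "?Y x \<le> 4 * \<rho>\<^sup>2" by (simp add: power2_norm_eq_inner power_mult_distrib)
    have "k \<le> cut_ker D n (1 / 2) (T0 - t) (?Y x)"
      unfolding k_def cut_ker_def heat_ker_def
    proof (intro mult_mono power_mono)
      have "\<rho> powr (- D) = (\<rho>\<^sup>2) powr (- D / 2)"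
      proof -
        have "\<rho>\<^sup>2 = \<rho> powr 2" using \<rho> by simp
        then show ?thesis by (simp only: powr_powr) simp
      qed
      then show "\<rho> powr (- D) \<le> (T0 - t) powr (- D / 2)" by (simp add: T0_def)
      have "?Y x / (4 * \<rho>\<^sup>2) \<le> 1" using y \<rho> by simp
      then show "exp (- 1) \<le> exp (- ?Y x / (4 * (T0 - t)))" by (simp add: T0_def)
      have "\<rho>\<^sup>2 \<le> (1 / 8)\<^sup>2" using \<rho> by (intro power_mono) auto
      then have "?Y x ^ n \<le> (1 / 16) ^ n" using y by (intro power_mono) (auto simp: power2_eq_square)
      also have "\<dots> = (1 / 4) ^ n * (1 / 4) ^ n" by (simp add: power_mult_distrib[symmetric])
      also have "\<dots> \<le> (1 / 4) ^ n * (1 / 2)"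
      proof (rule mult_left_mono)
        have "(1 / 4 :: real) ^ n \<le> (1 / 4) ^ 1" using n by (intro power_decreasing) auto
        then show "(1 / 4 :: real) ^ n \<le> 1 / 2" by simp
      qed simp
      finally have "?Y x ^ n \<le> (1 / 4) ^ n / 2" by simp
      moreover have "(1 / 2 :: real) ^ (2 * n) = (1 / 4) ^ n" by (simp add: power_mult power2_eq_square)
      moreover have "(1 / 2) ^ (2 * n) - ?Y x ^ n \<le> cut n (1 / 2) (?Y x)" by (simp add: cut_def)
      ultimately show "(1 / 4) ^ n / 2 \<le> cut n (1 / 2) (?Y x)" by linarith
    qed auto
    then show "(v (t, x))\<^sup>2 * k \<le> (v (t, x))\<^sup>2 * cut_ker D n (1 / 2) (T0 - t) (?Y x)"
      by (rule mult_left_mono) simp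
  qed
  then have "k * (LINT x:cball 0 (2 * \<rho>)|lborel. (v (t, x))\<^sup>2) \<le>
      (LINT x:?K|lborel. (v (t, x))\<^sup>2 * cut_ker D n (1 / 2) (T0 - t) (?Y x))"
    by (simp add: mult.commute)
  also have "\<dots> \<le> V * (S\<^sup>2 * (a' - a) powr (- D / 2)) +
      1 * ((ker_const D n * (1 / 2) powr (6 * real n - 2 - D)) * (S\<^sup>2 * V))"
  proof -
    have "(t - a) * ((ker_const D n * (1 / 2) powr (6 * real n - 2 - D)) * (S\<^sup>2 * V)) \<le>
        1 * ((ker_const D n * (1 / 2) powr (6 * real n - 2 - D)) * (S\<^sup>2 * V))"
      using t a by (intro mult_right_mono) (auto simp: V_def ker_const_nonneg)
    then show ?thesis using est start by linarith
  qed
  also have "\<dots> = V * ((a' - a) powr (- D / 2) + ker_const D n * (1 / 2) powr (6 * real n - 2 - D)) * S\<^sup>2"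
    by (simp add: algebra_simps)
  finally have "(LINT x:cball 0 (2 * \<rho>)|lborel. (v (t, x))\<^sup>2) \<le>
      V * ((a' - a) powr (- D / 2) + ker_const D n * (1 / 2) powr (6 * real n - 2 - D)) * S\<^sup>2 / k"
    using k by (simp add: field_simps)
  also have "1 / k = exp 1 * (2 * 4 ^ n) ^ 3 * \<rho> powr D"
    using \<rho> by (simp add: k_def powr_minus exp_minus power_divide power_mult_distrib field_simps)
  then have "V * ((a' - a) powr (- D / 2) + ker_const D n * (1 / 2) powr (6 * real n - 2 - D)) * S\<^sup>2 / k =
      mass_const V D n (a' - a) * S\<^sup>2 * \<rho> powr D"
    unfolding divide_inverse mass_const_def by (simp add: inverse_eq_divide mult_ac)
  finally show ?thesis by (simp only: V_def)
qed

text \<open>A local mean value inequality from the kernel of the true dimension, centred at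
  \<open>x0\<close> with pole at \<open>t0 + \<tau>\<close>. The kernel's mass on the ball of radius
  \<open>sqrt \<tau>\<close> is bounded below independently of \<tau>, so one small \<tau>, chosen
  by continuity of \<open>v\<close> in space, yields the value at the point without a limit.\<close>

lemma pointwise_bound:
  assumes mass: "\<And>t. t \<in> {a'..1} \<Longrightarrow> (LINT x:cball 0 (2 * \<rho>)|lborel. (v (t, x))\<^sup>2) \<le> m"
    and n: "2 \<le> n" "real DIM('a) / 2 + 1 \<le> real n" and \<rho>: "0 < \<rho>" "\<rho> \<le> 1 / 8"
    and x0: "norm x0 = \<rho>" and t0: "0 < a'" "a' \<le> t0 - (\<rho> / 2)\<^sup>2" "t0 \<le> 1"
  shows "(v (t0, x0))\<^sup>2 \<le> 16 * exp (1 / 4) * (1 + ker_const (real DIM('a)) n) / unit_ball_vol (real DIM('a))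
    * (\<rho> / 2) powr (- real DIM('a)) * m"
proof -
  define d where "d = real DIM('a)"
  define U where "U = unit_ball_vol d"
  have U: "0 < U" by (simp add: U_def d_def)
  \<comment> \<open>Half the distance to the vertex keeps the ball around \<open>x0\<close> inside
    the ball where the mass is controlled, and \<open>r\<^sup>2\<close> is the matching parabolic
    time span.\<close>
  define r where "r = \<rho> / 2"
  have r: "0 < r" using \<rho> by (simp add: r_def)
  then have r2: "0 < r\<^sup>2" by simp
  let ?K = "cball x0 r"
  let ?Y = "\<lambda>x::'a. (x - x0) \<bullet> (x - x0)"
  have KB: "?K \<subseteq> cball 0 (2 * \<rho>)"
  proof
    fix x assume "x \<in> ?K"
    then have "norm (x - x0) \<le> r" by (simp add: dist_norm norm_minus_commute)
    then show "x \<in> cball 0 (2 * \<rho>)"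
      using norm_triangle_ineq[of "x - x0" x0] x0 \<rho> by (simp add: r_def)
  qed
  have B1: "cball (0::'a) (2 * \<rho>) \<subseteq> ball 0 1" using \<rho> by auto
  have K: "?K \<subseteq> ball 0 1" and cK: "compact ?K" using KB B1 by auto
  have tI: "s \<in> {0<..1}" "s \<in> {a'..1}" if "s \<in> {t0 - r\<^sup>2..t0}" for s
    using that t0 by (auto simp: r_def)
  have t0I: "t0 \<in> {0<..1}" using tI(1)[of t0] by simp
  have massK: "(LINT x:?K|lborel. (v (s, x))\<^sup>2) \<le> m" if s: "s \<in> {t0 - r\<^sup>2..t0}" for s
  proof -
    have "(LINT x:?K|lborel. (v (s, x))\<^sup>2) \<le> (LINT x:cball 0 (2 * \<rho>)|lborel. (v (s, x))\<^sup>2)"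
      using set_integrable_v_square_mult[OF tI(1)[OF s] cK K continuous_on_const, of 1]
        set_integrable_v_square_mult[OF tI(1)[OF s] compact_cball B1 continuous_on_const, of 1]
      by (intro set_integral_mono_subset KB) auto
    also have "\<dots> \<le> m" by (rule mass[OF tI(2)[OF s]])
    finally show ?thesis .
  qed
  have m: "0 \<le> m"
  proof -
    have "0 \<le> (LINT x:?K|lborel. (v (t0, x))\<^sup>2)"
      unfolding set_lebesgue_integral_def by (rule Bochner_Integration.integral_nonneg) simp
    then show ?thesis using massK[of t0] by simp
  qed
  have "U * (v (t0, x0))\<^sup>2 * exp (- 1 / 4) / 16 \<le> (1 + ker_const d n) * r powr (- d) * m"
  proof (cases "v (t0, x0) = 0")
    case True
    then show ?thesis using m ker_const_nonneg[of d n] by simp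
  next
    case False
    define w where "w = (v (t0, x0))\<^sup>2"
    have w: "0 < w" using False by (simp add: w_def)
    have x0K: "x0 \<in> ball 0 1" using x0 \<rho> by simp
    have "isCont (\<lambda>x. (v (t0, x))\<^sup>2) x0"
      using has_derivative_continuous[OF deriv_v[OF t0I x0K]] by (intro continuous_intros) auto
    then obtain \<eta> where \<eta>: "\<eta> > 0" "\<And>x. dist x x0 < \<eta> \<Longrightarrow> dist ((v (t0, x))\<^sup>2) w < w / 2"
      unfolding continuous_at_eps_delta w_def[symmetric] using w half_gt_zero by meson
    \<comment> \<open>The first entry keeps the ball of radius \<open>sqrt \<tau>\<close> where
      \<open>v\<^sup>2\<close> exceeds half its central value; the second keeps that ball where the
      cutoff is at least half its central value.\<close>
    define \<tau> where "\<tau> = min ((\<eta> / 2)\<^sup>2) (r\<^sup>2 / 2)"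
    have \<tau>: "0 < \<tau>" "\<tau> \<le> r\<^sup>2 / 2" "sqrt \<tau> \<le> \<eta> / 2" "sqrt \<tau> \<le> r"
    proof -
      show "0 < \<tau>" "\<tau> \<le> r\<^sup>2 / 2" using \<eta>(1) r2 by (auto simp: \<tau>_def)
      show "sqrt \<tau> \<le> \<eta> / 2" using \<eta>(1) by (intro real_le_lsqrt) (auto simp: \<tau>_def)
      show "sqrt \<tau> \<le> r" using r r2 by (intro real_le_lsqrt) (auto simp: \<tau>_def intro!: min.coboundedI2)
    qed
    define T0 where "T0 = t0 + \<tau>"
    have est: "(LINT x:?K|lborel. (v (t0, x))\<^sup>2 * cut_ker d n r (T0 - t0) (?Y x)) \<le>
      (LINT x:?K|lborel. (v (t0 - r\<^sup>2, x))\<^sup>2 * cut_ker d n r (T0 - (t0 - r\<^sup>2)) (?Y x))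
      + (t0 - (t0 - r\<^sup>2)) * ((ker_const d n * r powr (6 * real n - 2 - d)) * m)"
    proof (rule kernel_estimate[OF _ _ _ K r])
      show "T0 - (t0 - r\<^sup>2) \<le> 4 * r\<^sup>2" using \<tau>(2) r2 unfolding T0_def by linarith
      fix s assume s: "s \<in> {t0 - r\<^sup>2..t0}"
      \<comment> \<open>In the true dimension the right-hand side of the gradient condition is zero,
        and the left-hand side has the favourable sign.\<close>
      have "0 \<le> (LINT x:?K|lborel. 2 * (norm (Dv (s, x)))\<^sup>2 * cut_ker d n r (T0 - s) (?Y x))"
        unfolding set_lebesgue_integral_def
        by (rule Bochner_Integration.integral_nonneg) (simp add: cut_ker_nonneg)
      moreover have "(LINT x:?K|lborel. - 2 * (norm (Dv (s, x)))\<^sup>2 * cut_ker d n r (T0 - s) (?Y x)) =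
          - (LINT x:?K|lborel. 2 * (norm (Dv (s, x)))\<^sup>2 * cut_ker d n r (T0 - s) (?Y x))"
        by (simp add: set_lebesgue_integral_def)
      ultimately show "(LINT x:?K|lborel. - 2 * (norm (Dv (s, x)))\<^sup>2 * cut_ker d n r (T0 - s) (?Y x)) \<le>
        (LINT x:?K|lborel. 2 * (d - real DIM('a)) * (v (s, x))\<^sup>2 * cut_ker_y d n r (T0 - s) (?Y x))"
        by (simp add: d_def)
    qed (use n t0 \<tau> r2 massK tI(1)[of "t0 - r\<^sup>2"] in \<open>auto simp: T0_def d_def\<close>)
    have rd: "(r\<^sup>2) powr (- d / 2) = r powr (- d)"
    proof -
      have "r\<^sup>2 = r powr 2" using r by simp
      then show ?thesis by (simp only: powr_powr) simp
    qed
    define k where "k = r powr (- d) * 1 * (r ^ (2 * n)) ^ 3"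
    have Ta: "r\<^sup>2 \<le> T0 - (t0 - r\<^sup>2)" using \<tau> by (simp add: T0_def)
    have s1: "(LINT x:?K|lborel. (v (t0 - r\<^sup>2, x))\<^sup>2 * cut_ker d n r (T0 - (t0 - r\<^sup>2)) (?Y x)) \<le>
        (LINT x:?K|lborel. (v (t0 - r\<^sup>2, x))\<^sup>2 * k)"
    proof (rule set_integral_mono)
      have s: "t0 - r\<^sup>2 \<in> {0<..1}" using tI(1)[of "t0 - r\<^sup>2"] r2 by simp
      show "set_integrable lborel ?K (\<lambda>x. (v (t0 - r\<^sup>2, x))\<^sup>2 * cut_ker d n r (T0 - (t0 - r\<^sup>2)) (?Y x))"
        by (rule set_integrable_v_square_mult[OF s cK K continuous_on_cut_ker]) (use Ta r2 in linarith)
      show "set_integrable lborel ?K (\<lambda>x. (v (t0 - r\<^sup>2, x))\<^sup>2 * k)"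
        by (rule set_integrable_v_square_mult[OF s cK K continuous_on_const])
      fix x
      have "cut_ker d n r (T0 - (t0 - r\<^sup>2)) (?Y x) \<le> k"
        unfolding cut_ker_def heat_ker_def k_def
      proof (intro mult_mono power_mono)
        show "(T0 - (t0 - r\<^sup>2)) powr (- d / 2) \<le> r powr (- d)"
          unfolding rd[symmetric] using Ta r2 by (intro powr_mono2') (auto simp: d_def)
        have "0 \<le> T0 - (t0 - r\<^sup>2)" by (rule order_trans[OF less_imp_le[OF r2] Ta])
        then have "0 \<le> 4 * (T0 - (t0 - r\<^sup>2))" by (rule mult_nonneg_nonneg[rotated]) simp
        then have "0 \<le> ?Y x / (4 * (T0 - (t0 - r\<^sup>2)))" by (intro divide_nonneg_nonneg) auto
        then show "exp (- ?Y x / (4 * (T0 - (t0 - r\<^sup>2)))) \<le> 1"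
          by (simp only: exp_le_one_iff minus_divide_left[symmetric] neg_le_0_iff_le)
        show "cut n r (?Y x) \<le> r ^ (2 * n)" by (rule cut_le) simp
      qed (auto simp: cut_nonneg)
      then show "(v (t0 - r\<^sup>2, x))\<^sup>2 * cut_ker d n r (T0 - (t0 - r\<^sup>2)) (?Y x) \<le> (v (t0 - r\<^sup>2, x))\<^sup>2 * k"
        by (rule mult_left_mono) simp
    qed
    have s2: "(LINT x:?K|lborel. (v (t0 - r\<^sup>2, x))\<^sup>2 * k) = k * (LINT x:?K|lborel. (v (t0 - r\<^sup>2, x))\<^sup>2)"
      by (simp add: mult.commute)
    have s3: "k * (LINT x:?K|lborel. (v (t0 - r\<^sup>2, x))\<^sup>2) \<le> k * m"
    proof (rule mult_left_mono[OF massK])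
      show "t0 - r\<^sup>2 \<in> {t0 - r\<^sup>2..t0}" using r2 unfolding atLeastAtMost_iff by linarith
      show "0 \<le> k" using r unfolding k_def by (intro mult_nonneg_nonneg) auto
    qed
    have k: "k = r powr (6 * real n - d)"
    proof -
      have "(r ^ (2 * n)) ^ 3 = r ^ (6 * n)" by (simp only: power_mult[symmetric]) simp
      also have "\<dots> = r powr (6 * real n)" using powr_realpow[OF r, of "6 * n"] by simp
      finally have "(r ^ (2 * n)) ^ 3 = r powr (6 * real n)" .
      then have "k = r powr (- d) * r powr (6 * real n)" unfolding k_def by (simp only: mult_1_right)
      also have "\<dots> = r powr (6 * real n - d)" by (simp only: powr_add[symmetric]) simp
      finally show ?thesis .
    qed
    have start: "(LINT x:?K|lborel. (v (t0 - r\<^sup>2, x))\<^sup>2 * cut_ker d n r (T0 - (t0 - r\<^sup>2)) (?Y x)) \<le>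
        r powr (6 * real n - d) * m"
      using s1 s3 unfolding s2 k[symmetric] by (rule order_trans)
    have err: "(t0 - (t0 - r\<^sup>2)) * ((ker_const d n * r powr (6 * real n - 2 - d)) * m) =
        ker_const d n * r powr (6 * real n - d) * m"
    proof -
      have "r powr 2 * r powr (6 * real n - 2 - d) = r powr (6 * real n - d)"
        by (simp only: powr_add[symmetric]) simp
      moreover have "t0 - (t0 - r\<^sup>2) = r powr 2" using r by simp
      ultimately show ?thesis by (simp add: mult_ac)
    qed
    let ?B = "cball x0 (sqrt \<tau>)"
    define l where "l = \<tau> powr (- d / 2) * exp (- 1 / 4) * (r ^ (2 * n) / 2) ^ 3"
    have "(LINT x:?B|lborel. w / 2 * l) \<le> (LINT x:?K|lborel. (v (t0, x))\<^sup>2 * cut_ker d n r (T0 - t0) (?Y x))"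
    proof (rule set_integral_mono_subset)
      show sub: "?B \<subseteq> ?K" using \<tau> by auto
      show "set_integrable lborel ?B (\<lambda>x. w / 2 * l)" by (intro set_integrable_compact continuous_intros) auto
      show "set_integrable lborel ?K (\<lambda>x. (v (t0, x))\<^sup>2 * cut_ker d n r (T0 - t0) (?Y x))"
        by (rule set_integrable_v_square_mult[OF t0I cK K continuous_on_cut_ker]) (use \<tau> in \<open>simp add: T0_def\<close>)
      show "0 \<le> (v (t0, x))\<^sup>2 * cut_ker d n r (T0 - t0) (?Y x)" for x by (simp add: cut_ker_nonneg)
      fix x assume x: "x \<in> ?B"
      then have nx: "norm (x - x0) \<le> sqrt \<tau>" by (simp add: dist_norm norm_minus_commute)
      then have "dist x x0 < \<eta>" using \<tau>(3) \<eta>(1) by (simp add: dist_norm)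
      from \<eta>(2)[OF this] have vw: "w / 2 \<le> (v (t0, x))\<^sup>2" by (auto simp: dist_real_def abs_if split: if_splits)
      have "(norm (x - x0))\<^sup>2 \<le> (sqrt \<tau>)\<^sup>2" using nx by (intro power_mono) auto
      then have y: "?Y x \<le> \<tau>" using \<tau> by (simp add: power2_norm_eq_inner)
      have "l \<le> cut_ker d n r (T0 - t0) (?Y x)"
        unfolding l_def cut_ker_def heat_ker_def
      proof (intro mult_mono power_mono)
        show "\<tau> powr (- d / 2) \<le> (T0 - t0) powr (- d / 2)" by (simp add: T0_def)
        have "?Y x / (4 * \<tau>) \<le> 1 / 4" using y \<tau> by (simp add: field_simps)
        then show "exp (- 1 / 4) \<le> exp (- ?Y x / (4 * (T0 - t0)))" by (simp add: T0_def)
        have "?Y x ^ n \<le> (r\<^sup>2 / 2) ^ n" using y \<tau> by (intro power_mono) auto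
        also have "\<dots> = r ^ (2 * n) * (1 / 2) ^ n" by (simp add: power_divide power_mult)
        also have "\<dots> \<le> r ^ (2 * n) * (1 / 2) ^ 1"
          using n r by (intro mult_left_mono power_decreasing) auto
        finally have "?Y x ^ n \<le> r ^ (2 * n) / 2" by simp
        moreover have "r ^ (2 * n) - ?Y x ^ n \<le> cut n r (?Y x)" by (simp add: cut_def)
        ultimately show "r ^ (2 * n) / 2 \<le> cut n r (?Y x)" by linarith
      qed (use r in auto)
      then show "w / 2 * l \<le> (v (t0, x))\<^sup>2 * cut_ker d n r (T0 - t0) (?Y x)"
        using vw w by (intro mult_mono) (auto simp: l_def r less_imp_le)
    qed
    also have "\<dots> \<le> (1 + ker_const d n) * r powr (6 * real n - d) * m"
    proof -
      have "(1 + ker_const d n) * r powr (6 * real n - d) * m =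
          r powr (6 * real n - d) * m + ker_const d n * r powr (6 * real n - d) * m"
        by (simp only: distrib_right mult_1_left)
      then show ?thesis using est start unfolding err by linarith
    qed
    finally have f1: "measure lborel ?B * (w / 2 * l) \<le> (1 + ker_const d n) * r powr (6 * real n - d) * m"
      by (simp only: set_integral_const_compact[OF compact_cball])
    \<comment> \<open>The volume of the ball, \<open>U * \<tau> powr (d / 2)\<close>, cancels the
      kernel's factor \<open>\<tau> powr (- d / 2)\<close>. The 16 is the 2 of \<open>w / 2\<close>
      times the 8 of the cubed half.\<close>
    have f2: "measure lborel ?B * (w / 2 * l) = (U * w * exp (- 1 / 4) / 16) * r ^ (6 * n)"
    proof -
      have A: "measure lborel ?B = U * sqrt \<tau> ^ DIM('a)"
        using content_cball[of "sqrt \<tau>" x0] \<tau> by (simp add: U_def d_def)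
      have B: "sqrt \<tau> ^ DIM('a) * \<tau> powr (- d / 2) = 1"
      proof -
        have "sqrt \<tau> ^ DIM('a) = \<tau> powr (d / 2)"
          using \<tau> by (simp add: powr_half_sqrt[symmetric] powr_realpow[symmetric] powr_powr d_def)
        then show ?thesis using \<tau> by (simp add: powr_minus)
      qed
      have C: "(r ^ (2 * n) / 2) ^ 3 = r ^ (6 * n) / 8"
        by (simp only: power_divide power_mult[symmetric]) simp
      have "measure lborel ?B * (w / 2 * l) =
          (sqrt \<tau> ^ DIM('a) * \<tau> powr (- d / 2)) * (U * (w / 2) * exp (- 1 / 4) * (r ^ (2 * n) / 2) ^ 3)"
        unfolding A l_def by (simp only: mult_ac)
      then show ?thesis unfolding B C by simp
    qed
    have f3: "r powr (6 * real n - d) = r ^ (6 * n) * r powr (- d)"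
      using powr_realpow[OF r, of "6 * n"] powr_add[of r "6 * real n" "- d"] by simp
    have "r ^ (6 * n) * (U * w * exp (- 1 / 4) / 16) \<le> r ^ (6 * n) * ((1 + ker_const d n) * r powr (- d) * m)"
      using f1 unfolding f2 f3 by (simp only: mult_ac)
    then show ?thesis using r by (simp add: w_def)
  qed
  moreover have "(v (t0, x0))\<^sup>2 = 16 * exp (1 / 4) / U * (U * (v (t0, x0))\<^sup>2 * exp (- 1 / 4) / 16)"
    using U by (simp add: exp_minus field_simps)
  moreover have "0 \<le> 16 * exp (1 / 4) / U" using U by simp
  ultimately have "(v (t0, x0))\<^sup>2 \<le> 16 * exp (1 / 4) / U * ((1 + ker_const d n) * r powr (- d) * m)"
    by (metis mult_left_mono)
  then show ?thesis by (simp add: U_def d_def r_def mult_ac)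
qed

end

section \<open>Truncated solutions are subsolutions\<close>

lemma continuous_on_locally:
  fixes F :: "'b::t2_space \<Rightarrow> 'c::topological_space"
  assumes "\<And>z. z \<in> X \<Longrightarrow> \<exists>W. open W \<and> z \<in> W \<and> continuous_on (X \<inter> W) F"
  shows "continuous_on X F"
  unfolding continuous_on_eq_continuous_within
proof
  fix z assume z: "z \<in> X"
  obtain W where W: "open W" "z \<in> W" "continuous_on (X \<inter> W) F" using assms[OF z] by blast
  have "at z within X \<inter> W = at z within X"
    by (rule at_within_nhd[OF W(2,1)]) auto
  moreover have "continuous (at z within X \<inter> W) F"
    using W(3) W(2) z unfolding continuous_on_eq_continuous_within by blast
  ultimately show "continuous (at z within X) F" unfolding continuous_within by (rule subst)
qed

text \<open>A cylinder is not open at its final time, but its space slices are, so a relative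
  derivative in space-time restricts to an ordinary derivative in space.\<close>

lemma has_derivative_space_slice:
  assumes f: "(f has_derivative f') (at (t, x) within I \<times> X)" and "t \<in> I" "open X" "x \<in> X"
  shows "((\<lambda>y. f (t, y)) has_derivative (\<lambda>h. f' (0, h))) (at x)"
proof -
  have p: "((\<lambda>y. (t, y)) has_derivative (\<lambda>h. (0, h))) (at x within X)"
    by (rule has_derivative_Pair[OF has_derivative_const has_derivative_ident])
  have im: "(\<lambda>y. (t, y)) ` X \<subseteq> I \<times> X" using assms(2) by auto
  have "((\<lambda>y. f (t, y)) has_derivative (\<lambda>h. f' (0, h))) (at x within X)"
    by (rule has_derivative_in_compose[OF p has_derivative_subset[OF f im]])
  then show ?thesis by (simp only: at_within_open[OF assms(4,3)])
qed

lemma has_real_derivative_along: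
  fixes f :: "'a::euclidean_space \<Rightarrow> real"
  assumes "(f has_derivative f') (at x)"
  shows "((\<lambda>s. f (x + s *\<^sub>R b)) has_real_derivative f' b) (at 0)"
proof -
  interpret bounded_linear f' using assms by (rule has_derivative_bounded_linear)
  have "((\<lambda>s. x + s *\<^sub>R b) has_derivative (\<lambda>s. s *\<^sub>R b)) (at 0)"
    by (auto intro!: derivative_eq_intros)
  then have "((\<lambda>s. f (x + s *\<^sub>R b)) has_derivative (\<lambda>s. f' (s *\<^sub>R b))) (at 0)"
    by (rule has_derivative_compose) (use assms in simp)
  moreover have "(\<lambda>s. f' (s *\<^sub>R b)) = (*) (f' b)" by (auto simp: fun_eq_iff scaleR)
  ultimately show ?thesis by (simp only: has_field_derivative_def)
qed

lemma cone_over_eq: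
  assumes "M \<subseteq> sphere 0 1"
  shows "cone_over M = {x. x \<noteq> 0 \<and> x /\<^sub>R norm x \<in> M}"
proof (intro set_eqI iffI)
  fix x assume "x \<in> cone_over M"
  then obtain r \<sigma> where *: "x = r *\<^sub>R \<sigma>" "0 < r" "\<sigma> \<in> M" by (auto simp: cone_over_def)
  then have "norm \<sigma> = 1" using assms by auto
  with * show "x \<in> {x. x \<noteq> 0 \<and> x /\<^sub>R norm x \<in> M}" by auto
next
  fix x assume "x \<in> {x. x \<noteq> 0 \<and> x /\<^sub>R norm x \<in> M}"
  then show "x \<in> cone_over M"
    unfolding cone_over_def by (auto intro!: exI[of _ "norm x"] exI[of _ "x /\<^sub>R norm x"])
qed

lemma open_cone_over:
  fixes M :: "'a::euclidean_space set"
  assumes "openin (top_of_set (sphere 0 1)) M"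
  shows "open (cone_over M)"
proof -
  obtain T where T: "open T" "M = sphere 0 1 \<inter> T" using assms by (auto simp: openin_open)
  have "open ((- {0}) \<inter> (\<lambda>x::'a. x /\<^sub>R norm x) -` T)"
    by (intro continuous_open_preimage continuous_intros T(1)) auto
  also have "(- {0}) \<inter> (\<lambda>x::'a. x /\<^sub>R norm x) -` T = cone_over M"
    using T by (subst cone_over_eq) auto
  finally show ?thesis .
qed

lemma scaleR_mem_cone_over:
  assumes "M \<subseteq> sphere 0 1" "\<sigma> \<in> sphere 0 1" "0 < r"
  shows "r *\<^sub>R \<sigma> \<in> cone_over M \<longleftrightarrow> \<sigma> \<in> M"
  using assms by (subst cone_over_eq) auto

lemma flat_exp_nonpos: "s \<le> 0 \<Longrightarrow> flat_exp \<delta> p s = 0"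
  by (simp add: flat_exp_def)

lemma cylinder_1: "cylinder \<Omega> 1 = {0<..1} \<times> (\<Omega> \<inter> ball 0 1)"
  by (simp add: cylinder_def)

text \<open>The bound on \<open>u\<close> is one-sided, and so is the resulting decay; the other
  side comes from interpreting the locale for the negated solution. Keeping the derivatives as
  parameters makes that second interpretation a matter of signs.\<close>

locale heat_solution_in_cone =
  fixes M :: "'a::euclidean_space set" and u :: "real \<times> 'a \<Rightarrow> real"
    and u1 :: "'a \<Rightarrow> real \<times> 'a \<Rightarrow> real" and u2 :: "'a \<Rightarrow> real \<times> 'a \<Rightarrow> real"
    and S :: real
  assumes M_open: "openin (top_of_set (sphere 0 1)) M"
    and smooth: "smooth_on (cylinder (cone_over M) 1) u"
    and lateral: "zero_lateral_values (cone_over M) u"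
    and cont_u1: "b \<in> Basis \<Longrightarrow> continuous_on (cylinder (cone_over M) 1) (u1 b)"
    and cont_u2: "b \<in> Basis \<Longrightarrow> continuous_on (cylinder (cone_over M) 1) (u2 b)"
    and deriv_u: "(t, x) \<in> cylinder (cone_over M) 1 \<Longrightarrow>
      ((\<lambda>y. u (t, y)) has_derivative (\<lambda>h. \<Sum>b\<in>Basis. u1 b (t, x) * (h \<bullet> b))) (at x)"
    and deriv_u1: "(t, x) \<in> cylinder (cone_over M) 1 \<Longrightarrow> b \<in> Basis \<Longrightarrow>
      ((\<lambda>s. u1 b (t, x + s *\<^sub>R b)) has_real_derivative u2 b (t, x)) (at 0)"
    and heat: "(t, x) \<in> cylinder (cone_over M) 1 \<Longrightarrow>
      ((\<lambda>s. u (s, x)) has_real_derivative (\<Sum>b\<in>Basis. u2 b (t, x))) (at t within {0<..1})"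
    and u_le: "z \<in> cylinder (cone_over M) 1 \<Longrightarrow> u z \<le> S" and S: "0 \<le> S"
begin

abbreviation "\<Omega> \<equiv> cone_over M"
abbreviation "C \<equiv> cylinder (cone_over M) 1"
abbreviation "X \<equiv> {0<..1::real} \<times> ball (0::'a) 1"

lemma M_sphere: "M \<subseteq> sphere 0 1"
  using M_open openin_imp_subset by blast

lemma open_Omega: "open \<Omega>"
  by (rule open_cone_over[OF M_open])

lemma zero_notin_Omega: "0 \<notin> \<Omega>"
  by (simp add: cone_over_eq[OF M_sphere])

lemma C_eq: "C = X \<inter> (UNIV \<times> \<Omega>)"
  by (auto simp: cylinder_1)

lemma cont_u: "continuous_on C u"
  using smooth Ck_on_imp_continuous_on by (auto simp: smooth_on_def)

lemma scaleR_mem_C: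
  assumes "t \<in> {0<..1}" "0 < r" "r < 1" "\<sigma> \<in> M"
  shows "(t, r *\<^sub>R \<sigma>) \<in> C"
proof -
  have "\<sigma> \<in> sphere 0 1" using assms(4) M_sphere by blast
  moreover have "r *\<^sub>R \<sigma> \<in> \<Omega>" using assms unfolding cone_over_def by blast
  ultimately show ?thesis using assms(1-3) by (simp add: cylinder_1)
qed

section \<open>Extension of truncated quantities by zero across the lateral boundary\<close>

lemma small_near_complement:
  assumes z: "z \<in> X" "z \<notin> C" and e: "0 < e"
  shows "\<exists>W. open W \<and> z \<in> W \<and> (\<forall>z'\<in>W \<inter> C. u z' < e)"
proof -
  obtain t x where tx: "z = (t, x)" by (cases z)
  have x: "x \<notin> \<Omega>" "x \<in> ball 0 1" "0 < t" "t \<le> 1" using z by (auto simp: tx cylinder_1)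
  show ?thesis
  \<comment> \<open>A point off the cone is either a lateral boundary point, the vertex included,
    where the zero limit applies, or has a neighbourhood disjoint from the cone. The limit
    disregards the value at the point itself, which is harmless because
    \<open>z \<notin> C\<close>.\<close>
  proof (cases "x \<in> closure \<Omega>")
    case True
    then have "x \<in> frontier \<Omega>" using x open_Omega by (simp add: frontier_def interior_open)
    then have "(u \<longlongrightarrow> 0) (at (t, x) within C)"
      using lateral x unfolding zero_lateral_values_def by blast
    then have "\<forall>\<^sub>F z' in at (t, x) within C. u z' < e"
      using e by (rule order_tendstoD(2))
    then obtain W where "open W" "(t, x) \<in> W" "\<forall>z'\<in>W. z' \<noteq> (t, x) \<longrightarrow> z' \<in> C \<longrightarrow> u z' < e"
      unfolding eventually_at_topological by blast
    then show ?thesis using z(2) by (intro exI[of _ W]) (auto simp: tx)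
  next
    case False
    then have "open (UNIV \<times> (- closure \<Omega>))" "z \<in> UNIV \<times> (- closure \<Omega>)"
      by (auto simp: tx intro!: open_Times)
    moreover have "(UNIV \<times> (- closure \<Omega>)) \<inter> C = {}"
      using closure_subset[of \<Omega>] by (auto simp: cylinder_1)
    ultimately show ?thesis by blast
  qed
qed

text \<open>Near a point outside \<open>C\<close> the solution stays below the level, so the glued
  function is identically zero there, and continuity is a local property.\<close>

lemma continuous_on_extension:
  assumes G: "continuous_on C G" and e: "0 < e" and G0: "\<And>z. z \<in> C \<Longrightarrow> u z < e \<Longrightarrow> G z = 0"
  shows "continuous_on X (\<lambda>z. if z \<in> C then G z else (0 :: 'c::real_normed_vector))"
proof (rule continuous_on_locally)
  fix z assume z: "z \<in> X"
  show "\<exists>W. open W \<and> z \<in> W \<and> continuous_on (X \<inter> W) (\<lambda>z. if z \<in> C then G z else 0)"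
  proof (cases "z \<in> C")
    case True
    have "continuous_on C (\<lambda>z. if z \<in> C then G z else 0)"
      by (rule continuous_on_eq[OF G]) simp
    then show ?thesis
      using True open_Omega by (intro exI[of _ "UNIV \<times> \<Omega>"]) (auto simp: C_eq[symmetric] cylinder_1 intro!: open_Times)
  next
    case False
    obtain W where W: "open W" "z \<in> W" "\<And>z'. z' \<in> W \<inter> C \<Longrightarrow> u z' < e"
      using small_near_complement[OF z False e] by blast
    have "continuous_on (X \<inter> W) (\<lambda>z. if z \<in> C then G z else 0)"
      by (rule continuous_on_eq[OF continuous_on_const[of _ 0]]) (use W G0 in auto)
    with W show ?thesis by blast
  qed
qed

lemma zero_near_complement:
  assumes "t \<in> {0<..1}" "x \<in> ball 0 1" "x \<notin> \<Omega>" "0 < e"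
  shows "\<exists>V. open V \<and> x \<in> V \<and> V \<subseteq> ball 0 1 \<and> (\<forall>y\<in>V. (t, y) \<in> C \<longrightarrow> u (t, y) < e)"
proof -
  have "(t, x) \<in> X" "(t, x) \<notin> C" using assms by (auto simp: cylinder_1)
  from small_near_complement[OF this assms(4)] obtain W where
    W: "open W" "(t, x) \<in> W" "\<And>z'. z' \<in> W \<inter> C \<Longrightarrow> u z' < e" by blast
  have "open (ball 0 1 \<inter> (\<lambda>y. (t, y)) -` W)"
    by (intro continuous_open_preimage continuous_intros W) auto
  with W assms show ?thesis by (intro exI[of _ "ball 0 1 \<inter> (\<lambda>y. (t, y)) -` W"]) auto
qed

context
  fixes \<epsilon> :: real
  assumes \<epsilon>: "0 < \<epsilon>"
begin

definition "tv z = (if z \<in> C then trunc \<epsilon> (u z - \<epsilon>) else 0)"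
definition "tDv z = (if z \<in> C then \<Sum>b\<in>Basis. (trunc1 \<epsilon> (u z - \<epsilon>) * u1 b z) *\<^sub>R b else 0)"
definition "tD2 b z = (if z \<in> C then trunc2 \<epsilon> (u z - \<epsilon>) * (u1 b z)\<^sup>2 + trunc1 \<epsilon> (u z - \<epsilon>) * u2 b z else 0)"
definition "tvt z = (if z \<in> C then trunc1 \<epsilon> (u z - \<epsilon>) * (\<Sum>b\<in>Basis. u2 b z) else 0)"

lemma trunc_below: "u z < \<epsilon> \<Longrightarrow> trunc \<epsilon> (u z - \<epsilon>) = 0" "u z < \<epsilon> \<Longrightarrow> trunc1 \<epsilon> (u z - \<epsilon>) = 0"
  "u z < \<epsilon> \<Longrightarrow> trunc2 \<epsilon> (u z - \<epsilon>) = 0"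
  by (simp_all add: trunc_def trunc1_def trunc2_def flat_exp_nonpos)

text \<open>Only closedness is at stake. If points of the set converged to a point outside
  \<open>M\<close>, then \<open>u\<close> would eventually fall below \<epsilon> by
  \<open>small_near_complement\<close>; limits inside \<open>M\<close> are covered by
  continuity.\<close>

lemma slice_compact_support:
  assumes t: "t \<in> {0<..1}" and r: "0 < r" "r < 1"
  shows "compact {\<sigma> \<in> M. \<epsilon> \<le> u (t, r *\<^sub>R \<sigma>)}"
proof -
  let ?K = "{\<sigma> \<in> M. \<epsilon> \<le> u (t, r *\<^sub>R \<sigma>)}"
  have inC: "(t, r *\<^sub>R \<sigma>) \<in> C" if "\<sigma> \<in> M" for \<sigma>
    using scaleR_mem_C[OF t r that] .
  have "closed ?K"
    unfolding closed_sequential_limits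
  proof (intro allI impI)
    fix s \<sigma> assume s: "(\<forall>n. s n \<in> ?K) \<and> s \<longlonglongrightarrow> \<sigma>"
    then have sM: "s n \<in> M" and us: "\<epsilon> \<le> u (t, r *\<^sub>R s n)" for n by auto
    have sph: "\<sigma> \<in> sphere 0 1"
      using closed_sequentially[OF closed_sphere, of s 0 1 \<sigma>] sM M_sphere s by blast
    have lim: "(\<lambda>n. (t, r *\<^sub>R s n)) \<longlonglongrightarrow> (t, r *\<^sub>R \<sigma>)"
      using s by (intro tendsto_intros) auto
    have "\<sigma> \<in> M"
    proof (rule ccontr)
      assume "\<sigma> \<notin> M"
      then have "(t, r *\<^sub>R \<sigma>) \<in> X" "(t, r *\<^sub>R \<sigma>) \<notin> C"
        using t r sph M_sphere by (auto simp: cylinder_1 scaleR_mem_cone_over)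
      from small_near_complement[OF this \<epsilon>] obtain W where
        W: "open W" "(t, r *\<^sub>R \<sigma>) \<in> W" "\<And>z'. z' \<in> W \<inter> C \<Longrightarrow> u z' < \<epsilon>" by blast
      have "\<forall>\<^sub>F n in sequentially. (t, r *\<^sub>R s n) \<in> W"
        using topological_tendstoD[OF lim W(1,2)] .
      then obtain n where "(t, r *\<^sub>R s n) \<in> W" using eventually_happens by fastforce
      then show False using W(3)[of "(t, r *\<^sub>R s n)"] inC[OF sM] us[of n] by force
    qed
    moreover have "(\<lambda>n. u (t, r *\<^sub>R s n)) \<longlonglongrightarrow> u (t, r *\<^sub>R \<sigma>)"
      by (rule continuous_on_tendsto_compose[OF cont_u lim])
        (use inC sM \<open>\<sigma> \<in> M\<close> in auto)
    then have "\<epsilon> \<le> u (t, r *\<^sub>R \<sigma>)"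
      using us by (intro LIMSEQ_le_const) auto
    ultimately show "\<sigma> \<in> ?K" by simp
  qed
  then have "compact (?K \<inter> sphere 0 1)" by (rule closed_Int_compact[OF _ compact_sphere])
  moreover have "?K \<inter> sphere 0 1 = ?K" using M_sphere by auto
  ultimately show ?thesis by simp
qed

text \<open>The radial extension of a slice is the truncation composed with \<open>u\<close> and
  with \<open>P\<close>. The components of \<open>P\<close> are the constant \<open>t\<close> and
  multiples of coordinates divided by \<open>norm x\<close>, smooth on the cone; that
  \<open>u\<close> is smooth only relative to the cylinder is no obstacle to this
  composition.\<close>

lemma slice_test_function:
  assumes t: "t \<in> {0<..1}" and r: "0 < r" "r < 1"
  shows "(\<lambda>\<sigma>. tv (t, r *\<^sub>R \<sigma>)) \<in> sphere_Cc_inf M"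
proof -
  define P where "P x = (t, r *\<^sub>R (x /\<^sub>R norm x))" for x :: 'a
  have PC: "P x \<in> C" if "x \<in> \<Omega>" for x
  proof -
    have "x \<noteq> 0" "x /\<^sub>R norm x \<in> M" using that by (auto simp: cone_over_eq[OF M_sphere])
    then show ?thesis unfolding P_def using scaleR_mem_C[OF t r] by blast
  qed
  have comp: "Ck_on k \<Omega> (\<lambda>x. P x \<bullet> b)" if "b \<in> Basis" for b k
  proof -
    consider "b = (1, 0)" | c where "c \<in> Basis" "b = (0, c)"
      using \<open>b \<in> Basis\<close> by (auto simp: Basis_prod_def)
    then show ?thesis
    proof cases
      case 1
      then have "(\<lambda>x. P x \<bullet> b) = (\<lambda>_. t)" by (simp add: P_def fun_eq_iff)
      then show ?thesis by (simp only: Ck_on_const)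
    next
      case 2
      have "Ck_on k \<Omega> (\<lambda>x. r * (x \<bullet> c) * (x \<bullet> x) powr (- 1 / 2))"
        by (intro Ck_on_mult Ck_on_const Ck_on_linear bounded_linear_inner_left
            Ck_on_inner_self_powr zero_notin_Omega)
      moreover have "P x \<bullet> b = r * (x \<bullet> c) * (x \<bullet> x) powr (- 1 / 2)" if "x \<in> \<Omega>" for x
      proof -
        have "x \<noteq> 0" using that zero_notin_Omega by blast
        then have "x \<bullet> x = norm x powr 2" by (simp add: power2_norm_eq_inner)
        then have "(x \<bullet> x) powr (- 1 / 2) = norm x powr (- 1)" by (simp only: powr_powr) simp
        also have "\<dots> = inverse (norm x)" by (simp add: powr_minus)
        finally have e: "(x \<bullet> x) powr (- 1 / 2) = inverse (norm x)" .
        show ?thesis unfolding e by (simp add: P_def 2(2))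
      qed
      ultimately show ?thesis
        using Ck_on_cong[of \<Omega> "\<lambda>x. P x \<bullet> b" "\<lambda>x. r * (x \<bullet> c) * (x \<bullet> x) powr (- 1 / 2)" k] by blast
    qed
  qed
  have s1: "smooth_on \<Omega> (\<lambda>x. u (P x))"
    by (rule smooth_on_compose[OF comp _ smooth]) (use PC in auto)
  have s2: "smooth_on \<Omega> (\<lambda>x. trunc \<epsilon> (u (P x) + - \<epsilon>))"
  proof (rule smooth_on_compose[OF _ _ smooth_on_trunc[OF \<epsilon>]])
    show "Ck_on k \<Omega> (\<lambda>x. (u (P x) + - \<epsilon>) \<bullet> b)" if "b \<in> Basis" for b :: real and k
      using that s1 Ck_on_add[OF _ Ck_on_const, of k \<Omega> "\<lambda>x. u (P x)" "- \<epsilon>"] by (simp add: smooth_on_def)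
  qed simp
  have "sphere_smooth M (\<lambda>\<sigma>. tv (t, r *\<^sub>R \<sigma>))"
    unfolding sphere_smooth_def smooth_on_def
  proof
    fix k
    have e: "radial_ext (\<lambda>\<sigma>. tv (t, r *\<^sub>R \<sigma>)) x = trunc \<epsilon> (u (P x) + - \<epsilon>)" if "x \<in> \<Omega>" for x
      using PC[OF that] by (simp add: radial_ext_def tv_def P_def)
    show "Ck_on k \<Omega> (radial_ext (\<lambda>\<sigma>. tv (t, r *\<^sub>R \<sigma>)))"
      using s2 e Ck_on_cong[of \<Omega> "radial_ext (\<lambda>\<sigma>. tv (t, r *\<^sub>R \<sigma>))" "\<lambda>x. trunc \<epsilon> (u (P x) + - \<epsilon>)" k]
      unfolding smooth_on_def by blast
  qed
  moreover have z: "tv (t, r *\<^sub>R \<sigma>) = 0" if "\<not> \<epsilon> \<le> u (t, r *\<^sub>R \<sigma>)" for \<sigma>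
    using that trunc_below(1) by (simp add: tv_def not_le)
  then have "\<exists>K. compact K \<and> K \<subseteq> M \<and> (\<forall>\<sigma>\<in>M - K. tv (t, r *\<^sub>R \<sigma>) = 0)"
    using slice_compact_support[OF t r]
    by (intro exI[of _ "{\<sigma> \<in> M. \<epsilon> \<le> u (t, r *\<^sub>R \<sigma>)}"]) auto
  ultimately show ?thesis by (simp add: sphere_Cc_inf_def)
qed

text \<open>Inside the cone this is the chain rule: the Laplacian exceeds the time derivative by
  \<open>trunc2\<close> times the squared gradient, nonnegative by convexity. At a point outside the
  cone the truncation vanishes on a space neighbourhood at each time, and for all times at the point
  itself.\<close>

lemma truncation_subsolution: "cone_subsolution M tv tDv tD2 tvt S"
proof
  have tr: "continuous_on C (\<lambda>z. trunc \<epsilon> (u z - \<epsilon>))" "continuous_on C (\<lambda>z. trunc1 \<epsilon> (u z - \<epsilon>))"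
    "continuous_on C (\<lambda>z. trunc2 \<epsilon> (u z - \<epsilon>))"
    by (rule continuous_on_compose2[OF continuous_on_trunc(1)[OF \<epsilon>, of UNIV]]
        continuous_on_compose2[OF continuous_on_trunc(2)[OF \<epsilon>, of UNIV]]
        continuous_on_compose2[OF continuous_on_trunc(3)[OF \<epsilon>, of UNIV]]; auto intro!: continuous_intros cont_u)+
  show "M \<subseteq> sphere 0 1" by (rule M_sphere)
  show "continuous_on X tv" unfolding tv_def[abs_def]
    by (rule continuous_on_extension[OF tr(1) \<epsilon>]) (simp add: trunc_below)
  show "continuous_on X tDv" unfolding tDv_def[abs_def]
    by (rule continuous_on_extension[OF _ \<epsilon>]) (auto simp: trunc_below intro!: continuous_intros tr cont_u1)
  show "continuous_on X (tD2 b)" if "b \<in> Basis" for b unfolding tD2_def[abs_def]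
    by (rule continuous_on_extension[OF _ \<epsilon>]) (use that in \<open>auto simp: trunc_below intro!: continuous_intros tr cont_u1 cont_u2\<close>)
  show "continuous_on X tvt" unfolding tvt_def[abs_def]
    by (rule continuous_on_extension[OF _ \<epsilon>]) (auto simp: trunc_below intro!: continuous_intros tr cont_u2)
  fix t :: real and x :: 'a assume t: "t \<in> {0<..1}"
  show "\<exists>e>0. \<forall>x\<in>ball 0 e. tv (t, x) = 0"
  proof -
    obtain V where V: "open V" "0 \<in> V" "\<And>y. y \<in> V \<Longrightarrow> (t, y) \<in> C \<Longrightarrow> u (t, y) < \<epsilon>"
      using zero_near_complement[OF t _ zero_notin_Omega \<epsilon>] by auto
    then obtain e where "e > 0" "ball 0 e \<subseteq> V" using open_contains_ball by blast
    then show ?thesis using V(3) by (intro exI[of _ e]) (auto simp: tv_def trunc_below)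
  qed
  show "(\<lambda>\<sigma>. tv (t, r *\<^sub>R \<sigma>)) \<in> sphere_Cc_inf M" if "0 < r" "r < 1" for r
    by (rule slice_test_function[OF t that])
  assume x: "x \<in> ball 0 1"
  show "0 \<le> tv (t, x)" using trunc_bounds(1)[OF \<epsilon>] by (simp add: tv_def)
  show "tv (t, x) \<le> S"
    using trunc_bounds(2)[OF \<epsilon> S, of "u (t, x) - \<epsilon>"] u_le[of "(t, x)"] \<epsilon> S by (auto simp: tv_def)
  show "tv (t, x) = 0 \<and> tDv (t, x) = 0" if "x \<notin> \<Omega>"
    using that by (simp add: tv_def tDv_def cylinder_1)
  show "tvt (t, x) \<le> (\<Sum>b\<in>Basis. tD2 b (t, x))"
  proof -
    have "0 \<le> (\<Sum>b\<in>Basis. trunc2 \<epsilon> (u (t, x) - \<epsilon>) * (u1 b (t, x))\<^sup>2)"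
      by (intro sum_nonneg mult_nonneg_nonneg trunc2_nonneg[OF \<epsilon>]) simp
    then show ?thesis by (simp add: tvt_def tD2_def sum.distrib sum_distrib_left)
  qed
  have openX: "open (\<Omega> \<inter> ball 0 1)" using open_Omega by auto
  have inC: "(t, y) \<in> C" if "y \<in> \<Omega> \<inter> ball 0 1" for y using that t by (simp add: cylinder_1)
  consider (inside) "x \<in> \<Omega>" | (outside) "x \<notin> \<Omega>" by blast
  then show "((\<lambda>y. tv (t, y)) has_derivative (\<lambda>h. tDv (t, x) \<bullet> h)) (at x)"
  proof cases
    case inside
    then have xC: "(t, x) \<in> C" using x inC by simp
    have "((\<lambda>y. trunc \<epsilon> (u (t, y) - \<epsilon>)) has_derivative
        (\<lambda>h. trunc1 \<epsilon> (u (t, x) - \<epsilon>) * (\<Sum>b\<in>Basis. u1 b (t, x) * (h \<bullet> b)))) (at x)"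
      using has_derivative_compose[OF has_derivative_diff[OF deriv_u[OF xC] has_derivative_const]
          trunc_deriv[OF \<epsilon>, unfolded has_field_derivative_def]] by simp
    also have "(\<lambda>h. trunc1 \<epsilon> (u (t, x) - \<epsilon>) * (\<Sum>b\<in>Basis. u1 b (t, x) * (h \<bullet> b))) = (\<lambda>h. tDv (t, x) \<bullet> h)"
    proof
      fix h
      have "tDv (t, x) \<bullet> h = (\<Sum>b\<in>Basis. trunc1 \<epsilon> (u (t, x) - \<epsilon>) * (u1 b (t, x) * (b \<bullet> h)))"
        using xC by (simp add: tDv_def inner_sum_left mult.assoc)
      then show "trunc1 \<epsilon> (u (t, x) - \<epsilon>) * (\<Sum>b\<in>Basis. u1 b (t, x) * (h \<bullet> b)) = tDv (t, x) \<bullet> h"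
        by (simp only: sum_distrib_left inner_commute[of h])
    qed
    finally show ?thesis
      by (rule has_derivative_transform_within_open[OF _ openX]) (use inside x inC in \<open>auto simp: tv_def\<close>)
  next
    case outside
    obtain V where V: "open V" "x \<in> V" "\<And>y. y \<in> V \<Longrightarrow> (t, y) \<in> C \<Longrightarrow> u (t, y) < \<epsilon>"
      using zero_near_complement[OF t x outside \<epsilon>] by auto
    have "((\<lambda>y. 0) has_derivative (\<lambda>h. tDv (t, x) \<bullet> h)) (at x)"
      using outside by (simp add: tDv_def cylinder_1)
    then show ?thesis
      by (rule has_derivative_transform_within_open[OF _ V(1,2)]) (use V in \<open>auto simp: tv_def trunc_below\<close>)
  qed
  show "((\<lambda>s. tv (s, x)) has_real_derivative tvt (t, x)) (at t within {0<..1})"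
  proof (cases "x \<in> \<Omega>")
    case True
    then have xC: "(s, x) \<in> C" if "s \<in> {0<..1}" for s using x that by (simp add: cylinder_1)
    have "((\<lambda>s. trunc \<epsilon> (u (s, x) - \<epsilon>)) has_real_derivative
        trunc1 \<epsilon> (u (t, x) - \<epsilon>) * ((\<Sum>b\<in>Basis. u2 b (t, x)) - 0)) (at t within {0<..1})"
      by (rule DERIV_chain2[OF trunc_deriv[OF \<epsilon>] DERIV_diff[OF heat[OF xC[OF t]] DERIV_const]])
    then have "((\<lambda>s. trunc \<epsilon> (u (s, x) - \<epsilon>)) has_real_derivative tvt (t, x)) (at t within {0<..1})"
      using xC[OF t] by (simp add: tvt_def)
    then show ?thesis
      by (rule has_field_derivative_transform_within[OF _ zero_less_one t]) (use xC in \<open>auto simp: tv_def\<close>)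
  next
    case False
    then show ?thesis by (simp add: tv_def tvt_def cylinder_1)
  qed
  fix b :: 'a assume b: "b \<in> Basis"
  have tDvb: "tDv z \<bullet> b = (if z \<in> C then trunc1 \<epsilon> (u z - \<epsilon>) * u1 b z else 0)" for z
    using b by (simp add: tDv_def inner_sum_left inner_Basis if_distrib sum.delta cong: if_cong)
  show "((\<lambda>s. tDv (t, x + s *\<^sub>R b) \<bullet> b) has_real_derivative tD2 b (t, x)) (at 0)"
  proof (cases "x \<in> \<Omega>")
    case True
    then have xC: "(t, x) \<in> C" using x inC by simp
    have du: "((\<lambda>s. u (t, x + s *\<^sub>R b)) has_real_derivative u1 b (t, x)) (at 0)"
    proof -
      have "(\<Sum>c\<in>Basis. u1 c (t, x) * (b \<bullet> c)) = u1 b (t, x)"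
        using b by (simp add: inner_Basis if_distrib sum.delta cong: if_cong)
      then show ?thesis using has_real_derivative_along[OF deriv_u[OF xC], of b] by simp
    qed
    have d1: "((\<lambda>s. trunc1 \<epsilon> (u (t, x + s *\<^sub>R b) - \<epsilon>)) has_real_derivative
        trunc2 \<epsilon> (u (t, x) - \<epsilon>) * (u1 b (t, x) - 0)) (at 0)"
      using DERIV_chain2[OF _ DERIV_diff[OF du DERIV_const], of "trunc1 \<epsilon>" "trunc2 \<epsilon> (u (t, x) - \<epsilon>)" \<epsilon>]
        trunc1_deriv[OF \<epsilon>, of "u (t, x) - \<epsilon>"] by simp
    have "((\<lambda>s. trunc1 \<epsilon> (u (t, x + s *\<^sub>R b) - \<epsilon>) * u1 b (t, x + s *\<^sub>R b)) has_real_derivative tD2 b (t, x)) (at 0)"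
      by (rule DERIV_cong[OF DERIV_mult[OF d1 deriv_u1[OF xC b]]])
        (use xC in \<open>simp add: tD2_def power2_eq_square algebra_simps\<close>)
    moreover have "open ((\<lambda>s::real. x + s *\<^sub>R b) -` (\<Omega> \<inter> ball 0 1))"
      by (intro open_vimage openX continuous_intros)
    ultimately show ?thesis unfolding tDvb
      by (rule has_field_derivative_transform_within_open) (use True x inC in auto)
  next
    case False
    obtain V where V: "open V" "x \<in> V" "\<And>y. y \<in> V \<Longrightarrow> (t, y) \<in> C \<Longrightarrow> u (t, y) < \<epsilon>"
      using zero_near_complement[OF t x False \<epsilon>] by auto
    have "((\<lambda>s. 0) has_real_derivative tD2 b (t, x)) (at 0)"
      using False by (simp add: tD2_def cylinder_1)
    moreover have "open ((\<lambda>s::real. x + s *\<^sub>R b) -` V)"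
      by (intro open_vimage V continuous_intros)
    ultimately show ?thesis unfolding tDvb
      by (rule has_field_derivative_transform_within_open) (use V in \<open>auto simp: trunc_below\<close>)
  qed
qed

end

end

section \<open>Decay near the vertex and removal of the truncation\<close>

definition decay_const :: "real \<Rightarrow> nat \<Rightarrow> real \<Rightarrow> nat \<Rightarrow> real \<Rightarrow> real" where
  "decay_const V d \<alpha> n s = 16 * exp (1 / 4) * (1 + ker_const (real d) n) / unit_ball_vol (real d) * 2 powr real d *
     mass_const V (real d + 2 * \<alpha>) n s"

lemma decay_const_nonneg: "0 \<le> V \<Longrightarrow> 0 \<le> decay_const V d \<alpha> n s"
  by (simp add: decay_const_def ker_const_nonneg mass_const_nonneg)

text \<open>The mass bound started at time \<open>a\<close> is available from time
  \<open>2 * a\<close> on, and the pointwise bound looks back by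
  \<open>(\<rho> / 2)\<^sup>2\<close>, at most \<open>a\<close>; hence the condition
  \<open>3 * a \<le> t\<close>. Mass of order \<open>\<rho> powr D\<close> divided by volume of
  order \<open>\<rho> powr d\<close> leaves \<open>\<rho> powr (2 * \<alpha>)\<close>, and the
  square root produces \<alpha>.\<close>

lemma (in cone_subsolution) decay:
  assumes L: "0 \<le> Lambda0 M" "\<alpha> * (\<alpha> + real DIM('a) - 2) \<le> Lambda0 M" "0 \<le> \<alpha>"
    and n: "2 \<le> n" "(real DIM('a) + 2 * \<alpha>) / 2 + 1 \<le> real n"
    and a: "0 < a" "3 * a \<le> t" "t \<le> 1"
    and x: "0 < norm x" "(norm x)\<^sup>2 \<le> a" "norm x \<le> 1 / 8"
  shows "v (t, x) \<le> sqrt (decay_const (measure lborel (cball (0::'a) (1 / 2))) DIM('a) \<alpha> n a) * S * norm x powr \<alpha>"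
proof -
  define d where "d = real DIM('a)"
  define D where "D = d + 2 * \<alpha>"
  define \<rho> where "\<rho> = norm x"
  define V where "V = measure lborel (cball (0::'a) (1 / 2))"
  have \<rho>: "0 < \<rho>" using x by (simp add: \<rho>_def)
  have V: "0 \<le> V" by (simp add: V_def)
  have S: "0 \<le> S"
    using v_nonneg[of 1 0] v_le[of 1 0] by simp
  define m where "m = mass_const V D n a * S\<^sup>2 * \<rho> powr D"
  have mass: "(LINT x:cball 0 (2 * \<rho>)|lborel. (v (s, x))\<^sup>2) \<le> m" if "s \<in> {2 * a..1}" for s
    using mass_bound[OF L _ n(1), of D a "2 * a" s \<rho>] that n(2) a x
    by (simp add: m_def V_def D_def d_def \<rho>_def)
  have "(\<rho> / 2)\<^sup>2 \<le> \<rho>\<^sup>2" using \<rho> by (simp add: power_divide)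
  then have t2: "2 * a \<le> t - (\<rho> / 2)\<^sup>2" using a x unfolding \<rho>_def by linarith
  have n2: "real DIM('a) / 2 + 1 \<le> real n" using n(2) L(3) unfolding add_divide_distrib by linarith
  have "(v (t, x))\<^sup>2 \<le> 16 * exp (1 / 4) * (1 + ker_const d n) / unit_ball_vol d * (\<rho> / 2) powr (- d) * m"
    unfolding d_def
    by (rule pointwise_bound[where a' = "2 * a" and \<rho> = \<rho>, OF mass n(1) n2 \<rho>])
      (use x a t2 in \<open>auto simp: \<rho>_def\<close>)
  also have "\<dots> = decay_const V DIM('a) \<alpha> n a * S\<^sup>2 * ((\<rho> / 2) powr (- d) * 2 powr (- d) * \<rho> powr D)"
  proof -
    have "decay_const V DIM('a) \<alpha> n a * S\<^sup>2 * ((\<rho> / 2) powr (- d) * 2 powr (- d) * \<rho> powr D) =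
        (2 powr d * 2 powr (- d)) *
        (16 * exp (1 / 4) * (1 + ker_const d n) / unit_ball_vol d * (\<rho> / 2) powr (- d) * m)"
      unfolding decay_const_def m_def D_def d_def by (simp only: mult_ac)
    also have "2 powr d * 2 powr (- d) = 1" by (simp add: powr_minus)
    finally show ?thesis by simp
  qed
  also have "(\<rho> / 2) powr (- d) * 2 powr (- d) * \<rho> powr D = (\<rho> powr \<alpha>)\<^sup>2"
  proof -
    have "(\<rho> / 2) powr (- d) * 2 powr (- d) = \<rho> powr (- d)"
      using \<rho> by (simp add: powr_mult[symmetric])
    moreover have "\<rho> powr (- d) * \<rho> powr D = \<rho> powr \<alpha> * \<rho> powr \<alpha>"
      by (simp only: powr_add[symmetric]) (simp add: D_def)
    ultimately show ?thesis by (simp add: power2_eq_square)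
  qed
  also have "decay_const V DIM('a) \<alpha> n a * S\<^sup>2 * (\<rho> powr \<alpha>)\<^sup>2 = (sqrt (decay_const V DIM('a) \<alpha> n a) * S * \<rho> powr \<alpha>)\<^sup>2"
    using decay_const_nonneg[OF V] by (simp add: power_mult_distrib)
  finally have "v (t, x) \<le> sqrt (decay_const V DIM('a) \<alpha> n a) * S * \<rho> powr \<alpha>"
    by (rule power2_le_imp_le) (use S decay_const_nonneg[OF V] in simp)
  then show ?thesis by (simp add: V_def \<rho>_def)
qed

text \<open>With level and parameter both equal to \<open>e / 2\<close> the truncation is at least
  \<open>u - e\<close>, and its bound does not depend on \<open>e\<close>.\<close>

lemma (in heat_solution_in_cone) decay:
  assumes L: "0 \<le> Lambda0 M" "\<alpha> * (\<alpha> + real DIM('a) - 2) \<le> Lambda0 M" "0 \<le> \<alpha>"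
    and n: "2 \<le> n" "(real DIM('a) + 2 * \<alpha>) / 2 + 1 \<le> real n"
    and a: "0 < a" "3 * a \<le> t" "t \<le> 1"
    and x: "x \<in> cone_over M" "(norm x)\<^sup>2 \<le> a" "norm x \<le> 1 / 8"
  shows "u (t, x) \<le> sqrt (decay_const (measure lborel (cball (0::'a) (1 / 2))) DIM('a) \<alpha> n a) * S * norm x powr \<alpha>"
proof (rule field_le_epsilon)
  fix e :: real assume e: "0 < e"
  then have e2: "0 < e / 2" by simp
  interpret tr: cone_subsolution M "tv (e / 2)" "tDv (e / 2)" "tD2 (e / 2)" "tvt (e / 2)" S
    by (rule truncation_subsolution[OF e2])
  have nx: "0 < norm x" using x zero_notin_Omega by auto
  have "(t, x) \<in> C" using x a by (simp add: cylinder_1)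
  then have "u (t, x) - e \<le> tv (e / 2) (t, x)"
    using trunc_bounds(3)[OF e2, of "u (t, x) - e / 2"] by (simp add: tv_def[OF e2])
  also have "\<dots> \<le> sqrt (decay_const (measure lborel (cball (0::'a) (1 / 2))) DIM('a) \<alpha> n a) * S * norm x powr \<alpha>"
    by (rule tr.decay[OF L n a nx x(2,3)])
  finally show "u (t, x) \<le> sqrt (decay_const (measure lborel (cball (0::'a) (1 / 2))) DIM('a) \<alpha> n a) * S * norm x powr \<alpha> + e"
    by simp
qed

text \<open>Bridges the relative derivatives of \<open>smooth_on\<close> and the unrestricted ones
  in \<open>laplacian\<close>. Space slices are open, so the relative derivatives determine
  \<open>laplacian\<close> even on the final time slice; the time derivative is read off from
  \<open>heat_solution\<close> and stays one-sided there.\<close>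

lemma heat_solution_derivatives:
  fixes u :: "real \<times> 'a::euclidean_space \<Rightarrow> real"
  assumes op: "open \<Omega>" and sm: "smooth_on (cylinder \<Omega> 1) u" and heat: "heat_solution \<Omega> u"
  obtains u1 u2 where
    "\<And>b. b \<in> Basis \<Longrightarrow> continuous_on (cylinder \<Omega> 1) (u1 b)"
    "\<And>b. b \<in> Basis \<Longrightarrow> continuous_on (cylinder \<Omega> 1) (u2 b)"
    "\<And>t x. (t, x) \<in> cylinder \<Omega> 1 \<Longrightarrow>
      ((\<lambda>y. u (t, y)) has_derivative (\<lambda>h. \<Sum>b\<in>Basis. u1 b (t, x) * (h \<bullet> b))) (at x)"
    "\<And>t x b. (t, x) \<in> cylinder \<Omega> 1 \<Longrightarrow> b \<in> Basis \<Longrightarrow>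
      ((\<lambda>s. u1 b (t, x + s *\<^sub>R b)) has_real_derivative u2 b (t, x)) (at 0)"
    "\<And>t x. (t, x) \<in> cylinder \<Omega> 1 \<Longrightarrow>
      ((\<lambda>s. u (s, x)) has_real_derivative (\<Sum>b\<in>Basis. u2 b (t, x))) (at t within {0<..1})"
proof -
  let ?C = "cylinder \<Omega> 1"
  let ?X = "\<Omega> \<inter> ball 0 1"
  have oX: "open ?X" using op by auto
  have "Ck_on (Suc (Suc 0)) ?C u" using sm unfolding smooth_on_def by blast
  then obtain f1 where f1: "\<And>z. z \<in> ?C \<Longrightarrow> (u has_derivative f1 z) (at z within ?C)"
    "\<And>w. Ck_on (Suc 0) ?C (\<lambda>z. f1 z w)"
    unfolding Ck_on.simps(2)[of "Suc 0"] by blast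
  have "\<forall>w. \<exists>f2. (\<forall>z\<in>?C. ((\<lambda>z. f1 z w) has_derivative f2 z) (at z within ?C)) \<and>
      (\<forall>w'. continuous_on ?C (\<lambda>z. f2 z w'))"
    using f1(2) by simp
  then obtain f2 where f2: "\<And>w z. z \<in> ?C \<Longrightarrow> ((\<lambda>z. f1 z w) has_derivative f2 w z) (at z within ?C)"
    "\<And>w w'. continuous_on ?C (\<lambda>z. f2 w z w')"
    by metis
  define u1 where "u1 b z = f1 z (0, b)" for b :: 'a and z
  define u2 where "u2 b z = f2 (0, b) z (0, b)" for b :: 'a and z
  have c1: "continuous_on ?C (u1 b)" for b
    using Ck_on_imp_continuous_on[OF f1(2)[of "(0, b)"]] by (simp add: u1_def[abs_def])
  have c2: "continuous_on ?C (u2 b)" for b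
    using f2(2)[of "(0, b)" "(0, b)"] by (simp add: u2_def[abs_def])
  have d0: "((\<lambda>y. u (t, y)) has_derivative (\<lambda>h. f1 (t, x) (0, h))) (at x)" if "(t, x) \<in> ?C" for t x
    using has_derivative_space_slice[OF f1(1)[OF that, unfolded cylinder_1] _ oX] that
    by (auto simp: cylinder_1)
  have d1: "((\<lambda>y. u1 b (t, y)) has_derivative (\<lambda>h. f2 (0, b) (t, x) (0, h))) (at x)"
    if "(t, x) \<in> ?C" for t x b
    using has_derivative_space_slice[OF f2(1)[OF that, unfolded cylinder_1] _ oX] that
    by (auto simp: cylinder_1 u1_def)
  have D1: "((\<lambda>y. u (t, y)) has_derivative (\<lambda>h. \<Sum>b\<in>Basis. u1 b (t, x) * (h \<bullet> b))) (at x)"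
    if "(t, x) \<in> ?C" for t x
  proof -
    interpret bounded_linear "\<lambda>h. f1 (t, x) (0, h)"
      using d0[OF that] by (rule has_derivative_bounded_linear)
    have "f1 (t, x) (0, h) = (\<Sum>b\<in>Basis. u1 b (t, x) * (h \<bullet> b))" for h
    proof -
      have "f1 (t, x) (0, h) = f1 (t, x) (0, \<Sum>b\<in>Basis. (h \<bullet> b) *\<^sub>R b)"
        by (simp only: euclidean_representation)
      also have "\<dots> = (\<Sum>b\<in>Basis. (h \<bullet> b) *\<^sub>R f1 (t, x) (0, b))"
        unfolding sum by (intro sum.cong refl scaleR)
      finally show ?thesis by (simp add: u1_def mult.commute)
    qed
    then show ?thesis using d0[OF that] by simp
  qed
  have D2: "((\<lambda>s. u1 b (t, x + s *\<^sub>R b)) has_real_derivative u2 b (t, x)) (at 0)"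
    if "(t, x) \<in> ?C" for t x b
    using has_real_derivative_along[OF d1[OF that], of b b] by (simp add: u2_def)
  have lap: "laplacian (\<lambda>y. u (t, y)) x = (\<Sum>b\<in>Basis. u2 b (t, x))" if tx: "(t, x) \<in> ?C" for t x
  proof -
    have x: "x \<in> ?X" and t: "t \<in> {0<..1}" using tx by (auto simp: cylinder_1)
    have p1: "partial b (\<lambda>y. u (t, y)) y = u1 b (t, y)" if "y \<in> ?X" for y b
    proof -
      have "(t, y) \<in> ?C" using that t by (simp add: cylinder_1)
      from frechet_derivative_at[OF d0[OF this]] show ?thesis by (simp add: partial_def u1_def fun_eq_iff)
    qed
    have "partial b (partial b (\<lambda>y. u (t, y))) x = u2 b (t, x)" for b
    proof -
      have "(partial b (\<lambda>y. u (t, y)) has_derivative (\<lambda>h. f2 (0, b) (t, x) (0, h))) (at x)"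
        by (rule has_derivative_transform_within_open[OF d1[OF tx] oX x]) (simp add: p1)
      from frechet_derivative_at[OF this] show ?thesis
        unfolding partial_def[of b "partial b (\<lambda>y. u (t, y))"] u2_def by metis
    qed
    then show ?thesis by (simp add: laplacian_def)
  qed
  have "((\<lambda>s. u (s, x)) has_real_derivative (\<Sum>b\<in>Basis. u2 b (t, x))) (at t within {0<..1})"
    if "(t, x) \<in> ?C" for t x
    using heat that unfolding heat_solution_def lap[OF that, symmetric] by blast
  with c1 c2 D1 D2 show ?thesis by (rule that)
qed

text \<open>Near the vertex the decay lemma applies to the solution and to its negative; elsewhere
  \<open>norm x powr lam\<close> is bounded below and the estimate is immediate. The constant is
  fixed before \<open>u\<close> and is built from \<open>d\<close>, \<open>lam\<close> and
  \<open>R\<close>.\<close>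

theorem theorem1p15:
  fixes M :: "'a::euclidean_space set" and w0 :: "'a \<Rightarrow> real" and \<Omega> :: "'a set"
    and lam R :: real
  assumes "DIM('a) \<ge> 2"
    and "assumption_A1 M" and "assumption_A2 M"
    and "first_eigenfunction M w0" and "assumption_A3 M w0"
    and "\<Omega> = cone_over M"
    and "0 < lam" and "lam < lambda0 M"
    and "0 < R" and "R < 1"
  shows "\<exists>N::real>0. \<forall>u :: real \<times> 'a \<Rightarrow> real.
           smooth_on (cylinder \<Omega> 1) u \<and> heat_solution \<Omega> u \<and> zero_lateral_values \<Omega> u \<longrightarrow>
           (\<forall>(t, x) \<in> cylinder \<Omega> R.
              ereal \<bar>u (t, x)\<bar> \<le>
                ereal N * (SUP z \<in> cylinder \<Omega> 1. ereal \<bar>u z\<bar>) * ereal (norm x powr lam))"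
proof -
  define d where "d = real DIM('a)"
  have d: "2 \<le> d" using assms(1) by (simp add: d_def)
  have M: "openin (top_of_set (sphere 0 1)) M"
    using assms(2) by (simp add: assumption_A1_def)
  have Ms: "M \<subseteq> sphere 0 1" using openin_imp_subset[OF M] .
  have \<Omega>: "\<Omega> = cone_over M" by fact
  have L: "lam * (lam + d - 2) \<le> Lambda0 M"
  proof -
    let ?h = "(d - 2) / 2"
    have s: "lam + ?h < sqrt (Lambda0 M + ?h\<^sup>2)"
    proof -
      have "lambda0 M = - ?h + sqrt (Lambda0 M + ?h\<^sup>2)"
        by (simp only: lambda0_def d_def minus_divide_left)
      then show ?thesis using assms(8) by linarith
    qed
    have "0 \<le> ?h" using d by simp
    then have p: "0 < lam + ?h" using assms(7) by linarith
    \<comment> \<open>The real \<open>sqrt\<close> takes negative values at negative arguments, so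
      positivity of the radicand must be settled before squaring.\<close>
    then have "0 < Lambda0 M + ?h\<^sup>2" using s by (smt (verit) real_sqrt_le_0_iff)
    moreover have "(lam + ?h)\<^sup>2 < (sqrt (Lambda0 M + ?h\<^sup>2))\<^sup>2"
      using s p by (intro power_strict_mono) auto
    ultimately have "(lam + ?h)\<^sup>2 < Lambda0 M + ?h\<^sup>2" by simp
    then show ?thesis by (simp add: power2_eq_square field_simps)
  qed
  have L0: "0 \<le> Lambda0 M"
  proof -
    have "0 \<le> lam * (lam + d - 2)" using d assms(7) by (intro mult_nonneg_nonneg) auto
    then show ?thesis using L by linarith
  qed
  obtain k :: nat where k: "(d + 2 * lam) / 2 + 1 \<le> real k" using real_arch_simple by blast
  define n where "n = max 2 k"
  have n: "2 \<le> n" "(d + 2 * lam) / 2 + 1 \<le> real n" using k by (auto simp: n_def)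
  \<comment> \<open>Times in the inner cylinder exceed \<open>1 - R\<^sup>2\<close>, split here into
    the three steps required by the decay lemma.\<close>
  define a where "a = (1 - R\<^sup>2) / 3"
  have R2: "R\<^sup>2 < 1" using assms(9,10) by (simp add: power_less_one_iff)
  have a: "0 < a" using R2 by (simp add: a_def)
  define \<rho> where "\<rho> = min (sqrt a) (1 / 8)"
  have \<rho>: "0 < \<rho>" using a by (simp add: \<rho>_def)
  define A where "A = sqrt (decay_const (measure lborel (cball (0::'a) (1 / 2))) DIM('a) lam n a)"
  have A: "0 \<le> A" by (simp add: A_def decay_const_nonneg)
  \<comment> \<open>The second term serves points with \<open>norm x > \<rho>\<close>, where
    \<open>1 \<le> \<rho> powr (- lam) * norm x powr lam\<close>.\<close>
  define N where "N = A + \<rho> powr (- lam)"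
  have N: "0 < N" using A \<rho> by (simp add: N_def add_nonneg_pos)
  have bound: "\<bar>u (t, x)\<bar> \<le> N * S * norm x powr lam"
    if u: "smooth_on (cylinder \<Omega> 1) u" "heat_solution \<Omega> u" "zero_lateral_values \<Omega> u"
      and S: "\<And>z. z \<in> cylinder \<Omega> 1 \<Longrightarrow> \<bar>u z\<bar> \<le> S" and tx: "(t, x) \<in> cylinder \<Omega> R"
    for u :: "real \<times> 'a \<Rightarrow> real" and S t x
  proof -
    have tx1: "(t, x) \<in> cylinder \<Omega> 1" and x: "x \<in> \<Omega>" and t: "3 * a \<le> t" "t \<le> 1"
      using tx R2 assms(10) by (auto simp: cylinder_def a_def)
    have S0: "0 \<le> S" using S[OF tx1] by linarith
    show ?thesis
    proof (cases "norm x \<le> \<rho>")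
      case True
      have "norm x \<le> sqrt a" "norm x \<le> 1 / 8" using True by (auto simp: \<rho>_def)
      then have "(norm x)\<^sup>2 \<le> (sqrt a)\<^sup>2" by (intro power_mono) auto
      then have x2: "(norm x)\<^sup>2 \<le> a" "norm x \<le> 1 / 8" using a \<open>norm x \<le> 1 / 8\<close> by auto
      have op: "open (cone_over M)" by (rule open_cone_over[OF M])
      obtain u1 u2 where d:
        "\<And>b. b \<in> Basis \<Longrightarrow> continuous_on (cylinder \<Omega> 1) (u1 b)"
        "\<And>b. b \<in> Basis \<Longrightarrow> continuous_on (cylinder \<Omega> 1) (u2 b)"
        "\<And>t x. (t, x) \<in> cylinder \<Omega> 1 \<Longrightarrow>
          ((\<lambda>y. u (t, y)) has_derivative (\<lambda>h. \<Sum>b\<in>Basis. u1 b (t, x) * (h \<bullet> b))) (at x)"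
        "\<And>t x b. (t, x) \<in> cylinder \<Omega> 1 \<Longrightarrow> b \<in> Basis \<Longrightarrow>
          ((\<lambda>s. u1 b (t, x + s *\<^sub>R b)) has_real_derivative u2 b (t, x)) (at 0)"
        "\<And>t x. (t, x) \<in> cylinder \<Omega> 1 \<Longrightarrow>
          ((\<lambda>s. u (s, x)) has_real_derivative (\<Sum>b\<in>Basis. u2 b (t, x))) (at t within {0<..1})"
        using heat_solution_derivatives[OF op u(1,2)[unfolded \<Omega>]] unfolding \<Omega> by blast
      interpret p: heat_solution_in_cone M u u1 u2 S
        by unfold_locales
          (use M u d S S0 in \<open>auto simp: \<Omega> abs_le_iff\<close>)
      interpret m: heat_solution_in_cone M "\<lambda>z. - u z" "\<lambda>b z. - u1 b z" "\<lambda>b z. - u2 b z" S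
      proof unfold_locales
        show "smooth_on (cylinder (cone_over M) 1) (\<lambda>z. - u z)"
          using u(1) Ck_on_mult[OF Ck_on_const[of _ _ "- 1"], of _ "cylinder (cone_over M) 1" u]
          by (simp add: smooth_on_def \<Omega>)
        show "zero_lateral_values (cone_over M) (\<lambda>z. - u z)"
          using u(3) tendsto_minus[of u 0] by (auto simp: zero_lateral_values_def \<Omega>)
        show "((\<lambda>y. - u (t, y)) has_derivative (\<lambda>h. \<Sum>b\<in>Basis. - u1 b (t, x) * (h \<bullet> b))) (at x)"
          if "(t, x) \<in> cylinder (cone_over M) 1" for t x
          using has_derivative_minus[OF d(3)[unfolded \<Omega>, OF that]] by (simp add: sum_negf)
        show "((\<lambda>s. - u (s, x)) has_real_derivative (\<Sum>b\<in>Basis. - u2 b (t, x))) (at t within {0<..1})"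
          if "(t, x) \<in> cylinder (cone_over M) 1" for t x
          using DERIV_minus[OF d(5)[unfolded \<Omega>, OF that]] by (simp add: sum_negf)
        show "((\<lambda>s. - u1 b (t, x + s *\<^sub>R b)) has_real_derivative - u2 b (t, x)) (at 0)"
          if "(t, x) \<in> cylinder (cone_over M) 1" "b \<in> Basis" for t x b
          using DERIV_minus[OF d(4)[unfolded \<Omega>, OF that]] .
      qed (use M d S S0 in \<open>auto simp: \<Omega> abs_le_iff intro!: continuous_intros\<close>)
      note hyps = L0 L[unfolded d_def] less_imp_le[OF assms(7)] n(1) n(2)[unfolded d_def] a t x[unfolded \<Omega>] x2
      have "u (t, x) \<le> A * S * norm x powr lam"
        using p.decay[OF hyps] by (simp add: A_def)
      moreover have "- u (t, x) \<le> A * S * norm x powr lam"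
        using m.decay[OF hyps] by (simp add: A_def)
      ultimately have "\<bar>u (t, x)\<bar> \<le> A * S * norm x powr lam" by linarith
      also have "\<dots> \<le> N * S * norm x powr lam"
        using S0 by (intro mult_right_mono) (auto simp: N_def)
      finally show ?thesis .
    next
      case False
      have "1 = \<rho> powr (- lam) * \<rho> powr lam" using \<rho> by (simp add: powr_minus)
      also have "\<dots> \<le> N * norm x powr lam"
        using False \<rho> A assms(7) by (intro mult_mono powr_mono2) (auto simp: N_def)
      finally have "S * 1 \<le> S * (N * norm x powr lam)" using S0 by (rule mult_left_mono)
      then show ?thesis using S[OF tx1] by (simp add: mult_ac)
    qed
  qed
  show ?thesis
  proof (intro exI[of _ N] conjI N allI impI ballI)
    fix u :: "real \<times> 'a \<Rightarrow> real" and z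
    assume u: "smooth_on (cylinder \<Omega> 1) u \<and> heat_solution \<Omega> u \<and> zero_lateral_values \<Omega> u"
      and z: "z \<in> cylinder \<Omega> R"
    obtain t x where tx: "z = (t, x)" by (cases z)
    define B where "B = (SUP z \<in> cylinder \<Omega> 1. ereal \<bar>u z\<bar>)"
    have le_B: "ereal \<bar>u z\<bar> \<le> B" if "z \<in> cylinder \<Omega> 1" for z
      unfolding B_def using that by (rule SUP_upper)
    have z1: "(t, x) \<in> cylinder \<Omega> 1" using z R2 assms(10) by (auto simp: tx cylinder_def)
    have x0: "x \<noteq> 0" using z by (auto simp: tx cylinder_def \<Omega> cone_over_eq[OF Ms])
    have "ereal \<bar>u (t, x)\<bar> \<le> ereal N * B * ereal (norm x powr lam)"
    proof (cases B)
      case (real S)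
      have "\<bar>u (t, x)\<bar> \<le> N * S * norm x powr lam"
        using u z le_B by (intro bound) (auto simp: tx real)
      then show ?thesis by (simp add: real)
    next
      \<comment> \<open>For unbounded \<open>u\<close> the right-hand side is infinite, because
        \<open>N\<close> and \<open>norm x powr lam\<close> are strictly positive.\<close>
      case PInf
      then show ?thesis using N x0 by simp
    next
      case MInf
      then show ?thesis using le_B[OF z1] by simp
    qed
    then show "case z of (t, x) \<Rightarrow> ereal \<bar>u (t, x)\<bar> \<le>
        ereal N * (SUP z \<in> cylinder \<Omega> 1. ereal \<bar>u z\<bar>) * ereal (norm x powr lam)"
      by (simp add: tx B_def)
  qed
qed

end
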